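(* Let $\mathfrak{g}$ be a simple simply laced complex Lie algebra, let $i\in I$ be such that $\omega_i$ is minuscule and let $\mathbf{i}\in R(w_0)$. For all $t\in\mathbb{R}^N$ we have $$[\varsigma_{\mathbf{i},i}]_{trop}(t)=\min_{\pi}\sum_{k=1}^N d_k(\pi)\,t_k,$$ where the minimum is taken over all $\mathbf{i}$-trails $\pi$ from $\omega^{\vee}_{i^*}$ to $w_0s_{i^*}\omega^{\vee}_{i^*}$ in the ${}^L\mathfrak{g}$-module $V(\omega^{\vee}_{i^*})$.
   Context: Setting. $\mathfrak{g}$ has rank $n$, $I=\{1,\dots,n\}$, Cartan matrix $(c_{i,j})$, Cartan subalgebra $\mathfrak{h}$, root system $\Delta\subset\mathfrak{h}^*$ with simple roots $\alpha_i$, simple coroots $\alpha_i^\vee\in\mathfrak{h}$, fundamental weights $\omega_i$, Weyl group $W$ with simple reflections $s_i$, longest element $w_0$ of length $N$. For $i\in I$, $i^*\in I$ is determined by $w_0\omega_i=-\omega_{i^*}$. The Langlands dual ${}^L\mathfrak{g}$ is the simple Lie algebra with Cartan subalgebra $\mathfrak{h}^*$, simple roots $\alpha_i^\vee$, simple coroots $\alpha_i$ and fundamental weights $\omega_i^\vee\in\mathfrak{h}$, $\alpha_j(\omega_i^\vee)=\delta_{i,j}$; $V(\lambda)$ is its irreducible module of highest weight $\lambda$. $\omega_i$ is minuscule if $\beta(\omega_i^\vee)\in\{-1,0,1\}$ for all $\beta\in\Delta$. $R(w_0)$ is the set of reduced words $\mathbf{i}=(i_1,\dots,i_N)$ of $w_0$,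 i.e. $w_0=s_{i_1}\cdots s_{i_N}$. $\mathbf{i}$-trails. Let $V$ be a finite-dimensional ${}^L\mathfrak{g}$-module, with Chevalley raising operators $e_j$, and $\gamma,\delta$ weights of $V$. A sequence of weights $\pi=(\gamma=\gamma_0,\gamma_1,\dots,\gamma_N=\delta)$ is an $\mathbf{i}$-trail from $\gamma$ to $\delta$ if $\gamma_{k-1}-\gamma_k=c_k\alpha^\vee_{i_k}$ with $c_k\in\mathbb{Z}_{\ge0}$ for all $k$, and $e_{i_1}^{c_1}e_{i_2}^{c_2}\cdots e_{i_N}^{c_N}$ is a non-zero map from the weight space $V_\delta$ to $V_\gamma$. Put $d_k(\pi)=\alpha_{i_k}\!\left(\tfrac{\gamma_{k-1}+\gamma_k}{2}\right)$. Moves. A word $\mathbf{j}$ is obtained from $\mathbf{i}$ by a $2$-term move at position $k$ if $(j_k,j_{k+1})=(i_{k+1},i_k)$, $c_{i_k,i_{k+1}}=0$, and all other letters agree; by a $3$-term move at position $k$ if $j_{k-1}=j_{k+1}=i_k$, $j_k=i_{k-1}=i_{k+1}$, $c_{i_k,i_{k+1}}=-1$, and all other letters agree. Any two elements of $R(w_0)$ are connected by such moves. String transition maps. If $\mathbf{j}$ arises from $\mathbf{i}$ by a $3$-term move at position $k$, the piecewise linear map $\Psi^{\mathbf{i}}_{\mathbf{j}}$, $x\mapsto x'$, is $x'_{k-1}=\max(x_{k+1},x_k-x_{k-1})$, $x'_k=x_{k-1}+x_{k+1}$, $x'_{k+1}=\min(x_{k-1},x_k-x_{k+1})$, other coordinates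 unchanged; for a $2$-term move at position $k$ it swaps $x_k$ and $x_{k+1}$. The subtraction-free birational lift $\widehat\Psi^{\mathbf{i}}_{\mathbf{j}}:(\mathbb{C}^* )^N\dashrightarrow(\mathbb{C}^* )^N$ is, for a $3$-term move, $x'_{k-1}=\frac{x_kx_{k+1}}{x_k+x_{k-1}x_{k+1}}$, $x'_k=x_{k-1}x_{k+1}$, $x'_{k+1}=x_{k-1}+\frac{x_k}{x_{k+1}}$, other coordinates unchanged, and for a $2$-term move the same swap; its tropicalization is $\Psi^{\mathbf{i}}_{\mathbf{j}}$. For arbitrary $\mathbf{i},\mathbf{j}$ one composes along a sequence of moves. The functions $\varsigma_{\mathbf{i},i}$ ($\mathbf{i}\in R(w_0)$, $i\in I$) are the rational functions in $x_1,\dots,x_N$ determined by: (1) if $i_N=i$ then $\varsigma_{\mathbf{i},i}(x)=x_N$; (2) $\varsigma_{\mathbf{i},i}\circ\widehat\Psi^{\mathbf{j}}_{\mathbf{i}}=\varsigma_{\mathbf{j},i}$ for all $\mathbf{i},\mathbf{j}\in R(w_0)$. They are Laurent polynomials with non-negative integer coefficients. For such a Laurent polynomial $f=\sum_u a_ux^u$, $[f]_{trop}(t)=\min_{u:\,a_u\ne0}\langle t,u\rangle$ with the standard inner product. *)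

theory Defs
  imports Complex_Main "HOL-Library.Poly_Mapping" "HOL-Computational_Algebra.Fraction_Field"
begin

section \<open>Simple complex Lie algebras with a Cartan subalgebra and Chevalley generators\<close>

text \<open>
  The type \<open>'g\<close> is the underlying space of the Lie algebra. The simple roots, the simple
  coroots and the Chevalley generators are numbered by \<open>{1..rank}\<close>; the values of the
  corresponding fields at other numbers are irrelevant.
\<close>

record 'g lie_data =
  smult :: "complex \<Rightarrow> 'g \<Rightarrow> 'g"
  brk :: "'g \<Rightarrow> 'g \<Rightarrow> 'g"
  csa :: "'g set"
  rank :: nat
  sroot :: "nat \<Rightarrow> 'g \<Rightarrow> complex"
  scoroot :: "nat \<Rightarrow> 'g"
  raising :: "nat \<Rightarrow> 'g"
  lowering :: "nat \<Rightarrow> 'g"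

definition index_set :: "'g lie_data \<Rightarrow> nat set" where
  "index_set G = {1..rank G}"

definition finite_dim :: "(complex \<Rightarrow> 'v::ab_group_add \<Rightarrow> 'v) \<Rightarrow> bool" where
  "finite_dim sc \<longleftrightarrow> vector_space sc \<and> (\<exists>B. finite B \<and> module.span sc B = UNIV)"

definition lie_algebra :: "'g::ab_group_add lie_data \<Rightarrow> bool" where
  "lie_algebra G \<longleftrightarrow>
     vector_space (smult G) \<and>
     (\<forall>x y z. brk G (x + y) z = brk G x z + brk G y z) \<and>
     (\<forall>x y z. brk G x (y + z) = brk G x y + brk G x z) \<and>
     (\<forall>a x y. brk G (smult G a x) y = smult G a (brk G x y)) \<and>
     (\<forall>a x y. brk G x (smult G a y) = smult G a (brk G x y)) \<and>
     (\<forall>x. brk G x x = 0) \<and>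
     (\<forall>x y z. brk G x (brk G y z) + brk G y (brk G z x) + brk G z (brk G x y) = 0)"

definition lie_ideal :: "'g::ab_group_add lie_data \<Rightarrow> 'g set \<Rightarrow> bool" where
  "lie_ideal G J \<longleftrightarrow> module.subspace (smult G) J \<and> (\<forall>x. \<forall>y\<in>J. brk G x y \<in> J)"

definition lie_subalgebra :: "'g::ab_group_add lie_data \<Rightarrow> 'g set \<Rightarrow> bool" where
  "lie_subalgebra G S \<longleftrightarrow> module.subspace (smult G) S \<and> (\<forall>x\<in>S. \<forall>y\<in>S. brk G x y \<in> S)"

definition simple_lie :: "'g::ab_group_add lie_data \<Rightarrow> bool" where
  "simple_lie G \<longleftrightarrow> lie_algebra G \<and> (\<exists>x y. brk G x y \<noteq> 0) \<and>
     (\<forall>J. lie_ideal G J \<longrightarrow> J = {0} \<or> J = UNIV)"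

definition ad_diagonalizable :: "'g::ab_group_add lie_data \<Rightarrow> 'g \<Rightarrow> bool" where
  "ad_diagonalizable G x \<longleftrightarrow>
     module.span (smult G) {y. \<exists>c. brk G x y = smult G c y} = UNIV"

text \<open>A Cartan subalgebra (of a semisimple Lie algebra) is a toral subalgebra that equals its
  own centralizer; the last conjunct includes that it is abelian.\<close>

definition cartan_subalgebra :: "'g::ab_group_add lie_data \<Rightarrow> bool" where
  "cartan_subalgebra G \<longleftrightarrow>
     module.subspace (smult G) (csa G) \<and>
     (\<forall>x\<in>csa G. ad_diagonalizable G x) \<and>
     {x. \<forall>h\<in>csa G. brk G h x = 0} = csa G"

text \<open>Linear functionals on the Cartan subalgebra are represented by functions on the whole Lie
  algebra that vanish off the Cartan subalgebra, so that equality of functionals is equality of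
  functions.\<close>

definition dual_csa :: "'g::ab_group_add lie_data \<Rightarrow> ('g \<Rightarrow> complex) set" where
  "dual_csa G = {\<phi>. (\<forall>x\<in>csa G. \<forall>y\<in>csa G. \<phi> (x + y) = \<phi> x + \<phi> y) \<and>
                    (\<forall>a. \<forall>x\<in>csa G. \<phi> (smult G a x) = a * \<phi> x) \<and>
                    (\<forall>x. x \<notin> csa G \<longrightarrow> \<phi> x = 0)}"

definition root_space :: "'g lie_data \<Rightarrow> ('g \<Rightarrow> complex) \<Rightarrow> 'g set" where
  "root_space G \<beta> = {x. \<forall>h\<in>csa G. brk G h x = smult G (\<beta> h) x}"

definition root_system :: "'g::ab_group_add lie_data \<Rightarrow> ('g \<Rightarrow> complex) set" where
  "root_system G = {\<beta>\<in>dual_csa G. \<beta> \<noteq> (\<lambda>_. 0) \<and> (\<exists>x\<in>root_space G \<beta>. x \<noteq> 0)}"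

definition simple_roots_base :: "'g::ab_group_add lie_data \<Rightarrow> bool" where
  "simple_roots_base G \<longleftrightarrow>
     (\<forall>i\<in>index_set G. sroot G i \<in> root_system G) \<and>
     (\<forall>a. (\<forall>x. (\<Sum>i\<in>index_set G. a i * sroot G i x) = 0) \<longrightarrow> (\<forall>i\<in>index_set G. a i = 0)) \<and>
     (\<forall>\<beta>\<in>root_system G. \<exists>m :: nat \<Rightarrow> nat.
        \<beta> = (\<lambda>x. \<Sum>i\<in>index_set G. of_nat (m i) * sroot G i x) \<or>
        \<beta> = (\<lambda>x. - (\<Sum>i\<in>index_set G. of_nat (m i) * sroot G i x)))"

text \<open>The simple coroot is the element \<open>h\<close> of the line spanned by \<open>[g\<^sub>\<alpha>, g\<^sub>-\<^sub>\<alpha>]\<close> with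
  \<open>\<alpha> h = 2\<close>.\<close>

definition chevalley_generators :: "'g::ab_group_add lie_data \<Rightarrow> bool" where
  "chevalley_generators G \<longleftrightarrow>
     (\<forall>i\<in>index_set G.
        raising G i \<in> root_space G (sroot G i) \<and>
        lowering G i \<in> root_space G (\<lambda>x. - sroot G i x) \<and>
        sroot G i (scoroot G i) = 2) \<and>
     (\<forall>i\<in>index_set G. \<forall>j\<in>index_set G.
        brk G (raising G i) (lowering G j) = (if i = j then scoroot G i else 0)) \<and>
     (\<forall>S. lie_subalgebra G S \<and> raising G ` index_set G \<subseteq> S \<and> lowering G ` index_set G \<subseteq> S
        \<longrightarrow> S = UNIV)"

definition simple_lie_algebra :: "'g::ab_group_add lie_data \<Rightarrow> bool" where
  "simple_lie_algebra G \<longleftrightarrow>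
     simple_lie G \<and> finite_dim (smult G) \<and> cartan_subalgebra G \<and>
     simple_roots_base G \<and> chevalley_generators G"

definition cartan_entry :: "'g lie_data \<Rightarrow> nat \<Rightarrow> nat \<Rightarrow> complex" where
  "cartan_entry G i j = sroot G j (scoroot G i)"

definition simply_laced :: "'g lie_data \<Rightarrow> bool" where
  "simply_laced G \<longleftrightarrow>
     (\<forall>i\<in>index_set G. \<forall>j\<in>index_set G. i \<noteq> j \<longrightarrow> cartan_entry G i j \<in> {0, - 1})"


section \<open>Weights and the Weyl group\<close>

definition fund_weight :: "'g::ab_group_add lie_data \<Rightarrow> nat \<Rightarrow> 'g \<Rightarrow> complex" where
  "fund_weight G i = (THE \<omega>. \<omega> \<in> dual_csa G \<and>
     (\<forall>j\<in>index_set G. \<omega> (scoroot G j) = (if i = j then 1 else 0)))"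

definition fund_coweight :: "'g lie_data \<Rightarrow> nat \<Rightarrow> 'g" where
  "fund_coweight G i = (THE x. x \<in> csa G \<and>
     (\<forall>j\<in>index_set G. sroot G j x = (if i = j then 1 else 0)))"

definition minuscule :: "'g::ab_group_add lie_data \<Rightarrow> nat \<Rightarrow> bool" where
  "minuscule G i \<longleftrightarrow> (\<forall>\<beta>\<in>root_system G. \<beta> (fund_coweight G i) \<in> {- 1, 0, 1})"

text \<open>The Weyl group acts on the Cartan subalgebra. As \<open>sroot G i\<close> vanishes off the Cartan
  subalgebra, the maps below are the identity there, so they are permutations of the whole Lie
  algebra that are determined by their restriction to the Cartan subalgebra.\<close>

definition simple_reflection :: "'g::ab_group_add lie_data \<Rightarrow> nat \<Rightarrow> 'g \<Rightarrow> 'g" where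
  "simple_reflection G i x = x - smult G (sroot G i x) (scoroot G i)"

definition word_product :: "'g::ab_group_add lie_data \<Rightarrow> nat list \<Rightarrow> 'g \<Rightarrow> 'g" where
  "word_product G iw = foldr (\<lambda>i w. simple_reflection G i \<circ> w) iw id"

definition weyl_group :: "'g::ab_group_add lie_data \<Rightarrow> ('g \<Rightarrow> 'g) set" where
  "weyl_group G = word_product G ` lists (index_set G)"

definition weyl_length :: "'g::ab_group_add lie_data \<Rightarrow> ('g \<Rightarrow> 'g) \<Rightarrow> nat" where
  "weyl_length G w = (LEAST l. \<exists>iw\<in>lists (index_set G). length iw = l \<and> word_product G iw = w)"

definition longest_element :: "'g::ab_group_add lie_data \<Rightarrow> 'g \<Rightarrow> 'g" where
  "longest_element G = (THE w. w \<in> weyl_group G \<and>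
     (\<forall>v\<in>weyl_group G. weyl_length G v \<le> weyl_length G w))"

definition longest_length :: "'g::ab_group_add lie_data \<Rightarrow> nat" where
  "longest_length G = weyl_length G (longest_element G)"

definition reduced_words_w0 :: "'g::ab_group_add lie_data \<Rightarrow> nat list set" where
  "reduced_words_w0 G = {iw \<in> lists (index_set G).
     length iw = longest_length G \<and> word_product G iw = longest_element G}"

definition weyl_act_dual :: "('g \<Rightarrow> 'g) \<Rightarrow> ('g \<Rightarrow> complex) \<Rightarrow> 'g \<Rightarrow> complex" where
  "weyl_act_dual w \<phi> = \<phi> \<circ> inv w"

definition star_index :: "'g::ab_group_add lie_data \<Rightarrow> nat \<Rightarrow> nat" where
  "star_index G i = (THE j. j \<in> index_set G \<and>
     weyl_act_dual (longest_element G) (fund_weight G i) = (\<lambda>x. - fund_weight G j x))"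


section \<open>The Langlands dual and its modules\<close>

text \<open>\<open>\<iota>\<close> identifies the dual of the Cartan subalgebra of \<open>G\<close> with the Cartan subalgebra
  of \<open>L\<close>. Under this identification the simple coroots of \<open>L\<close> are the simple roots of \<open>G\<close>,
  and the simple roots of \<open>L\<close> are evaluation at the simple coroots of \<open>G\<close>.\<close>

definition langlands_dual ::
  "'g::ab_group_add lie_data \<Rightarrow> 'l::ab_group_add lie_data \<Rightarrow> (('g \<Rightarrow> complex) \<Rightarrow> 'l) \<Rightarrow> bool" where
  "langlands_dual G L \<iota> \<longleftrightarrow>
     simple_lie_algebra L \<and> rank L = rank G \<and>
     bij_betw \<iota> (dual_csa G) (csa L) \<and>
     (\<forall>\<phi>\<in>dual_csa G. \<forall>\<psi>\<in>dual_csa G. \<iota> (\<lambda>x. \<phi> x + \<psi> x) = \<iota> \<phi> + \<iota> \<psi>) \<and>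
     (\<forall>a. \<forall>\<phi>\<in>dual_csa G. \<iota> (\<lambda>x. a * \<phi> x) = smult L a (\<iota> \<phi>)) \<and>
     (\<forall>i\<in>index_set G. scoroot L i = \<iota> (sroot G i)) \<and>
     (\<forall>i\<in>index_set G. \<forall>\<phi>\<in>dual_csa G. sroot L i (\<iota> \<phi>) = \<phi> (scoroot G i))"

definition lie_module ::
  "'l::ab_group_add lie_data \<Rightarrow> (complex \<Rightarrow> 'v::ab_group_add \<Rightarrow> 'v) \<Rightarrow> ('l \<Rightarrow> 'v \<Rightarrow> 'v) \<Rightarrow> bool" where
  "lie_module L sc \<rho> \<longleftrightarrow>
     vector_space sc \<and>
     (\<forall>x y v. \<rho> (x + y) v = \<rho> x v + \<rho> y v) \<and>
     (\<forall>a x v. \<rho> (smult L a x) v = sc a (\<rho> x v)) \<and>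
     (\<forall>x u v. \<rho> x (u + v) = \<rho> x u + \<rho> x v) \<and>
     (\<forall>a x v. \<rho> x (sc a v) = sc a (\<rho> x v)) \<and>
     (\<forall>x y v. \<rho> (brk L x y) v = \<rho> x (\<rho> y v) - \<rho> y (\<rho> x v))"

definition irreducible_module ::
  "'l::ab_group_add lie_data \<Rightarrow> (complex \<Rightarrow> 'v::ab_group_add \<Rightarrow> 'v) \<Rightarrow> ('l \<Rightarrow> 'v \<Rightarrow> 'v) \<Rightarrow> bool" where
  "irreducible_module L sc \<rho> \<longleftrightarrow>
     lie_module L sc \<rho> \<and> (\<exists>v :: 'v. v \<noteq> 0) \<and>
     (\<forall>U. module.subspace sc U \<and> (\<forall>x. \<forall>u\<in>U. \<rho> x u \<in> U) \<longrightarrow> U = {0} \<or> U = UNIV)"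

text \<open>Weights of modules over the Langlands dual are elements of the Cartan subalgebra of \<open>G\<close>,
  regarded as functionals on its dual.\<close>

definition weight_space ::
  "'g::ab_group_add lie_data \<Rightarrow> (('g \<Rightarrow> complex) \<Rightarrow> 'l) \<Rightarrow> (complex \<Rightarrow> 'v::ab_group_add \<Rightarrow> 'v) \<Rightarrow>
   ('l \<Rightarrow> 'v \<Rightarrow> 'v) \<Rightarrow> 'g \<Rightarrow> 'v set" where
  "weight_space G \<iota> sc \<rho> \<mu> = {v. \<forall>\<phi>\<in>dual_csa G. \<rho> (\<iota> \<phi>) v = sc (\<phi> \<mu>) v}"

definition module_weights ::
  "'g::ab_group_add lie_data \<Rightarrow> (('g \<Rightarrow> complex) \<Rightarrow> 'l) \<Rightarrow> (complex \<Rightarrow> 'v::ab_group_add \<Rightarrow> 'v) \<Rightarrow>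
   ('l \<Rightarrow> 'v \<Rightarrow> 'v) \<Rightarrow> 'g set" where
  "module_weights G \<iota> sc \<rho> = {\<mu>\<in>csa G. \<exists>v\<in>weight_space G \<iota> sc \<rho> \<mu>. v \<noteq> 0}"

text \<open>\<open>(sc, \<rho>)\<close> is the finite-dimensional irreducible module of highest weight \<open>\<mu>\<close>, which is
  unique up to isomorphism.\<close>

definition highest_weight_module ::
  "'g::ab_group_add lie_data \<Rightarrow> 'l::ab_group_add lie_data \<Rightarrow> (('g \<Rightarrow> complex) \<Rightarrow> 'l) \<Rightarrow>
   (complex \<Rightarrow> 'v::ab_group_add \<Rightarrow> 'v) \<Rightarrow> ('l \<Rightarrow> 'v \<Rightarrow> 'v) \<Rightarrow> 'g \<Rightarrow> bool" where
  "highest_weight_module G L \<iota> sc \<rho> \<mu> \<longleftrightarrow>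
     irreducible_module L sc \<rho> \<and> finite_dim sc \<and> \<mu> \<in> csa G \<and>
     (\<exists>v\<in>weight_space G \<iota> sc \<rho> \<mu>. v \<noteq> 0 \<and> (\<forall>j\<in>index_set L. \<rho> (raising L j) v = 0))"


section \<open>Trails\<close>

text \<open>Words are lists; positions in a word are counted from \<open>1\<close>.\<close>

definition letter :: "nat list \<Rightarrow> nat \<Rightarrow> nat" where
  "letter iw k = iw ! (k - 1)"

text \<open>A trail \<open>(\<gamma>\<^sub>0, \<dots>, \<gamma>\<^sub>N)\<close> is the list of its weights, \<open>\<gamma>\<^sub>k = \<pi> ! k\<close>.\<close>

definition trails ::
  "'g::ab_group_add lie_data \<Rightarrow> 'l::ab_group_add lie_data \<Rightarrow> (('g \<Rightarrow> complex) \<Rightarrow> 'l) \<Rightarrow>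
   (complex \<Rightarrow> 'v::ab_group_add \<Rightarrow> 'v) \<Rightarrow> ('l \<Rightarrow> 'v \<Rightarrow> 'v) \<Rightarrow> nat list \<Rightarrow> 'g \<Rightarrow> 'g \<Rightarrow> 'g list set" where
  "trails G L \<iota> sc \<rho> iw \<gamma> \<delta> = {\<pi>.
     length \<pi> = length iw + 1 \<and> \<pi> ! 0 = \<gamma> \<and> \<pi> ! length iw = \<delta> \<and>
     set \<pi> \<subseteq> module_weights G \<iota> sc \<rho> \<and>
     (\<exists>c :: nat \<Rightarrow> nat.
        (\<forall>k\<in>{1..length iw}.
           \<pi> ! (k - 1) - \<pi> ! k = smult G (of_nat (c k)) (scoroot G (letter iw k))) \<and>
        (\<exists>v\<in>weight_space G \<iota> sc \<rho> \<delta>.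
           foldr (\<lambda>k T. (\<rho> (raising L (letter iw k)) ^^ c k) \<circ> T) [1..<length iw + 1] id v \<noteq> 0))}"

text \<open>The value of the root at the midpoint is a half-integral complex number; it is converted
  to a real number by \<open>Re\<close>.\<close>

definition trail_coeff :: "'g::ab_group_add lie_data \<Rightarrow> nat list \<Rightarrow> 'g list \<Rightarrow> nat \<Rightarrow> real" where
  "trail_coeff G iw \<pi> k =
     Re (sroot G (letter iw k) (smult G (1 / 2) (\<pi> ! (k - 1) + \<pi> ! k)))"


section \<open>Laurent polynomials and rational functions\<close>

text \<open>A Laurent polynomial maps exponent vectors to coefficients. The variables are
  \<open>x\<^sub>k\<close> for \<open>k :: nat\<close>; \<open>laurent_ring N\<close> is the subring of those in \<open>x\<^sub>1, \<dots>, x\<^sub>N\<close> only.\<close>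

type_synonym laurent = "(nat \<Rightarrow>\<^sub>0 int) \<Rightarrow>\<^sub>0 complex"
type_synonym ratfun = "laurent fract"

definition laurent_ring :: "nat \<Rightarrow> laurent set" where
  "laurent_ring N = {p. \<forall>u\<in>Poly_Mapping.keys p. Poly_Mapping.keys u \<subseteq> {1..N}}"

definition laurent_eval :: "laurent \<Rightarrow> (nat \<Rightarrow> complex) \<Rightarrow> complex" where
  "laurent_eval p x = (\<Sum>u\<in>Poly_Mapping.keys p.
     Poly_Mapping.lookup p u * (\<Prod>k\<in>Poly_Mapping.keys u. x k powi Poly_Mapping.lookup u k))"

definition laurent_var :: "nat \<Rightarrow> laurent" where
  "laurent_var k = Poly_Mapping.single (Poly_Mapping.single k 1) 1"

definition ratfun_field :: "nat \<Rightarrow> ratfun set" where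
  "ratfun_field N = {Fract p q | p q. p \<in> laurent_ring N \<and> q \<in> laurent_ring N \<and> q \<noteq> 0}"

text \<open>The rational function \<open>r\<close> is regular at the point \<open>x\<close> of the torus, with value \<open>v\<close>.\<close>

definition ratfun_value :: "nat \<Rightarrow> ratfun \<Rightarrow> (nat \<Rightarrow> complex) \<Rightarrow> complex \<Rightarrow> bool" where
  "ratfun_value N r x v \<longleftrightarrow>
     (\<exists>p\<in>laurent_ring N. \<exists>q\<in>laurent_ring N. q \<noteq> 0 \<and> r = Fract p q \<and>
        laurent_eval q x \<noteq> 0 \<and> v = laurent_eval p x / laurent_eval q x)"

text \<open>For \<open>r\<close> that is a Laurent polynomial; meaningless otherwise.\<close>

definition laurent_of_ratfun :: "ratfun \<Rightarrow> laurent" where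
  "laurent_of_ratfun r = (THE p. r = Fract p 1)"

definition tropicalization :: "laurent \<Rightarrow> (nat \<Rightarrow> real) \<Rightarrow> real" where
  "tropicalization p t = Min ((\<lambda>u. \<Sum>k\<in>Poly_Mapping.keys u.
     t k * of_int (Poly_Mapping.lookup u k)) ` Poly_Mapping.keys p)"


section \<open>Moves and transition maps\<close>

definition two_term_move :: "'g lie_data \<Rightarrow> nat \<Rightarrow> nat list \<Rightarrow> nat list \<Rightarrow> bool" where
  "two_term_move G k iw jw \<longleftrightarrow>
     length jw = length iw \<and> 1 \<le> k \<and> k + 1 \<le> length iw \<and>
     letter jw k = letter iw (k + 1) \<and> letter jw (k + 1) = letter iw k \<and>
     cartan_entry G (letter iw k) (letter iw (k + 1)) = 0 \<and>
     (\<forall>l\<in>{1..length iw} - {k, k + 1}. letter jw l = letter iw l)"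

definition three_term_move :: "'g lie_data \<Rightarrow> nat \<Rightarrow> nat list \<Rightarrow> nat list \<Rightarrow> bool" where
  "three_term_move G k iw jw \<longleftrightarrow>
     length jw = length iw \<and> 2 \<le> k \<and> k + 1 \<le> length iw \<and>
     letter jw (k - 1) = letter iw k \<and> letter jw (k + 1) = letter iw k \<and>
     letter jw k = letter iw (k - 1) \<and> letter jw k = letter iw (k + 1) \<and>
     cartan_entry G (letter iw k) (letter iw (k + 1)) = - 1 \<and>
     (\<forall>l\<in>{1..length iw} - {k - 1, k, k + 1}. letter jw l = letter iw l)"

definition torus :: "nat \<Rightarrow> (nat \<Rightarrow> complex) set" where
  "torus N = {x. \<forall>k\<in>{1..N}. x k \<noteq> 0}"

definition two_term_map :: "nat \<Rightarrow> (nat \<Rightarrow> complex) \<Rightarrow> nat \<Rightarrow> complex" where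
  "two_term_map k x = x(k := x (k + 1), k + 1 := x k)"

definition three_term_map :: "nat \<Rightarrow> (nat \<Rightarrow> complex) \<Rightarrow> nat \<Rightarrow> complex" where
  "three_term_map k x = x(
     k - 1 := x k * x (k + 1) / (x k + x (k - 1) * x (k + 1)),
     k := x (k - 1) * x (k + 1),
     k + 1 := x (k - 1) + x k / x (k + 1))"

text \<open>\<open>transition G iw x jw y\<close>: the composite of the birational maps along some sequence of moves
  from \<open>iw\<close> to \<open>jw\<close> is defined at the point \<open>x\<close> of the torus and takes it to \<open>y\<close>. The side
  condition in the last rule is the domain of definition of the map of a 3-term move, as a map
  from the torus to itself.\<close>

inductive transition ::
  "'g lie_data \<Rightarrow> nat list \<Rightarrow> (nat \<Rightarrow> complex) \<Rightarrow> nat list \<Rightarrow> (nat \<Rightarrow> complex) \<Rightarrow> bool"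
  for G iw x where
  start: "x \<in> torus (length iw) \<Longrightarrow> transition G iw x iw x"
| two_term: "transition G iw x jw y \<Longrightarrow> two_term_move G k jw kw \<Longrightarrow>
     transition G iw x kw (two_term_map k y)"
| three_term: "transition G iw x jw y \<Longrightarrow> three_term_move G k jw kw \<Longrightarrow>
     y k + y (k - 1) * y (k + 1) \<noteq> 0 \<Longrightarrow> transition G iw x kw (three_term_map k y)"


section \<open>The functions \<open>\<varsigma>\<close>\<close>

text \<open>The family \<open>F\<close> is indexed by the reduced words, for one fixed \<open>i\<close>. The last conjunct is
  the equality of the rational function \<open>F iw\<close>, composed with the birational map from \<open>jw\<close> to
  \<open>iw\<close>, and the rational function \<open>F jw\<close>: equality at all points where both sides are
  defined.\<close>

definition sigma_family :: "'g::ab_group_add lie_data \<Rightarrow> nat \<Rightarrow> (nat list \<Rightarrow> ratfun) \<Rightarrow> bool" where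
  "sigma_family G i F \<longleftrightarrow>
     (\<forall>iw\<in>reduced_words_w0 G. F iw \<in> ratfun_field (longest_length G)) \<and>
     (\<forall>iw\<in>reduced_words_w0 G. letter iw (longest_length G) = i \<longrightarrow>
        F iw = Fract (laurent_var (longest_length G)) 1) \<and>
     (\<forall>iw\<in>reduced_words_w0 G. \<forall>jw\<in>reduced_words_w0 G. \<forall>x y a b.
        transition G jw x iw y \<and>
        ratfun_value (longest_length G) (F iw) y a \<and>
        ratfun_value (longest_length G) (F jw) x b \<longrightarrow> a = b)"

definition sigma :: "'g::ab_group_add lie_data \<Rightarrow> nat list \<Rightarrow> nat \<Rightarrow> ratfun" where
  "sigma G iw i = (THE r. \<exists>F. sigma_family G i F \<and> r = F iw)"

end

theory Submission
  imports Defs "HOL-Library.FuncSet"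
begin

text \<open>
  Everything is expressed in the coordinates \<open>j \<mapsto> \<alpha>\<^sub>j x\<close> of a coweight \<open>x\<close>. The weights of a
  minuscule module form one Weyl group orbit on which these coordinates lie in \<open>{-1, 0, 1}\<close>, and a
  raising operator is nonzero exactly where the coordinate is \<open>-1\<close>. Hence trails are paths in the
  orbit, and summing the monomials with exponents \<open>d\<^sub>k\<close> over all trails gives a matrix coefficient
  of the product of the operators that map a vector of weight \<open>\<mu>\<close> to \<open>x\<^sup>m\<close> times itself, where
  \<open>m = \<alpha>\<^sub>j \<mu>\<close>, plus its image under the raising operator. These operators satisfy the braid relations
  with the parameters changed by the transition maps. If the word ends in \<open>i\<close>, then a trail can
  only avoid the extremal weights by staying strictly below them in the dominance order, so it
  never reaches the highest weight; one trail is left and the sum is \<open>x\<^sub>N\<close>. By Matsumoto's theorem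
  the two properties determine the functions, because the moves are involutions of the positive
  points of the torus.
\<close>

section \<open>Weyl groups of simply laced Cartan matrices\<close>

text \<open>\<open>sigma\<close> is a definite description over families whose members are compared
  pointwise, wherever both sides are regular. Hence existence and uniqueness are both needed:
  existence is the invariance of the trail sums, and uniqueness requires that every positive point
  be reached from a word ending in \<open>i\<close>. The minimum over trails appears because the
  sums have natural coefficients: no monomial cancels, so the exponents that occur are exactly those
  of the trails. A lowering step has exponent 0, since the coordinates 1 and -1 at its ends have
  mean 0. The hypothesis speaks of \<open>i\<close> but the module belongs to the star of
  \<open>i\<close>; the longest element exchanges the two up to sign and carries the bound over.
  Besides the Cartan matrix, the combinatorics of words takes only sign coherence and finiteness of
  the roots from Lie theory. Both rest on the fact that a reflected root is a root, which comes from
  sl2-strings in the adjoint representation; the same strings give the Weyl invariance of the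
  weights of the module.\<close>

type_synonym vec = "nat \<Rightarrow> int"

text \<open>One function serves twice: as a simple root, in the basis of simple roots, and as a
  fundamental coweight, in the coordinates given by the values of the simple roots.\<close>

definition unit :: "nat \<Rightarrow> nat \<Rightarrow> int" where
  "unit i = (\<lambda>j. if j = i then 1 else 0)"

lemma sum_unit:
  assumes "finite I" "i \<in> I"
  shows "(\<Sum>j\<in>I. f j * unit i j) = f i" "(\<Sum>j\<in>I. unit i j * f j) = f i"
proof -
  have "(\<Sum>j\<in>I. f j * unit i j) = (\<Sum>j\<in>I. if j = i then f j else 0)"
    by (intro sum.cong) (auto simp: unit_def)
  then show "(\<Sum>j\<in>I. f j * unit i j) = f i" using assms by simp
  then show "(\<Sum>j\<in>I. unit i j * f j) = f i" by (simp add: mult.commute)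
qed

text \<open>Vectors are total functions on the naturals. The value 0 outside \<open>I\<close> makes
  \<open>dual_refl\<close> fix the coordinates there, so that equality of coweights can be equality
  of functions. Symmetry lets the Cartan matrix itself define an invariant bilinear form.\<close>

locale cartan_matrix =
  fixes I :: "nat set" and c :: "nat \<Rightarrow> nat \<Rightarrow> int"
  assumes finite_I: "finite I"
    and diag: "i \<in> I \<Longrightarrow> c i i = 2"
    and sym: "c i j = c j i"
    and off_diag: "i \<in> I \<Longrightarrow> j \<in> I \<Longrightarrow> i \<noteq> j \<Longrightarrow> c i j = 0 \<or> c i j = - 1"
    and outside: "j \<notin> I \<Longrightarrow> c i j = 0"
begin

text \<open>The evaluation of a root lattice vector, given by its coefficients at the simple roots,
  at the simple coroot \<open>i\<close>.\<close>

definition pair :: "nat \<Rightarrow> vec \<Rightarrow> int" where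
  "pair i q = (\<Sum>j\<in>I. c i j * q j)"

definition refl :: "nat \<Rightarrow> vec \<Rightarrow> nat \<Rightarrow> int" where
  "refl i q = (\<lambda>k. q k - pair i q * unit i k)"

definition act :: "nat list \<Rightarrow> vec \<Rightarrow> nat \<Rightarrow> int" where
  "act w q = foldr refl w q"

definition form :: "vec \<Rightarrow> vec \<Rightarrow> int" where
  "form p q = (\<Sum>j\<in>I. p j * pair j q)"

text \<open>The same reflection on coweights, where \<open>p j\<close> is the value of the simple
  root \<open>j\<close>: the row \<open>c i\<close> is the simple coroot \<open>i\<close> in these
  coordinates. It is adjoint to \<open>refl\<close> with respect to \<open>pairing\<close>.\<close>

definition dual_refl :: "nat \<Rightarrow> vec \<Rightarrow> nat \<Rightarrow> int" where
  "dual_refl i p = (\<lambda>j. p j - p i * c i j)"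

definition dual_act :: "nat list \<Rightarrow> vec \<Rightarrow> nat \<Rightarrow> int" where
  "dual_act w p = foldr dual_refl w p"

definition pairing :: "vec \<Rightarrow> vec \<Rightarrow> int" where
  "pairing p q = (\<Sum>j\<in>I. p j * q j)"

lemma act_simps [simp]: "act [] q = q" "act (i # w) q = refl i (act w q)"
  by (simp_all add: act_def)

lemma act_append: "act (u @ w) q = act u (act w q)"
  by (simp add: act_def)

lemma dual_act_simps [simp]: "dual_act [] q = q" "dual_act (i # w) q = dual_refl i (dual_act w q)"
  by (simp_all add: dual_act_def)

lemma dual_act_append: "dual_act (u @ w) q = dual_act u (dual_act w q)"
  by (simp add: dual_act_def)

lemma pair_unit [simp]: "j \<in> I \<Longrightarrow> pair i (unit j) = c i j"
  by (simp add: pair_def sum_unit finite_I)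

lemma pair_add: "pair i (\<lambda>k. p k + q k) = pair i p + pair i q"
  by (simp add: pair_def algebra_simps sum.distrib)

lemma pair_diff: "pair i (\<lambda>k. p k - q k) = pair i p - pair i q"
  by (simp add: pair_def algebra_simps sum_subtractf)

lemma pair_scale: "pair i (\<lambda>k. a * q k) = a * pair i q"
  by (simp add: pair_def sum_distrib_left algebra_simps)

lemma refl_apply: "refl i q k = q k - pair i q * unit i k"
  by (simp add: refl_def)

lemma pair_refl: "i \<in> I \<Longrightarrow> pair j (refl i q) = pair j q - c j i * pair i q"
  unfolding refl_def pair_diff pair_scale by simp

lemma refl_refl [simp]: "i \<in> I \<Longrightarrow> refl i (refl i q) = q"
  by (subst refl_def) (simp add: pair_refl diag, simp add: refl_def)

lemma refl_unit: "j \<in> I \<Longrightarrow> refl i (unit j) = (\<lambda>k. unit j k - c i j * unit i k)"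
  by (simp add: refl_def)

lemma refl_unit_self [simp]: "i \<in> I \<Longrightarrow> refl i (unit i) = (\<lambda>k. - unit i k)"
  by (simp add: refl_def diag)

lemma refl_uminus: "refl i (\<lambda>k. - q k) = (\<lambda>k. - refl i q k)"
  using pair_scale[of i "-1" q] by (simp add: refl_def)

lemma act_uminus: "act w (\<lambda>k. - q k) = (\<lambda>k. - act w q k)"
  by (induction w) (simp_all add: refl_uminus)

lemma refl_add: "refl i (\<lambda>k. p k + q k) = (\<lambda>k. refl i p k + refl i q k)"
  by (simp add: refl_def pair_add algebra_simps)

lemma act_add: "act w (\<lambda>k. p k + q k) = (\<lambda>k. act w p k + act w q k)"
  by (induction w) (simp_all add: refl_add)

lemma refl_scale: "refl i (\<lambda>k. a * q k) = (\<lambda>k. a * refl i q k)"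
  by (simp add: refl_def pair_scale algebra_simps)

lemma act_scale: "act w (\<lambda>k. a * q k) = (\<lambda>k. a * act w q k)"
  by (induction w) (simp_all add: refl_scale)

lemma refl_zero: "refl i (\<lambda>_. 0) = (\<lambda>_. 0)"
  by (simp add: refl_def pair_def)

lemma act_zero: "act w (\<lambda>_. 0) = (\<lambda>_. 0)"
  by (induction w) (simp_all add: refl_zero)

lemma act_sum: "finite J \<Longrightarrow> act w (\<lambda>k. \<Sum>j\<in>J. a j * q j k) = (\<lambda>k. \<Sum>j\<in>J. a j * act w (q j) k)"
  by (induction J rule: finite_induct) (simp_all add: act_zero act_add act_scale)

lemma act_rev [simp]:
  assumes "w \<in> lists I" shows "act (rev w) (act w q) = q" "act w (act (rev w) q) = q"
proof -
  have 1: "\<And>q. w \<in> lists I \<Longrightarrow> act (rev w) (act w q) = q" for w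
    by (induction w) (auto simp: act_append)
  show "act (rev w) (act w q) = q" using 1 assms by blast
  show "act w (act (rev w) q) = q" using 1[of "rev w" q] assms by (simp add: in_lists_conv_set)
qed

lemma act_rev_eq_iff:
  assumes "u \<in> lists I" "w \<in> lists I" shows "act (rev u) = act (rev w) \<longleftrightarrow> act u = act w"
  by (metis act_rev assms ext)

lemma form_unit: "i \<in> I \<Longrightarrow> form (unit i) q = pair i q"
  by (simp add: form_def sum_unit finite_I)

lemma form_sym: "form p q = form q p"
proof -
  have "form p q = (\<Sum>j\<in>I. \<Sum>k\<in>I. p j * c j k * q k)"
    by (simp add: form_def pair_def sum_distrib_left algebra_simps)
  also have "\<dots> = (\<Sum>k\<in>I. \<Sum>j\<in>I. p j * c j k * q k)" by (rule sum.swap)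
  also have "\<dots> = (\<Sum>k\<in>I. \<Sum>j\<in>I. q k * (c k j * p j))"
    using sym by (intro sum.cong refl) (simp add: algebra_simps)
  also have "\<dots> = form q p" by (simp add: form_def pair_def sum_distrib_left)
  finally show ?thesis .
qed

lemma form_refl: "i \<in> I \<Longrightarrow> form (refl i p) (refl i q) = form p q"
proof -
  assume i: "i \<in> I"
  have *: "form (\<lambda>k. f k - a * g k) q = form f q - a * form g q" for f g q a
    by (simp add: form_def algebra_simps sum_subtractf sum_distrib_left)
  have "form (refl i p) r = form p r - pair i p * pair i r" for p r
    unfolding refl_def * using form_unit[OF i] by simp
  then have "form (refl i p) (refl i q) = form p (refl i q) - pair i p * pair i (refl i q)" by simp
  also have "form p (refl i q) = form q p - pair i q * pair i p"
    unfolding form_sym[of p] by (simp add: \<open>\<And>r p. form (refl i p) r = form p r - pair i p * pair i r\<close>)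
  finally show ?thesis using i by (simp add: pair_refl diag form_sym[of q p])
qed

lemma form_act: "w \<in> lists I \<Longrightarrow> form (act w p) (act w q) = form p q"
  by (induction w) (auto simp: form_refl)

text \<open>The form is invariant, so \<open>w\<close> carries the pairing with
  \<open>unit i\<close> to the pairing with its image. Conjugating a reflection by \<open>w\<close>
  thus gives the reflection in the image root, here again a simple one.\<close>

lemma refl_conjugate:
  assumes w: "w \<in> lists I" and "i \<in> I" "j \<in> I" and eq: "act w (unit i) = unit j"
  shows "act w (refl i q) = refl j (act w q)"
proof -
  have "pair j (act w q) = form (act w (unit i)) (act w q)" using assms form_unit by simp
  also have "\<dots> = pair i q" unfolding form_act[OF w] using form_unit assms by simp
  finally have p: "pair j (act w q) = pair i q" .
  have "act w (refl i q) = act w (\<lambda>k. q k + (- pair i q) * unit i k)" by (simp add: refl_def)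
  also have "\<dots> = refl j (act w q)" unfolding act_add act_scale eq by (simp add: refl_def p)
  finally show ?thesis .
qed

lemma pairing_unit: "i \<in> I \<Longrightarrow> pairing p (unit i) = p i" "i \<in> I \<Longrightarrow> pairing (unit i) q = q i"
  by (simp_all add: pairing_def sum_unit finite_I)

lemma pairing_dual_refl: "i \<in> I \<Longrightarrow> pairing (dual_refl i p) q = pairing p (refl i q)"
proof -
  assume i: "i \<in> I"
  have "pairing p (refl i q) = pairing p q - pair i q * pairing p (unit i)"
    by (simp add: pairing_def refl_def algebra_simps sum_subtractf sum_distrib_left)
  moreover have "pairing (dual_refl i p) q = pairing p q - p i * pair i q"
    by (simp add: pairing_def dual_refl_def pair_def algebra_simps sum_subtractf sum_distrib_left)
  ultimately show ?thesis using i by (simp add: pairing_unit)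
qed

lemma pairing_dual_act: "w \<in> lists I \<Longrightarrow> pairing (dual_act w p) q = pairing p (act (rev w) q)"
  by (induction w arbitrary: q) (auto simp: pairing_dual_refl act_append)

lemma dual_act_nth: "w \<in> lists I \<Longrightarrow> j \<in> I \<Longrightarrow> dual_act w p j = pairing p (act (rev w) (unit j))"
  using pairing_dual_act pairing_unit(1) by metis

lemma dual_refl_dual_refl [simp]: "i \<in> I \<Longrightarrow> dual_refl i (dual_refl i p) = p"
  by (simp add: dual_refl_def diag)

end

section \<open>Signs of roots, reduced words and the longest element\<close>

definition nonneg :: "vec \<Rightarrow> bool" where "nonneg q \<longleftrightarrow> (\<forall>k. 0 \<le> q k)"
definition nonpos :: "vec \<Rightarrow> bool" where "nonpos q \<longleftrightarrow> (\<forall>k. q k \<le> 0)"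

locale root_datum = cartan_matrix +
  assumes sign_coherent: "w \<in> lists I \<Longrightarrow> i \<in> I \<Longrightarrow> nonneg (act w (unit i)) \<or> nonpos (act w (unit i))"
    and finite_roots: "finite {act w (unit i) |w i. w \<in> lists I \<and> i \<in> I}"
begin

definition reduced :: "nat list \<Rightarrow> bool" where
  "reduced w \<longleftrightarrow> w \<in> lists I \<and> (\<forall>u\<in>lists I. act u = act w \<longrightarrow> length w \<le> length u)"

lemma unit_nonneg: "nonneg (unit i)" "\<not> nonpos (unit i)"
  by (auto simp: nonneg_def nonpos_def unit_def intro!: exI[of _ i])

lemma nonneg_nonpos_uminus [simp]:
  "nonneg (\<lambda>k. - q k) \<longleftrightarrow> nonpos q" "nonpos (\<lambda>k. - q k) \<longleftrightarrow> nonneg q"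
  by (auto simp: nonneg_def nonpos_def)

lemma not_both_signs:
  assumes "w \<in> lists I" "nonneg (act w (unit i))" "nonpos (act w (unit i))" shows False
proof -
  have "act w (unit i) = (\<lambda>_. 0)" using assms(2,3) by (auto simp: nonneg_def nonpos_def intro: antisym)
  then have "unit i = (\<lambda>_. 0)" using act_rev(1)[OF assms(1), of "unit i"] by (simp add: act_zero)
  then show False using unit_nonneg(2)[of i] by (simp add: nonpos_def)
qed

lemma nonneg_iff: "w \<in> lists I \<Longrightarrow> i \<in> I \<Longrightarrow> nonneg (act w (unit i)) \<longleftrightarrow> \<not> nonpos (act w (unit i))"
  using sign_coherent not_both_signs by blast

text \<open>A simple reflection changes only the coefficient at \<open>j\<close>, so a positive root
  that it makes negative is concentrated at \<open>j\<close>.\<close>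

lemma refl_nonpos_imp_simple:
  assumes w: "w \<in> lists I" and i: "i \<in> I" and j: "j \<in> I"
    and pos: "nonneg (act w (unit i))" and neg: "nonpos (refl j (act w (unit i)))"
  shows "act w (unit i) = unit j"
proof -
  let ?q = "act w (unit i)"
  have off: "?q k = 0" if "k \<noteq> j" for k
    using that pos neg by (auto simp: nonneg_def nonpos_def refl_def unit_def intro: antisym dest!: spec[of _ k])
  have q: "?q = (\<lambda>k. ?q j * unit j k)"
    using off by (auto simp: unit_def fun_eq_iff)
  \<comment> \<open>Undoing \<open>w\<close> exhibits \<open>unit i\<close> as \<open>?q j\<close>
    times an integer vector, so \<open>?q j\<close> divides 1.\<close>
  have "unit i = act (rev w) (\<lambda>k. ?q j * unit j k)"
    using act_rev(1)[OF w, of "unit i"] q by simp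
  then have "unit i i = ?q j * act (rev w) (unit j) i" unfolding act_scale by metis
  then have "1 = ?q j * act (rev w) (unit j) i" by (simp add: unit_def)
  moreover have "0 \<le> ?q j" using pos by (simp add: nonneg_def)
  ultimately have "?q j = 1" by (metis zmult_eq_1_iff order.asym zero_le_numeral neg_0_le_iff_le not_one_le_zero)
  then show ?thesis using q by simp
qed

text \<open>Follow the image of \<open>unit i\<close> through the suffixes of \<open>w\<close>. At
  the letter \<open>j\<close> where it turns negative it was \<open>unit j\<close> before, so there
  \<open>s_j w' = w' s_i\<close>, and appending \<open>i\<close> cancels that letter.\<close>

lemma exchange:
  assumes "w \<in> lists I" "i \<in> I" "nonpos (act w (unit i))"
  shows "\<exists>u\<in>lists I. length u + 1 = length w \<and> act u = act (w @ [i])"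
  using assms
proof (induction w)
  case Nil
  then show ?case using unit_nonneg by simp
next
  case (Cons j w)
  then have w: "w \<in> lists I" and j: "j \<in> I" by auto
  show ?case
  proof (cases "nonpos (act w (unit i))")
    case True
    then obtain u where u: "u \<in> lists I" "length u + 1 = length w" "act u = act (w @ [i])"
      using Cons.IH w \<open>i \<in> I\<close> by blast
    then have "act (j # u) = act ((j # w) @ [i])" by (intro ext) simp
    moreover have "j # u \<in> lists I" "length (j # u) + 1 = length (j # w)" using u j by auto
    ultimately show ?thesis by blast
  next
    case False
    then have pos: "nonneg (act w (unit i))" using nonneg_iff[OF w assms(2)] by simp
    have neg: "nonpos (refl j (act w (unit i)))" using Cons.prems(2) by simp
    have "act w (unit i) = unit j"
      by (rule refl_nonpos_imp_simple[OF w assms(2) j pos neg])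
    then have "act w (refl i q) = refl j (act w q)" for q
      by (rule refl_conjugate[OF w assms(2) j])
    then have "act w = act ((j # w) @ [i])" using j by (intro ext) (simp add: act_append)
    then show ?thesis using w by (intro bexI[of _ w]) auto
  qed
qed

lemma ex_reduced: "w \<in> lists I \<Longrightarrow> \<exists>u. reduced u \<and> act u = act w"
proof -
  assume w: "w \<in> lists I"
  define P where "P = (\<lambda>u. u \<in> lists I \<and> act u = act w)"
  have "P (arg_min length P)" "\<And>u. P u \<Longrightarrow> length (arg_min length P) \<le> length u"
    using arg_min_nat_lemma[of P w length] w by (auto simp: P_def)
  then show ?thesis unfolding reduced_def P_def by (intro exI[of _ "arg_min length P"]) (auto simp: P_def)
qed

lemma reduced_snoc_nonneg:
  assumes "reduced (w @ [i])" shows "nonneg (act w (unit i))"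
proof (rule ccontr)
  assume "\<not> ?thesis"
  moreover have w: "w \<in> lists I" "i \<in> I" using assms by (auto simp: reduced_def)
  ultimately have "nonpos (act w (unit i))" using nonneg_iff by blast
  then obtain u where "u \<in> lists I" "length u + 1 = length w" "act u = act (w @ [i])" using exchange w by blast
  then show False using assms by (fastforce simp: reduced_def)
qed

text \<open>With \<open>reduced_snoc_nonneg\<close> this is the length criterion. A shorter word for
  \<open>w @ [i]\<close> would make \<open>unit i\<close> negative, and exchange would then give a
  word for \<open>w\<close> shorter than \<open>w\<close>.\<close>

lemma nonneg_reduced_snoc:
  assumes r: "reduced w" and i: "i \<in> I" and p: "nonneg (act w (unit i))"
  shows "reduced (w @ [i])"
proof (rule ccontr)
  assume n: "\<not> ?thesis"
  have w: "w \<in> lists I" using r by (simp add: reduced_def)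
  obtain u where u: "u \<in> lists I" "act u = act (w @ [i])" "length u < length (w @ [i])"
    using n w i by (auto simp: reduced_def not_le)
  have "nonpos (act u (unit i))" using u i p by (simp add: act_append act_uminus)
  then obtain v where v: "v \<in> lists I" "length v + 1 = length u" "act v = act (u @ [i])" using exchange u i by blast
  have "act v = act w" using v u i by (simp add: fun_eq_iff act_append)
  then show False using r v u by (fastforce simp: reduced_def)
qed

lemma reduced_length: "reduced u \<Longrightarrow> reduced w \<Longrightarrow> act u = act w \<Longrightarrow> length u = length w"
  by (auto simp: reduced_def intro: antisym)

lemma reduced_lists: "reduced w \<Longrightarrow> w \<in> lists I"
  by (simp add: reduced_def)

lemma nonpos_ex_reduced_snoc:
  assumes r: "reduced w" and i: "i \<in> I" and p: "nonpos (act w (unit i))"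
  shows "\<exists>u. reduced (u @ [i]) \<and> act (u @ [i]) = act w"
proof -
  obtain v where v: "v \<in> lists I" "length v + 1 = length w" "act v = act (w @ [i])"
    using exchange[OF reduced_lists[OF r] i p] by blast
  have a: "act (v @ [i]) = act w" using v i by (simp add: fun_eq_iff act_append)
  then have "reduced (v @ [i])" using r v i by (simp add: reduced_def)
  then show ?thesis using a by blast
qed

lemma reduced_prefix: "reduced (u @ w) \<Longrightarrow> reduced u"
proof -
  assume r: "reduced (u @ w)"
  show ?thesis unfolding reduced_def
  proof (intro conjI ballI impI)
    show "u \<in> lists I" using r by (simp add: reduced_def)
    fix v assume v: "v \<in> lists I" "act v = act u"
    then have "act (v @ w) = act (u @ w)" by (intro ext) (simp add: act_append)
    moreover have "v @ w \<in> lists I" using r v by (simp add: reduced_def)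
    ultimately have "length (u @ w) \<le> length (v @ w)" using r unfolding reduced_def by blast
    then show "length u \<le> length v" by simp
  qed
qed

lemma reduced_rev: "reduced w \<Longrightarrow> reduced (rev w)"
proof -
  assume r: "reduced w"
  have "length w \<le> length u" if "u \<in> lists I" "act u = act (rev w)" for u
  proof -
    have "rev u \<in> lists I" using that by (simp add: in_lists_conv_set)
    moreover have "act (rev u) = act w" using that r act_rev_eq_iff[of u "rev w"]
      by (simp add: reduced_def in_lists_conv_set)
    ultimately show ?thesis using r by (fastforce simp: reduced_def)
  qed
  then show ?thesis using r by (simp add: reduced_def in_lists_conv_set)
qed

text \<open>A nonempty reduced word makes the simple root of its last letter negative.\<close>

lemma all_nonneg_imp_id:
  assumes w: "w \<in> lists I" and p: "\<And>i. i \<in> I \<Longrightarrow> nonneg (act w (unit i))"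
  shows "act w = id"
proof -
  obtain u where u: "reduced u" "act u = act w" using ex_reduced w by blast
  have "u = []"
  proof (cases u rule: rev_cases)
    case (snoc v i)
    then have i: "i \<in> I" and v: "v \<in> lists I" using u by (auto simp: reduced_def)
    have "act w (unit i) = (\<lambda>k. - act v (unit i) k)" using snoc i u(2)[symmetric] by (simp add: act_append act_uminus)
    then have "nonpos (act v (unit i))" using p[OF i] by simp
    moreover have "nonneg (act v (unit i))" using reduced_snoc_nonneg u snoc by blast
    ultimately show ?thesis using not_both_signs v by blast
  qed simp
  then show ?thesis using u by (simp add: fun_eq_iff)
qed

lemma act_outside: "w \<in> lists I \<Longrightarrow> k \<notin> I \<Longrightarrow> act w q k = q k"
  by (induction w) (auto simp: refl_def unit_def)

lemma supported_expand:
  assumes "\<And>k. k \<notin> I \<Longrightarrow> q k = 0"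
  shows "q = (\<lambda>k. \<Sum>j\<in>I. q j * unit j k)"
proof
  fix k
  have "(\<Sum>j\<in>I. q j * unit j k) = (\<Sum>j\<in>I. if j = k then q j else 0)"
    by (intro sum.cong) (auto simp: unit_def)
  then show "q k = (\<Sum>j\<in>I. q j * unit j k)" using assms finite_I by simp
qed

lemma unit_expand: "w \<in> lists I \<Longrightarrow> i \<in> I \<Longrightarrow> act w (unit i) = (\<lambda>k. \<Sum>j\<in>I. act w (unit i) j * unit j k)"
  by (rule supported_expand) (auto simp: act_outside unit_def)

definition longest :: "nat list \<Rightarrow> bool" where
  "longest w \<longleftrightarrow> reduced w \<and> (\<forall>i\<in>I. nonpos (act w (unit i)))"

lemma act_eqI:
  assumes u: "u \<in> lists I" and w: "w \<in> lists I"
    and eq: "\<And>i. i \<in> I \<Longrightarrow> act u (unit i) = act w (unit i)"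
  shows "act u = act w"
proof -
  have "nonneg (act (rev w @ u) (unit i))" if "i \<in> I" for i
    using eq that u w unit_nonneg by (simp add: act_append)
  moreover have "rev w @ u \<in> lists I" using u w by auto
  ultimately have "act (rev w @ u) = id" using all_nonneg_imp_id by blast
  then have "act w (act (rev w) (act u q)) = act w q" for q by (metis act_append id_apply)
  then show ?thesis using w by (intro ext) simp
qed

text \<open>An element is determined by the images of the simple roots, and these lie in a finite
  set.\<close>

lemma finite_act: "finite (act ` lists I)"
proof -
  let ?R = "{act w (unit i) |w i. w \<in> lists I \<and> i \<in> I}"
  let ?g = "\<lambda>f :: vec \<Rightarrow> nat \<Rightarrow> int. restrict (\<lambda>i. f (unit i)) I"
  have "inj_on ?g (act ` lists I)"
  proof (intro inj_onI)
    fix f g assume fg: "f \<in> act ` lists I" "g \<in> act ` lists I" and eq: "?g f = ?g g"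
    then obtain u w where u: "f = act u" "u \<in> lists I" and w: "g = act w" "w \<in> lists I" by blast
    have "act u (unit i) = act w (unit i)" if "i \<in> I" for i
      using eq that u w by (metis restrict_apply')
    then show "f = g" unfolding u(1) w(1) using act_eqI u w by blast
  qed
  moreover have "?g ` (act ` lists I) \<subseteq> PiE I (\<lambda>_. ?R)" by (auto intro!: exI)
  then have "finite (?g ` (act ` lists I))" using finite_PiE[OF finite_I, of "\<lambda>_. ?R"] finite_roots finite_subset by blast
  ultimately show ?thesis using finite_imageD by blast
qed

lemma finite_reduced_lengths: "finite (length ` Collect reduced)"
proof -
  let ?h = "\<lambda>f. length (SOME w. reduced w \<and> act w = f)"
  have "length w = ?h (act w)" if "reduced w" for w
  proof -
    have "reduced (SOME u. reduced u \<and> act u = act w) \<and> act (SOME u. reduced u \<and> act u = act w) = act w"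
      by (rule someI[of "\<lambda>u. reduced u \<and> act u = act w" w]) (use that in simp)
    then show ?thesis using reduced_length[OF that] by (metis (no_types, lifting))
  qed
  then have "length ` Collect reduced \<subseteq> ?h ` (act ` lists I)" using reduced_lists by (fastforce simp: image_iff)
  then show ?thesis using finite_act finite_subset by blast
qed

text \<open>The quotient of the two elements keeps simple roots positive: if it made one negative,
  then \<open>u\<close>, which reverses all signs, would turn it positive, whereas \<open>w\<close>
  makes it negative.\<close>

lemma longest_unique:
  assumes "longest u" "longest w" shows "act u = act w"
proof -
  have u: "u \<in> lists I" "rev u \<in> lists I" and w: "w \<in> lists I" using assms by (auto simp: longest_def reduced_def in_lists_conv_set)
  have "nonneg (act (rev u @ w) (unit i))" if i: "i \<in> I" for i
  proof (rule ccontr)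
    assume "\<not> ?thesis"
    moreover have l: "rev u @ w \<in> lists I" using u w by simp
    ultimately have neg: "nonpos (act (rev u @ w) (unit i))" using nonneg_iff i by blast
    let ?q = "act (rev u @ w) (unit i)"
    have "act w (unit i) = act u ?q" using u by (simp add: act_append)
    also have "\<dots> = act u (\<lambda>k. \<Sum>j\<in>I. ?q j * unit j k)" using unit_expand[OF l i] by simp
    also have "\<dots> = (\<lambda>k. \<Sum>j\<in>I. ?q j * act u (unit j) k)" by (rule act_sum[OF finite_I])
    finally have "nonneg (act w (unit i))"
      using neg assms(1) by (auto simp: nonneg_def nonpos_def longest_def intro!: sum_nonneg mult_nonpos_nonpos)
    then show False using assms(2) i not_both_signs w by (auto simp: longest_def)
  qed
  then have "act (rev u @ w) = id" using all_nonneg_imp_id u w by simp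
  then have "act u (act (rev u) (act w q)) = act u q" for q by (metis act_append id_apply)
  then show ?thesis using u by (intro ext) simp
qed

lemma maximal_imp_longest:
  assumes u: "reduced u" and max: "\<And>v. reduced v \<Longrightarrow> length v \<le> length u"
  shows "longest u"
proof -
  have "nonpos (act u (unit i))" if i: "i \<in> I" for i
  proof (rule ccontr)
    assume "\<not> ?thesis"
    then have "reduced (u @ [i])" using nonneg_reduced_snoc nonneg_iff reduced_lists u i by blast
    then show False using max by fastforce
  qed
  then show ?thesis using u by (simp add: longest_def)
qed

lemma ex_longest: "\<exists>u. longest u \<and> (\<forall>v. reduced v \<longrightarrow> length v \<le> length u)"
proof -
  have "reduced []" by (simp add: reduced_def)
  then have "length ` Collect reduced \<noteq> {}" by blast
  then obtain u where "reduced u" "length u = Max (length ` Collect reduced)"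
    using Max_in[OF finite_reduced_lengths] by auto
  moreover then have "\<And>v. reduced v \<Longrightarrow> length v \<le> length u" using finite_reduced_lengths by simp
  ultimately show ?thesis using maximal_imp_longest by blast
qed

lemma longest_iff: "longest w \<longleftrightarrow> reduced w \<and> (\<forall>u. reduced u \<longrightarrow> length u \<le> length w)"
proof
  assume l: "longest w"
  obtain u where u: "longest u" "\<forall>v. reduced v \<longrightarrow> length v \<le> length u" using ex_longest by blast
  have "length w = length u" using reduced_length longest_unique[OF l u(1)] l u(1) unfolding longest_def by blast
  then show "reduced w \<and> (\<forall>u. reduced u \<longrightarrow> length u \<le> length w)" using u(2) l by (simp add: longest_def)
qed (use maximal_imp_longest in blast)

lemma longest_rev: "longest w \<Longrightarrow> longest (rev w)"
  using longest_iff reduced_rev by simp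

text \<open>The negative of the longest element has a matrix \<open>n\<close> with natural entries
  whose square is the identity. Each row sum is at least 1, and the height of \<open>unit i\<close>
  expressed through the square forces it to be exactly 1, so the row has a single nonzero entry,
  equal to 1.\<close>

lemma longest_simple:
  assumes l: "longest w" and i: "i \<in> I"
  obtains j where "j \<in> I" "act w (unit i) = (\<lambda>k. - unit j k)"
proof -
  have w: "w \<in> lists I" using l by (auto simp: longest_def reduced_def)
  have inv: "act w (act w q) = q" for q
    using longest_unique[OF l longest_rev[OF l]] act_rev(2)[OF w] by metis
  define n where "n i k = - act w (unit i) k" for i k
  have n0: "0 \<le> n j k" if "j \<in> I" for j k
    using that l by (auto simp: n_def longest_def nonpos_def)
  define ht where "ht q = (\<Sum>k\<in>I. q k)" for q :: "nat \<Rightarrow> int"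
  have nsupp: "n j k = 0" if "j \<in> I" "k \<notin> I" for j k using that w by (auto simp: n_def act_outside unit_def)
  have ht1: "1 \<le> ht (n j)" if j: "j \<in> I" for j
  proof (rule ccontr)
    assume "\<not> ?thesis"
    then have "ht (n j) = 0" using n0[OF j] sum_nonneg[of I "n j"] by (auto simp: ht_def)
    then have "\<forall>k\<in>I. n j k = 0" using n0[OF j] finite_I by (simp add: ht_def sum_nonneg_eq_0_iff)
    then have "n j k = 0" for k using nsupp[OF j] by blast
    then have "act w (unit j) = (\<lambda>_. 0)" by (auto simp: n_def)
    then have "unit j = (\<lambda>_. 0)" using inv[of "unit j"] by (simp add: act_zero)
    then show False using unit_nonneg(2)[of j] by (simp add: nonpos_def)
  qed
  have "(\<lambda>k. - n i k) = act w (unit i)" by (simp add: n_def)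
  then have "unit i = act w (\<lambda>k. - n i k)" using inv by simp
  also have "(\<lambda>k. - n i k) = (\<lambda>k. \<Sum>j\<in>I. - n i j * unit j k)"
    using nsupp[OF i] by (intro supported_expand) simp
  also have "act w \<dots> = (\<lambda>k. \<Sum>j\<in>I. - n i j * act w (unit j) k)" by (rule act_sum[OF finite_I])
  also have "\<dots> = (\<lambda>k. \<Sum>j\<in>I. n i j * n j k)" by (simp add: n_def)
  finally have e: "unit i = (\<lambda>k. \<Sum>j\<in>I. n i j * n j k)" .
  have "ht (unit i) = (\<Sum>k\<in>I. if k = i then 1 else 0)" by (simp add: ht_def unit_def)
  then have "1 = ht (unit i)" using finite_I i by simp
  also have "\<dots> = (\<Sum>j\<in>I. n i j * ht (n j))"
    unfolding ht_def sum_distrib_left by (subst e) (rule sum.swap)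
  finally have s: "(\<Sum>j\<in>I. n i j * ht (n j)) = 1" ..
  have "(\<Sum>j\<in>I. n i j) \<le> 1" unfolding s[symmetric]
    using n0[OF i] ht1 by (intro sum_mono) (metis mult.right_neutral mult_left_mono)
  then have h1: "ht (n i) = 1" using ht1[OF i] by (simp add: ht_def)
  then obtain j where j: "j \<in> I" "n i j \<noteq> 0" unfolding ht_def by (metis sum.not_neutral_contains_not_neutral zero_neq_one)
  have "ht (n i) = n i j + (\<Sum>k\<in>I-{j}. n i k)" unfolding ht_def using finite_I j by (simp add: sum.remove)
  moreover have nn: "0 \<le> (\<Sum>k\<in>I-{j}. n i k)" using n0[OF i] by (simp add: sum_nonneg)
  moreover have "1 \<le> n i j" using j n0[OF i, of j] by linarith
  ultimately have nj: "n i j = 1" and "(\<Sum>k\<in>I-{j}. n i k) = 0" using h1 by linarith+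
  then have "\<forall>k\<in>I-{j}. n i k = 0" using n0[OF i] finite_I by (simp add: sum_nonneg_eq_0_iff)
  then have "n i k = unit j k" for k using nj nsupp[OF i] by (cases "k \<in> I") (auto simp: unit_def)
  then have "act w (unit i) = (\<lambda>k. - unit j k)" by (auto simp: n_def fun_eq_iff minus_equation_iff)
  then show ?thesis using that j by blast
qed

lemma dual_act_diff: "dual_act w (\<lambda>k. p k - q k) = (\<lambda>k. dual_act w p k - dual_act w q k)"
  by (induction w) (auto simp: dual_refl_def algebra_simps)

lemma dual_act_uminus: "dual_act w (\<lambda>k. - p k) = (\<lambda>k. - dual_act w p k)"
  by (induction w) (auto simp: dual_refl_def algebra_simps)

lemma pairing_uminus: "pairing p (\<lambda>k. - q k) = - pairing p q" "pairing (\<lambda>k. - p k) q = - pairing p q"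
  by (simp_all add: pairing_def sum_negf)

lemma dual_act_outside: "w \<in> lists I \<Longrightarrow> k \<notin> I \<Longrightarrow> dual_act w p k = p k"
  by (induction w) (auto simp: dual_refl_def outside)

lemma dual_act_pair: "dual_act w (\<lambda>l. pair l q) = (\<lambda>l. pair l (act w q))" if "w \<in> lists I"
  using that by (induction w) (auto simp: dual_refl_def pair_refl sym)

lemma longest_involution: "longest w \<Longrightarrow> act (rev w) = act w"
  using longest_unique longest_rev by blast

lemma longest_twice: "longest w \<Longrightarrow> act w (act w q) = q"
  using longest_involution[of w] act_rev(2)[of w q] by (simp add: longest_def reduced_def)

lemma longest_swap:
  assumes l: "longest w" and ij: "act w (unit i) = (\<lambda>k. - unit j k)"
  shows "act w (unit j) = (\<lambda>k. - unit i k)"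
proof -
  have "unit i = act w (act w (unit i))" using longest_twice[OF l] by simp
  also have "\<dots> = (\<lambda>k. - act w (unit j) k)" unfolding ij by (rule act_uminus)
  finally show ?thesis by simp
qed

lemma unit_inject: "unit i = unit j \<longleftrightarrow> i = j"
  by (auto simp: unit_def fun_eq_iff split: if_splits)

text \<open>Through the pairing, coordinate \<open>k\<close> of the left side is the coefficient at
  \<open>j\<close> of the image of \<open>unit k\<close>. It can only be nonzero for
  \<open>k = i\<close>, because the action is injective.\<close>

lemma dual_longest_unit:
  assumes l: "longest w" and ij: "i \<in> I" "j \<in> I" "act w (unit i) = (\<lambda>k. - unit j k)"
  shows "dual_act w (unit j) = (\<lambda>k. - unit i k)"
proof
  fix k
  have w: "w \<in> lists I" using l by (simp add: longest_def reduced_def)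
  show "dual_act w (unit j) k = - unit i k"
  proof (cases "k \<in> I")
    case True
    then obtain m where m: "m \<in> I" "act w (unit k) = (\<lambda>l. - unit m l)"
      using longest_simple[OF l] by blast
    have "dual_act w (unit j) k = pairing (unit j) (\<lambda>l. - unit m l)"
      using dual_act_nth[OF w True] longest_involution[OF l] m by simp
    also have "\<dots> = - unit j m" using m by (simp add: pairing_unit pairing_uminus)
    also have "\<dots> = - unit i k"
    proof (cases "k = i")
      case True
      then have "m = j" using m ij by (auto simp: fun_eq_iff unit_def split: if_splits)
      then show ?thesis using True by (simp add: unit_def)
    next
      case False
      have "m \<noteq> j"
      proof
        assume "m = j"
        then have "act w (unit k) = act w (unit i)" using m ij by simp
        then have "unit k = unit i" using longest_twice[OF l] by metis
        then show False using False by (simp add: unit_inject)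
      qed
      then show ?thesis using False by (auto simp: unit_def)
    qed
    finally show ?thesis .
  next
    case False
    then show ?thesis using ij dual_act_outside[OF w] by (auto simp: unit_def)
  qed
qed

section \<open>Connectedness of the reduced words of an element\<close>

inductive braid_move :: "nat list \<Rightarrow> nat list \<Rightarrow> bool" where
  commute: "c a b = 0 \<Longrightarrow> braid_move (u @ [a, b] @ v) (u @ [b, a] @ v)"
| braid: "c a b = - 1 \<Longrightarrow> braid_move (u @ [a, b, a] @ v) (u @ [b, a, b] @ v)"

abbreviation "braid_equiv \<equiv> braid_move\<^sup>*\<^sup>*"

lemma braid_move_append: "braid_move u w \<Longrightarrow> braid_move (u @ v) (w @ v)"
  by (induction rule: braid_move.induct) (metis append.assoc braid_move.intros)+

lemma braid_moves_append: "braid_equiv u w \<Longrightarrow> braid_equiv (u @ v) (w @ v)"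
  by (induction rule: rtranclp_induct) (auto intro: rtranclp.rtrancl_into_rtrancl braid_move_append)

lemma nonpos_add: "nonpos p \<Longrightarrow> nonpos q \<Longrightarrow> nonpos (\<lambda>k. p k + q k)"
  by (auto simp: nonpos_def add_nonpos_nonpos)

lemma act_eq_appendD: "act (u @ [i]) = act (w @ [i]) \<Longrightarrow> i \<in> I \<Longrightarrow> act u = act w"
  by (rule ext) (metis act_append act_simps refl_refl)

text \<open>Words with the same last letter are connected by the induction hypothesis for their
  prefixes. If the last letters \<open>a\<close> and \<open>b\<close> differ, the element makes both
  simple roots negative, hence it has reduced words ending in each of the two alternating words for
  the longest element of the rank two subgroup of \<open>a\<close> and \<open>b\<close>. These two
  words differ by one move.\<close>

theorem matsumoto:
  "reduced u \<Longrightarrow> reduced w \<Longrightarrow> act u = act w \<Longrightarrow> braid_equiv u w"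
proof (induction "length u" arbitrary: u w rule: less_induct)
  case less
  have len: "length u = length w" using reduced_length less.prems by blast
  have same: "braid_equiv (u' @ [i]) (w' @ [i])"
    if "reduced (u' @ [i])" "reduced (w' @ [i])" "act (u' @ [i]) = act u" "act (w' @ [i]) = act u" for u' w' i
  proof -
    have "i \<in> I" using that by (simp add: reduced_def)
    then have "act u' = act w'" using act_eq_appendD that by metis
    moreover have "length u' < length u" using reduced_length[OF that(1) less.prems(1) that(3)] by simp
    ultimately have "braid_equiv u' w'" using less.hyps reduced_prefix that by blast
    then show ?thesis by (rule braid_moves_append)
  qed
  show ?case
  proof (cases u rule: rev_cases)
    case Nil
    then show ?thesis using len by simp
  next
    case (snoc u' a)
    then obtain w' b where w: "w = w' @ [b]" using len by (metis length_0_conv rev_exhaust snoc_eq_iff_butlast)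
    have su: "reduced (u' @ [a])" "act (u' @ [a]) = act u" using less.prems snoc by simp_all
    have sw: "reduced (w' @ [b])" "act (w' @ [b]) = act u" using less.prems w by simp_all
    have ab: "a \<in> I" "b \<in> I" "u' \<in> lists I" "w' \<in> lists I" using snoc w less.prems by (auto simp: reduced_def)
    show ?thesis
    proof (cases "a = b")
      case True
      then show ?thesis using same[OF su(1) _ su(2)] sw by (simp add: snoc w)
    next
      case False
      let ?f = "act u"
      have na: "nonpos (?f (unit a))"
        using reduced_snoc_nonneg[of u' a] less.prems(1) snoc ab by (simp add: act_append act_uminus)
      have nb: "nonpos (?f (unit b))"
        using reduced_snoc_nonneg[of w' b] less.prems(2) w ab unfolding less.prems(3) by (simp add: act_append act_uminus)
      obtain v1 where v1: "reduced (v1 @ [b])" "act (v1 @ [b]) = ?f"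
        using nonpos_ex_reduced_snoc[OF less.prems(1) ab(2) nb] by blast
      have v1f: "act v1 q = ?f (refl b q)" for q using v1(2) ab by (metis act_append act_simps refl_refl)
      have rv1: "reduced v1" using v1 reduced_prefix by blast
      have red: "reduced z" if "z \<in> lists I" "act z = ?f" "length z = length u" for z
        using less.prems(1) that by (simp add: reduced_def)
      \<comment> \<open>The two intermediate words share their last letters with \<open>u\<close>
        and \<open>w\<close> respectively, so \<open>same\<close> applies at both ends.\<close>
      have via: "braid_equiv u w"
        if "reduced (x @ [a])" "act (x @ [a]) = ?f" "reduced (y @ [b])" "act (y @ [b]) = ?f" "braid_move (x @ [a]) (y @ [b])" for x y
      proof -
        have "braid_equiv u (x @ [a])" using same[OF su(1) that(1) su(2) that(2)] by (simp add: snoc)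
        also note that(5)
        also have "braid_equiv (y @ [b]) w" using same[OF that(3) sw(1) that(4) sw(2)] by (simp add: w)
        finally show ?thesis .
      qed
      note l1 = reduced_length[OF v1(1) less.prems(1) v1(2)]
      consider "c a b = 0" | "c a b = - 1" using off_diag ab False by blast
      then show ?thesis
      proof cases
        case 1
        have "refl b (unit a) = unit a" using 1 ab sym[of a b] by (simp add: refl_unit)
        then have "nonpos (act v1 (unit a))" using na v1f by simp
        then obtain v where v: "reduced (v @ [a])" "act (v @ [a]) = act v1"
          using nonpos_ex_reduced_snoc[OF rv1 ab(1)] by blast
        have comm: "refl a (refl b q) = refl b (refl a q)" for q
          using 1 sym[of a b] ab by (simp add: fun_eq_iff refl_apply pair_refl)
        have e1: "act (v @ [a,b]) = ?f" using v(2) v1(2) by (metis append.assoc append_Cons append_Nil act_append ext)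
        have e2: "act (v @ [b,a]) = ?f" unfolding e1[symmetric] by (intro ext) (simp add: act_append comm)
        have "reduced (v @ [a,b])" "reduced (v @ [b,a])"
          by (rule red; use reduced_lists[OF v(1)] l1 ab e1 e2 reduced_length[OF v(1) rv1 v(2)] in simp)+
        then show ?thesis using via[of "v @ [b]" "v @ [a]"] e1 e2 commute[of b a v "[]"] 1 sym[of a b] by simp
      next
        case 2
        have cba: "c b a = - 1" using 2 sym by simp
        have rb: "refl b (unit a) = (\<lambda>k. unit a k + unit b k)" using cba ab by (simp add: refl_unit)
        have ra: "refl a (unit b) = (\<lambda>k. unit a k + unit b k)" using 2 ab by (simp add: refl_unit add.commute)
        \<comment> \<open>After removal of \<open>b\<close> the image of \<open>unit a\<close> is
          the image under \<open>?f\<close> of the sum of both simple roots, a sum of two negative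
          vectors.\<close>
        have "nonpos (act v1 (unit a))" using na nb nonpos_add by (simp add: v1f rb act_add)
        then obtain v2 where v2: "reduced (v2 @ [a])" "act (v2 @ [a]) = act v1"
          using nonpos_ex_reduced_snoc[OF rv1 ab(1)] by blast
        have rv2: "reduced v2" using v2 reduced_prefix by blast
        have v2f: "act v2 q = ?f (refl b (refl a q))" for q
          using v2(2) v1f ab by (metis act_append act_simps refl_refl)
        \<comment> \<open>This allows a third letter to be split off: the image of
          \<open>unit b\<close> under \<open>v2\<close> is that of \<open>unit a\<close> under
          \<open>?f\<close>.\<close>
        have "refl b (refl a (unit b)) = unit a" using ra rb ab by (metis refl_refl)
        then have "nonpos (act v2 (unit b))" using na v2f by simp
        then obtain v where v: "reduced (v @ [b])" "act (v @ [b]) = act v2"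
          using nonpos_ex_reduced_snoc[OF rv2 ab(2)] by blast
        have braid': "refl a (refl b (refl a q)) = refl b (refl a (refl b q))" for q
          using 2 cba ab by (simp add: fun_eq_iff refl_apply pair_refl diag algebra_simps)
        have e1: "act (v @ [b,a,b]) = ?f"
          using fun_cong[OF v(2)] fun_cong[OF v2(2)] fun_cong[OF v1(2)] by (simp add: fun_eq_iff act_append)
        have e2: "act (v @ [a,b,a]) = ?f" unfolding e1[symmetric] by (intro ext) (simp add: act_append braid')
        have "reduced (v @ [a,b,a])" "reduced (v @ [b,a,b])"
          by (rule red; use reduced_lists[OF v(1)] l1 ab e1 e2 reduced_length[OF v(1) rv2 v(2)]
              reduced_length[OF v2(1) rv1 v2(2)] in simp)+
        then show ?thesis using via[of "v @ [a,b]" "v @ [b,a]"] e1 e2 braid[of a b v "[]"] 2 by simp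
      qed
    qed
  qed
qed

end


section \<open>Laurent polynomials\<close>

abbreviation "keys \<equiv> Poly_Mapping.keys"
abbreviation "lookup \<equiv> Poly_Mapping.lookup"
abbreviation "single \<equiv> Poly_Mapping.single"

definition monomial :: "(nat \<Rightarrow>\<^sub>0 int) \<Rightarrow> (nat \<Rightarrow> complex) \<Rightarrow> complex" where
  "monomial u x = (\<Prod>k\<in>keys u. x k powi lookup u k)"

lemma monomial_superset:
  assumes "finite K" "keys u \<subseteq> K"
  shows "monomial u x = (\<Prod>k\<in>K. x k powi lookup u k)"
  unfolding monomial_def using assms by (intro prod.mono_neutral_left) (auto simp: in_keys_iff)

lemma laurent_eval_superset:
  assumes "finite U" "keys p \<subseteq> U"
  shows "laurent_eval p x = (\<Sum>u\<in>U. lookup p u * monomial u x)"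
  unfolding laurent_eval_def monomial_def using assms by (intro sum.mono_neutral_left) (auto simp: in_keys_iff)

lemma laurent_eval_single: "laurent_eval (single u a) x = a * monomial u x"
  by (subst laurent_eval_superset[of "{u}"]) auto

lemma laurent_eval_0 [simp]: "laurent_eval 0 x = 0"
  by (simp add: laurent_eval_def)

lemma laurent_eval_1 [simp]: "laurent_eval 1 x = 1"
  using laurent_eval_single[of 0 1 x] by (simp add: monomial_def)

lemma laurent_eval_add: "laurent_eval (p + q) x = laurent_eval p x + laurent_eval q x"
proof -
  let ?U = "keys p \<union> keys q"
  have "laurent_eval r x = (\<Sum>u\<in>?U. lookup r u * monomial u x)"
    if "r \<in> {p, q, p + q}" for r
    using that Poly_Mapping.keys_add[of p q] by (intro laurent_eval_superset) auto
  then show ?thesis by (simp add: lookup_add algebra_simps sum.distrib)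
qed

lemma laurent_eval_uminus: "laurent_eval (- p) x = - laurent_eval p x"
proof -
  have "laurent_eval (- p) x + laurent_eval p x = laurent_eval (- p + p) x" by (rule laurent_eval_add[symmetric])
  then show ?thesis by (simp add: eq_neg_iff_add_eq_0)
qed

lemma laurent_eval_diff: "laurent_eval (p - q) x = laurent_eval p x - laurent_eval q x"
  using laurent_eval_add[of p "- q" x] by (simp add: laurent_eval_uminus)

lemma laurent_eval_sum: "laurent_eval (sum f A) x = (\<Sum>a\<in>A. laurent_eval (f a) x)"
  by (induction A rule: infinite_finite_induct) (simp_all add: laurent_eval_add)

lemma laurent_expand: "p = (\<Sum>u\<in>keys p. single u (lookup p u))" for p :: laurent
proof (rule poly_mapping_eqI)
  fix k
  show "lookup p k = lookup (\<Sum>u\<in>keys p. single u (lookup p u)) k"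
    by (cases "k \<in> keys p") (auto simp: lookup_sum lookup_single when_def in_keys_iff)
qed

lemma monomial_add:
  assumes "x \<in> torus N" "keys u \<subseteq> {1..N}" "keys v \<subseteq> {1..N}"
  shows "monomial (u + v) x = monomial u x * monomial v x"
proof -
  have "monomial w x = (\<Prod>k\<in>{1..N}. x k powi lookup w k)" if "w \<in> {u, v, u + v}" for w
    using that assms Poly_Mapping.keys_add[of u v] by (intro monomial_superset) auto
  then show ?thesis using assms(1)
    by (simp add: lookup_add power_int_add torus_def flip: prod.distrib)
qed

lemma laurent_eval_mult:
  assumes x: "x \<in> torus N" and p: "p \<in> laurent_ring N" and q: "q \<in> laurent_ring N"
  shows "laurent_eval (p * q) x = laurent_eval p x * laurent_eval q x"
proof -
  let ?K = keys and ?l = lookup and ?s = single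
  have "p * q = (\<Sum>u\<in>?K p. ?s u (?l p u)) * (\<Sum>v\<in>?K q. ?s v (?l q v))"
    using laurent_expand by metis
  also have "\<dots> = (\<Sum>u\<in>?K p. \<Sum>v\<in>?K q. ?s (u + v) (?l p u * ?l q v))"
    by (simp add: sum_product mult_single)
  finally have "laurent_eval (p * q) x = (\<Sum>u\<in>?K p. \<Sum>v\<in>?K q. ?l p u * ?l q v * monomial (u + v) x)"
    by (simp add: laurent_eval_sum laurent_eval_single)
  also have "\<dots> = (\<Sum>u\<in>?K p. \<Sum>v\<in>?K q. (?l p u * monomial u x) * (?l q v * monomial v x))"
    using p q monomial_add[OF x] by (intro sum.cong refl) (auto simp: laurent_ring_def)
  also have "\<dots> = laurent_eval p x * laurent_eval q x"
    by (simp add: sum_product laurent_eval_def monomial_def)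
  finally show ?thesis .
qed

lemma laurent_ring_add: "p \<in> laurent_ring N \<Longrightarrow> q \<in> laurent_ring N \<Longrightarrow> p + q \<in> laurent_ring N"
  using Poly_Mapping.keys_add[of p q] by (auto simp: laurent_ring_def)

lemma laurent_ring_uminus: "p \<in> laurent_ring N \<Longrightarrow> - p \<in> laurent_ring N"
  by (auto simp: laurent_ring_def in_keys_iff)

lemma laurent_ring_diff: "p \<in> laurent_ring N \<Longrightarrow> q \<in> laurent_ring N \<Longrightarrow> p - q \<in> laurent_ring N"
  using laurent_ring_add[of p N "- q"] laurent_ring_uminus by simp

lemma laurent_ring_mult: "p \<in> laurent_ring N \<Longrightarrow> q \<in> laurent_ring N \<Longrightarrow> p * q \<in> laurent_ring N"
proof -
  assume pq: "p \<in> laurent_ring N" "q \<in> laurent_ring N"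
  show ?thesis unfolding laurent_ring_def
  proof (intro CollectI ballI)
    fix w assume "w \<in> keys (p * q)"
    then obtain u v where "u \<in> keys p" "v \<in> keys q" "w = u + v"
      using Poly_Mapping.keys_mult[of p q] by blast
    then show "keys w \<subseteq> {1..N}" using pq Poly_Mapping.keys_add[of u v]
      by (fastforce simp: laurent_ring_def)
  qed
qed

lemma laurent_ring_0 [simp]: "0 \<in> laurent_ring N" and laurent_ring_1 [simp]: "1 \<in> laurent_ring N"
  by (auto simp: laurent_ring_def)

lemma laurent_ring_single: "keys u \<subseteq> {1..N} \<Longrightarrow> single u a \<in> laurent_ring N"
  by (auto simp: laurent_ring_def)

section \<open>Positive points and equality of rational functions\<close>

definition positive :: "(nat \<Rightarrow> complex) \<Rightarrow> bool" where
  "positive x \<longleftrightarrow> (\<forall>k. \<exists>r>0. x k = complex_of_real r)"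

lemma positive_nonzero: "positive x \<Longrightarrow> x k \<noteq> 0"
  unfolding positive_def by (metis of_real_eq_0_iff less_irrefl)

lemma positive_torus: "positive x \<Longrightarrow> x \<in> torus N"
  using positive_nonzero by (simp add: torus_def)

lemma two_powi_inject: "(2::complex) powi a = 2 powi b \<longleftrightarrow> a = b"
proof
  assume "(2::complex) powi a = 2 powi b"
  then have "(2::real) powi a = 2 powi b" by (metis norm_power_int norm_numeral)
  then show "a = b" using power_int_strict_increasing[of a b "2::real"] power_int_strict_increasing[of b a "2::real"]
    by (cases a b rule: linorder_cases) auto
qed simp

text \<open>Dedekind's argument for the linear independence of characters.\<close>

lemma monomials_independent:
  assumes "finite U" "\<And>x. positive x \<Longrightarrow> (\<Sum>u\<in>U. a u * monomial u x) = 0" "u \<in> U"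
  shows "a u = 0"
  using assms
proof (induction U arbitrary: a u rule: finite_induct)
  case (insert w U)
  have IH: "a v = 0" if v: "v \<in> U" for v
  proof -
    have "v \<noteq> w" using insert.hyps v by blast
    then obtain k where k: "lookup v k \<noteq> lookup w k" by (metis poly_mapping_eqI)
    let ?b = "\<lambda>u. a u * (2 powi lookup u k - 2 powi lookup w k)"
    have "(\<Sum>u\<in>U. ?b u * monomial u x) = 0" if x: "positive x" for x
    proof -
      \<comment> \<open>Doubling coordinate \<open>k\<close> multiplies each monomial by a power of
        2 that tells \<open>v\<close> from \<open>w\<close>. Subtracting the matching multiple of
        the original relation removes the term of \<open>w\<close>.\<close>
      let ?y = "x(k := 2 * x k)"
      have y: "positive ?y" unfolding positive_def
      proof
        fix l
        obtain r where "r > 0" "x l = complex_of_real r" using x unfolding positive_def by blast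
        then show "\<exists>r>0. ?y l = complex_of_real r"
          by (intro exI[of _ "if l = k then 2 * r else r"]) auto
      qed
      have m: "monomial u ?y = 2 powi lookup u k * monomial u x" for u
      proof -
        let ?K = "insert k (keys u)"
        have "monomial u ?y = (\<Prod>l\<in>?K. ?y l powi lookup u l)"
          by (intro monomial_superset) auto
        also have "\<dots> = (\<Prod>l\<in>?K. (if l = k then 2 powi lookup u k else 1) * x l powi lookup u l)"
          by (intro prod.cong refl) (auto simp: power_int_mult_distrib)
        also have "\<dots> = 2 powi lookup u k * (\<Prod>l\<in>?K. x l powi lookup u l)"
          by (subst prod.distrib) (simp add: prod.delta)
        also have "(\<Prod>l\<in>?K. x l powi lookup u l) = monomial u x"
          by (intro monomial_superset[symmetric]) auto
        finally show ?thesis .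
      qed
      have "(\<Sum>u\<in>insert w U. a u * monomial u ?y) = 0" using insert.prems(1) y by blast
      moreover have "2 powi lookup w k * (\<Sum>u\<in>insert w U. a u * monomial u x) = 0"
        using insert.prems(1)[OF x] by simp
      ultimately have "(\<Sum>u\<in>insert w U. a u * monomial u ?y)
          - 2 powi lookup w k * (\<Sum>u\<in>insert w U. a u * monomial u x) = 0" by simp
      then have "(\<Sum>u\<in>insert w U. ?b u * monomial u x) = 0"
        by (simp only: m sum_distrib_left flip: sum_subtractf) (simp add: algebra_simps)
      then show ?thesis using insert.hyps by simp
    qed
    then have "?b v = 0" using insert.IH[of ?b v] v by blast
    then show ?thesis using k by (simp add: two_powi_inject)
  qed
  have one: "positive (\<lambda>_. 1)" unfolding positive_def by (metis of_real_1 zero_less_one)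
  have "a w * monomial w (\<lambda>_. 1) = 0" using insert.prems(1)[OF one] insert.hyps IH by simp
  then have "a w = 0" by (simp add: monomial_def)
  then show ?case using IH insert.prems(2) by blast
qed simp

lemma laurent_vanish:
  assumes "\<And>x. positive x \<Longrightarrow> laurent_eval p x = 0" shows "p = 0"
proof (rule poly_mapping_eqI)
  fix u
  have "lookup p u = 0" if "u \<in> keys p"
  proof (rule monomials_independent[OF finite_keys _ that])
    fix x assume "positive x"
    then show "(\<Sum>u\<in>keys p. lookup p u * monomial u x) = 0"
      using assms[of x] by (simp only: laurent_eval_def monomial_def)
  qed
  then show "lookup p u = lookup 0 u" by (auto simp: in_keys_iff)
qed

text \<open>The hypothesis says nothing where a denominator vanishes. Multiplying the difference of
  cross products by both denominators gives a Laurent polynomial that vanishes at all positive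
  points.\<close>

lemma ratfun_eqI:
  assumes r: "r \<in> ratfun_field N" and s: "s \<in> ratfun_field N"
    and eq: "\<And>x a b. positive x \<Longrightarrow> ratfun_value N r x a \<Longrightarrow> ratfun_value N s x b \<Longrightarrow> a = b"
  shows "r = s"
proof -
  obtain p q where r': "r = Fract p q" "p \<in> laurent_ring N" "q \<in> laurent_ring N" "q \<noteq> 0"
    using r by (auto simp: ratfun_field_def)
  obtain p' q' where s': "s = Fract p' q'" "p' \<in> laurent_ring N" "q' \<in> laurent_ring N" "q' \<noteq> 0"
    using s by (auto simp: ratfun_field_def)
  note mem = r'(2,3) s'(2,3) laurent_ring_mult laurent_ring_diff
  have "(p * q' - p' * q) * (q * q') = 0"
  proof (rule laurent_vanish)
    fix x assume x: "positive x"
    have m: "\<And>a b. a \<in> laurent_ring N \<Longrightarrow> b \<in> laurent_ring N \<Longrightarrow> laurent_eval (a * b) x = laurent_eval a x * laurent_eval b x"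
      using laurent_eval_mult[OF positive_torus[OF x]] by blast
    let ?e = "\<lambda>p. laurent_eval p x"
    have "(?e p * ?e q' - ?e p' * ?e q) * (?e q * ?e q') = 0"
    proof (cases "?e q = 0 \<or> ?e q' = 0")
      case False
      then have "ratfun_value N r x (?e p / ?e q)" "ratfun_value N s x (?e p' / ?e q')"
        using r' s' unfolding ratfun_value_def by blast+
      then have "?e p / ?e q = ?e p' / ?e q'" by (rule eq[OF x])
      then show ?thesis using False by (simp add: field_simps)
    qed auto
    then show "laurent_eval ((p * q' - p' * q) * (q * q')) x = 0"
      using mem by (simp add: m laurent_eval_diff)
  qed
  then have "p * q' = p' * q" using r' s' by simp
  then show ?thesis using r' s' by (simp add: eq_fract)
qed

lemma Fract_1_inject: "Fract (p :: laurent) 1 = Fract q 1 \<longleftrightarrow> p = q"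
  by (simp add: eq_fract)

lemma laurent_of_ratfun_Fract: "laurent_of_ratfun (Fract p 1) = p"
  unfolding laurent_of_ratfun_def by (rule the_equality) (simp_all add: Fract_1_inject)

lemma Fract_in_ratfun_field: "p \<in> laurent_ring N \<Longrightarrow> Fract p 1 \<in> ratfun_field N"
  unfolding ratfun_field_def using laurent_ring_1[of N] zero_neq_one[symmetric, where 'a = laurent] by blast

text \<open>The value is independent of the fraction chosen: another representation has numerator
  \<open>p * s\<close>, and evaluation is multiplicative on the torus.\<close>

lemma ratfun_value_Fract:
  assumes p: "p \<in> laurent_ring N" and x: "x \<in> torus N" and v: "ratfun_value N (Fract p 1) x a"
  shows "a = laurent_eval p x"
proof -
  obtain r s where rs: "r \<in> laurent_ring N" "s \<in> laurent_ring N" "s \<noteq> 0" "Fract p 1 = Fract r s"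
    "laurent_eval s x \<noteq> 0" "a = laurent_eval r x / laurent_eval s x"
    using v unfolding ratfun_value_def by blast
  then have "r = p * s" by (simp add: eq_fract)
  then show ?thesis using rs laurent_eval_mult[OF x p rs(2)] by simp
qed

lemma ratfun_value_FractI: "p \<in> laurent_ring N \<Longrightarrow> ratfun_value N (Fract p 1) x (laurent_eval p x)"
  unfolding ratfun_value_def by (intro bexI[of _ p] bexI[of _ 1]) auto

section \<open>Exponents, supports and the absence of cancellation\<close>

definition trop_weight :: "(nat \<Rightarrow> real) \<Rightarrow> (nat \<Rightarrow>\<^sub>0 int) \<Rightarrow> real" where
  "trop_weight t u = (\<Sum>k\<in>keys u. t k * of_int (lookup u k))"

lemma trop_weight_superset:
  assumes "finite K" "keys u \<subseteq> K"
  shows "trop_weight t u = (\<Sum>k\<in>K. t k * of_int (lookup u k))"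
  unfolding trop_weight_def using assms by (intro sum.mono_neutral_left) (auto simp: in_keys_iff)

lemma trop_weight_add: "trop_weight t (u + v) = trop_weight t u + trop_weight t v"
proof -
  let ?K = "keys u \<union> keys v"
  have "trop_weight t w = (\<Sum>k\<in>?K. t k * of_int (lookup w k))" if "w \<in> {u, v, u + v}" for w
    using that Poly_Mapping.keys_add[of u v] by (intro trop_weight_superset) auto
  then show ?thesis by (simp add: lookup_add algebra_simps sum.distrib)
qed

lemma trop_weight_single: "trop_weight t (single k a) = t k * of_int a"
  by (subst trop_weight_superset[of "{k}"]) auto

text \<open>Natural coefficients exclude cancellation, so the support of a sum is the union of the
  supports. This is what turns a sum over trails into a set of exponents.\<close>

definition nat_coeffs :: "laurent \<Rightarrow> bool" where
  "nat_coeffs p \<longleftrightarrow> (\<forall>u. lookup p u \<in> \<nat>)"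

lemma nat_coeffs_add: "nat_coeffs p \<Longrightarrow> nat_coeffs q \<Longrightarrow> nat_coeffs (p + q)"
  by (simp add: nat_coeffs_def lookup_add)

lemma keys_add_nat_coeffs:
  assumes "nat_coeffs p" "nat_coeffs q"
  shows "keys (p + q) = keys p \<union> keys q"
proof -
  have "lookup p u + lookup q u = 0 \<longleftrightarrow> lookup p u = 0 \<and> lookup q u = 0" for u
  proof -
    obtain m n where "lookup p u = of_nat m" "lookup q u = of_nat n"
      using assms by (metis nat_coeffs_def Nats_cases)
    then show ?thesis by (metis add_is_0 of_nat_add of_nat_eq_0_iff)
  qed
  then show ?thesis unfolding set_eq_iff Un_iff in_keys_iff lookup_add by blast
qed

lemma lookup_monomial_times: "lookup (single e 1 * p) (e + u) = lookup p u" for p :: laurent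
proof -
  have "single e 1 * p = (\<Sum>v\<in>keys p. single (e + v) (lookup p v))"
    by (subst (1) laurent_expand[of p]) (simp only: sum_distrib_left mult_single mult_1)
  then show ?thesis by (simp add: lookup_sum lookup_single when_def in_keys_iff)
qed

lemma keys_monomial_times: "keys (single e 1 * p) = (+) e ` keys p" for p :: laurent
proof -
  have "v \<in> keys (single e 1 * p) \<longleftrightarrow> v - e \<in> keys p" for v
    using lookup_monomial_times[of e p "v - e"] by (simp add: in_keys_iff)
  then show ?thesis by (force simp: image_iff algebra_simps)
qed

lemma nat_coeffs_monomial_times: "nat_coeffs p \<Longrightarrow> nat_coeffs (single e 1 * p)"
  unfolding nat_coeffs_def by (metis lookup_monomial_times add.commute diff_add_cancel)


section \<open>Joint eigenvectors\<close>

text \<open>Choose \<open>h\<close> that separates two characters, apply \<open>T h\<close> to the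
  relation and subtract \<open>\<chi> w h\<close> times the relation; this eliminates
  \<open>w\<close>. Stated for an arbitrary family of operators, since it serves roots, weights and
  single eigenvalues alike.\<close>

lemma joint_eigenvectors_independent:
  fixes sc :: "'k::field \<Rightarrow> 'v::ab_group_add \<Rightarrow> 'v"
  assumes vs: "vector_space sc" and X: "finite X"
    and add: "\<And>h u v. h \<in> K \<Longrightarrow> T h (u + v) = T h u + T h v"
    and scale: "\<And>h a v. h \<in> K \<Longrightarrow> T h (sc a v) = sc a (T h v)"
    and eig: "\<And>x h. x \<in> X \<Longrightarrow> h \<in> K \<Longrightarrow> T h (v x) = sc (\<chi> x h) (v x)"
    and nz: "\<And>x. x \<in> X \<Longrightarrow> v x \<noteq> 0"
    and sep: "\<And>x y. x \<in> X \<Longrightarrow> y \<in> X \<Longrightarrow> x \<noteq> y \<Longrightarrow> \<exists>h\<in>K. \<chi> x h \<noteq> \<chi> y h"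
    and "(\<Sum>x\<in>X. sc (a x) (v x)) = 0" and "x \<in> X"
  shows "a x = 0"
  using X eig nz sep assms(8,9)
proof (induction X arbitrary: a x rule: finite_induct)
  case (insert w X)
  interpret vector_space sc by (rule vs)
  have T0: "T h 0 = 0" if "h \<in> K" for h using add[OF that, of 0 0] by simp
  have IH: "a z = 0" if z: "z \<in> X" for z
  proof -
    have "z \<noteq> w" using insert.hyps z by blast
    then obtain h where h: "h \<in> K" "\<chi> z h \<noteq> \<chi> w h" using insert.prems(3)[of z w] z by blast
    have Tsum: "T h (sum f Y) = (\<Sum>y\<in>Y. T h (f y))" if "finite Y" for f :: "_ \<Rightarrow> 'v" and Y
      using that by (induction Y rule: finite_induct) (simp_all add: T0 add h)
    let ?b = "\<lambda>y. a y * (\<chi> y h - \<chi> w h)"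
    have "(\<Sum>y\<in>insert w X. T h (sc (a y) (v y))) = 0"
      using insert.prems(4) Tsum[of "insert w X" "\<lambda>y. sc (a y) (v y)"] insert.hyps T0 h by simp
    moreover have "(\<Sum>y\<in>insert w X. T h (sc (a y) (v y))) = (\<Sum>y\<in>insert w X. sc (a y * \<chi> y h) (v y))"
      using insert.prems(1) h by (intro sum.cong refl) (simp add: scale)
    moreover have "sc (\<chi> w h) (\<Sum>y\<in>insert w X. sc (a y) (v y)) = (\<Sum>y\<in>insert w X. sc (a y * \<chi> w h) (v y))"
      by (simp add: scale_sum_right mult.commute del: sum.insert)
    ultimately have "(\<Sum>y\<in>insert w X. sc (?b y) (v y)) = 0"
      using insert.prems(4) by (simp add: scale_left_diff_distrib right_diff_distrib sum_subtractf del: sum.insert)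
    then have s: "(\<Sum>y\<in>X. sc (?b y) (v y)) = 0" using insert.hyps by simp
    have "?b z = 0" by (rule insert.IH[OF _ _ _ s z]) (use insert.prems in auto)
    then show ?thesis using h by simp
  qed
  have "sc (a w) (v w) = 0" using insert.prems(4) insert.hyps IH by simp
  then have "a w = 0" using insert.prems(2)[of w] by simp
  then show ?case using IH insert.prems(5) by blast
qed simp

lemma finite_joint_eigenvectors:
  fixes sc :: "complex \<Rightarrow> 'v::ab_group_add \<Rightarrow> 'v"
  assumes fd: "finite_dim sc"
    and add: "\<And>h u v. h \<in> K \<Longrightarrow> T h (u + v) = T h u + T h v"
    and scale: "\<And>h a v. h \<in> K \<Longrightarrow> T h (sc a v) = sc a (T h v)"
    and eig: "\<And>x h. x \<in> X \<Longrightarrow> h \<in> K \<Longrightarrow> T h (v x) = sc (\<chi> x h) (v x)"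
    and nz: "\<And>x. x \<in> X \<Longrightarrow> v x \<noteq> 0"
    and sep: "\<And>x y. x \<in> X \<Longrightarrow> y \<in> X \<Longrightarrow> x \<noteq> y \<Longrightarrow> \<exists>h\<in>K. \<chi> x h \<noteq> \<chi> y h"
  shows "finite X"
proof -
  have vs: "vector_space sc" using fd by (simp add: finite_dim_def)
  interpret vector_space sc by (rule vs)
  obtain B where B: "finite B" "span B = UNIV" using fd by (auto simp: finite_dim_def)
  have indep: "a x = 0" if "finite Y" "Y \<subseteq> X" "(\<Sum>x\<in>Y. sc (a x) (v x)) = 0" "x \<in> Y" for Y a x
    by (rule joint_eigenvectors_independent[where T=T and K=K and \<chi>=\<chi>, OF vs that(1) add scale _ _ _ that(3,4)])
      (use eig nz sep that(2) in blast)+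
  have inj: "inj_on v X"
  proof (rule inj_onI, rule ccontr)
    fix x y assume xy: "x \<in> X" "y \<in> X" "v x = v y" "x \<noteq> y"
    \<comment> \<open>Equal vectors at two indices would give a relation with coefficients 1 and
      -1.\<close>
    have "(\<Sum>z\<in>{x, y}. sc (if z = x then 1 else - 1) (v z)) = 0" using xy by simp
    then have "(if x = x then 1 else - 1 :: complex) = 0" using xy by (intro indep[of "{x, y}" _ x]) auto
    then show False by simp
  qed
  have "independent (v ` X)" unfolding independent_explicit_finite_subsets
  proof (intro allI impI ballI)
    fix S u w assume S: "S \<subseteq> v ` X" "finite S" "(\<Sum>w\<in>S. sc (u w) w) = 0" "w \<in> S"
    then obtain Y where Y: "Y \<subseteq> X" "S = v ` Y" using subset_image_iff by metis
    have inj': "inj_on v Y" using inj Y inj_on_subset by blast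
    then have "finite Y" using S Y finite_image_iff by blast
    moreover have "(\<Sum>y\<in>Y. sc (u (v y)) (v y)) = 0" using S Y inj' by (simp add: sum.reindex)
    moreover obtain y where "y \<in> Y" "w = v y" using S Y by blast
    ultimately show "u w = 0" using indep[of Y "\<lambda>y. u (v y)"] Y by blast
  qed
  then have "finite (v ` X)" using independent_span_bound[OF B(1), of "v ` X"] B(2) by simp
  then show ?thesis using inj finite_imageD by blast
qed

text \<open>Only three operators and their commutators are recorded, so the locale applies both to
  the adjoint action of a simple Lie algebra and to a module over its dual.\<close>

locale sl2_module =
  fixes sc :: "complex \<Rightarrow> 'v::ab_group_add \<Rightarrow> 'v" and E F H :: "'v \<Rightarrow> 'v"
  assumes fd: "finite_dim sc"
    and E_add: "E (u + v) = E u + E v" and E_scale: "E (sc a v) = sc a (E v)"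
    and F_add: "F (u + v) = F u + F v" and F_scale: "F (sc a v) = sc a (F v)"
    and H_add: "H (u + v) = H u + H v" and H_scale: "H (sc a v) = sc a (H v)"
    and HE: "H (E v) = E (H v) + sc 2 (E v)"
    and HF: "H (F v) = F (H v) - sc 2 (F v)"
    and EF: "E (F v) = F (E v) + H v"
begin

sublocale vector_space sc using fd by (simp add: finite_dim_def)

lemma E_0 [simp]: "E 0 = 0" and F_0 [simp]: "F 0 = 0" and H_0 [simp]: "H 0 = 0"
  using E_add[of 0 0] F_add[of 0 0] H_add[of 0 0] by simp_all

lemma H_E_pow: "H v = sc m v \<Longrightarrow> H ((E ^^ r) v) = sc (m + 2 * of_nat r) ((E ^^ r) v)"
proof (induction r)
  case (Suc r)
  have "H ((E ^^ Suc r) v) = sc (m + 2 * of_nat r) ((E ^^ Suc r) v) + sc 2 ((E ^^ Suc r) v)"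
    using Suc by (simp add: HE E_scale)
  also have "\<dots> = sc (m + 2 * of_nat r + 2) ((E ^^ Suc r) v)" by (rule scale_left_distrib[symmetric])
  finally show ?case by (simp add: add.assoc add.commute[of 2])
qed simp

lemma H_F_pow: "H v = sc m v \<Longrightarrow> H ((F ^^ r) v) = sc (m - 2 * of_nat r) ((F ^^ r) v)"
proof (induction r)
  case (Suc r)
  have "H ((F ^^ Suc r) v) = sc (m - 2 * of_nat r) ((F ^^ Suc r) v) - sc 2 ((F ^^ Suc r) v)"
    using Suc by (simp add: HF F_scale)
  also have "\<dots> = sc (m - 2 * of_nat r - 2) ((F ^^ Suc r) v)" by (rule scale_left_diff_distrib[symmetric])
  finally show ?case by (simp add: diff_diff_eq add.commute[of 2])
qed simp

text \<open>The eigenvalues \<open>m + a * of_nat r\<close> are pairwise distinct, so only finitely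
  many of the eigenvectors \<open>w r\<close> can be nonzero.\<close>

lemma pow_eventually_zero:
  assumes "\<And>r. H (w r) = sc (m + a * of_nat r) (w r)" "a \<noteq> 0"
    and "w 0 \<noteq> 0"
  obtains r where "w (Suc r) = 0" "\<And>j. j \<le> r \<Longrightarrow> w j \<noteq> 0"
proof -
  have "\<exists>r. w r = 0"
  proof (rule ccontr)
    assume nz: "\<nexists>r. w r = 0"
    have "finite (UNIV :: nat set)"
      by (rule finite_joint_eigenvectors[OF fd, where K="UNIV::unit set" and T="\<lambda>_. H" and v=w and \<chi>="\<lambda>r _. m + a * of_nat r"])
        (use assms nz H_add H_scale in auto)
    then show False by simp
  qed
  then obtain r where "w r = 0" "\<And>j. j < r \<Longrightarrow> w j \<noteq> 0" using exists_least_iff[of "\<lambda>r. w r = 0"] by blast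
  then show ?thesis using that[of "r - 1"] assms(3) by (cases r) auto
qed

text \<open>By induction \<open>E\<close> maps the vector lowered \<open>j + 1\<close> times to
  \<open>(j + 1) * (m - j)\<close> times the vector lowered \<open>j\<close> times. At the last
  nonzero vector of the string this scalar must vanish.\<close>

lemma highest_weight_string:
  assumes h: "H v = sc m v" and e: "E v = 0" and nz: "v \<noteq> 0"
  shows "\<exists>n. m = of_nat n \<and> (\<forall>j\<le>n. (F ^^ j) v \<noteq> 0)"
proof -
  have ef: "E ((F ^^ Suc j) v) = sc (of_nat (Suc j) * (m - of_nat j)) ((F ^^ j) v)" for j
  proof (induction j)
    case 0
    then show ?case using h e by (simp add: EF)
  next
    case (Suc j)
    have "E ((F ^^ Suc (Suc j)) v) = F (E ((F ^^ Suc j) v)) + H ((F ^^ Suc j) v)" by (simp add: EF)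
    also have "\<dots> = sc (of_nat (Suc j) * (m - of_nat j)) ((F ^^ Suc j) v) + sc (m - 2 * of_nat (Suc j)) ((F ^^ Suc j) v)"
      unfolding Suc.IH H_F_pow[OF h] by (simp add: F_scale)
    also have "\<dots> = sc (of_nat (Suc j) * (m - of_nat j) + (m - 2 * of_nat (Suc j))) ((F ^^ Suc j) v)"
      by (rule scale_left_distrib[symmetric])
    also have "of_nat (Suc j) * (m - of_nat j) + (m - 2 * of_nat (Suc j)) = of_nat (Suc (Suc j)) * (m - of_nat (Suc j))"
      by (simp add: algebra_simps)
    finally show ?case .
  qed
  obtain n where n: "(F ^^ Suc n) v = 0" "\<And>j. j \<le> n \<Longrightarrow> (F ^^ j) v \<noteq> 0"
    by (rule pow_eventually_zero[of "\<lambda>r. (F ^^ r) v" m "- 2"]) (use H_F_pow[OF h] nz in auto)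
  have "sc (of_nat (Suc n) * (m - of_nat n)) ((F ^^ n) v) = 0" using ef[of n] n(1) by simp
  then have "m = of_nat n" using n(2)[of n]
    by (metis scale_eq_0_iff order_refl mult_eq_0_iff of_nat_eq_0_iff nat.distinct(1) right_minus_eq)
  then show ?thesis using n(2) by auto
qed

lemma E_nonzero:
  assumes "H v = sc (of_int m) v" "m < 0" "v \<noteq> 0" shows "E v \<noteq> 0"
proof
  assume "E v = 0"
  then obtain n where "of_int m = (of_nat n :: complex)" using highest_weight_string assms by blast
  then have "m = int n" by (metis of_int_eq_iff of_int_of_nat_eq)
  then show False using assms by simp
qed

text \<open>Raise \<open>v\<close> to the top of its string, of weight \<open>m + 2r\<close>, then
  lower \<open>m + r\<close> times; this stays within the string and ends in weight
  \<open>-m\<close>. Such a vector stands in for the image of \<open>v\<close> under a group element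
  representing the simple reflection.\<close>

lemma reflected_vector_nonneg:
  assumes h: "H v = sc (of_int m) v" and "v \<noteq> 0" "0 \<le> m"
  shows "\<exists>r a. int a = m + int r \<and> (F ^^ a) ((E ^^ r) v) \<noteq> 0"
proof -
  obtain r where r: "(E ^^ Suc r) v = 0" "\<And>j. j \<le> r \<Longrightarrow> (E ^^ j) v \<noteq> 0"
    by (rule pow_eventually_zero[of "\<lambda>r. (E ^^ r) v" "of_int m" 2]) (use H_E_pow[OF h] assms in auto)
  have "E ((E ^^ r) v) = 0" "(E ^^ r) v \<noteq> 0" using r by auto
  then obtain n where n: "of_int m + 2 * of_nat r = (of_nat n :: complex)" "\<forall>j\<le>n. (F ^^ j) ((E ^^ r) v) \<noteq> 0"
    using highest_weight_string[OF H_E_pow[OF h]] by blast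
  have "of_int (m + 2 * int r) = (of_int (int n) :: complex)" using n(1) by simp
  then have "m + 2 * int r = int n" by (simp only: of_int_eq_iff)
  then show ?thesis using n(2) assms(3) by (intro exI[of _ r] exI[of _ "nat (m + int r)"]) auto
qed

lemma dual: "sl2_module sc F E (\<lambda>v. - H v)"
proof (unfold_locales)
  fix u v a
  show "- H (u + v) = - H u + - H v" by (simp add: H_add)
  show "- H (sc a v) = sc a (- H v)" by (simp add: H_scale)
  have Fm: "F (- v) = - F v" for v using F_add[of v "- v"] by (simp add: minus_unique)
  have Em: "E (- v) = - E v" for v using E_add[of v "- v"] by (simp add: minus_unique)
  show "- H (F v) = F (- H v) + sc 2 (F v)" by (simp add: HF Fm)
  show "- H (E v) = E (- H v) - sc 2 (E v)" by (simp add: HE Em)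
  show "F (E v) = E (F v) + - H v" by (simp add: EF)
qed (simp_all add: fd E_add F_add E_scale F_scale)

text \<open>Negative \<open>m\<close> is reduced to the previous case by exchanging \<open>E\<close>
  and \<open>F\<close> and negating \<open>H\<close>.\<close>

lemma reflected_vector:
  assumes h: "H v = sc (of_int m) v" and v: "v \<noteq> 0"
  obtains r a where "int a = m + int r" "(F ^^ a) ((E ^^ r) v) \<noteq> 0"
  | r a where "int r = m + int a" "(E ^^ a) ((F ^^ r) v) \<noteq> 0"
proof (cases "0 \<le> m")
  case True
  then show ?thesis using reflected_vector_nonneg[OF h v] that(1) by blast
next
  case False
  have "- H v = sc (of_int (- m)) v" using h by simp
  then obtain r a where "int a = - m + int r" "(E ^^ a) ((F ^^ r) v) \<noteq> 0"
    using sl2_module.reflected_vector_nonneg[OF dual _ v, of "- m"] False by auto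
  then show ?thesis using that(2)[of r a] by simp
qed

end


section \<open>Sums over trails\<close>

abbreviation powers :: "(nat \<Rightarrow> complex) \<Rightarrow> nat \<Rightarrow> int \<Rightarrow> complex" where
  "powers x \<equiv> \<lambda>k a. x k powi a"

context cartan_matrix
begin

text \<open>At each letter a trail either stays, with factor \<open>m k (g j)\<close>, or descends
  by a simple coroot, with factor 1. The argument \<open>m\<close> may be the formal monomial or its
  value at a point, so one recursion yields both the Laurent polynomial and the operator acting on
  functions \<open>f\<close> of the final weight.\<close>

fun trail_sum :: "(nat \<Rightarrow> int \<Rightarrow> 'r::comm_ring_1) \<Rightarrow> nat \<Rightarrow> nat list \<Rightarrow> (vec \<Rightarrow> 'r) \<Rightarrow> vec \<Rightarrow> 'r" where
  "trail_sum m k [] f g = f g"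
| "trail_sum m k (j # w) f g = m k (g j) * trail_sum m (Suc k) w f g +
     (if g j = 1 then trail_sum m (Suc k) w f (\<lambda>l. g l - c j l) else 0)"

definition step :: "nat \<Rightarrow> vec \<Rightarrow> vec \<Rightarrow> bool" where
  "step j g h \<longleftrightarrow> h = g \<or> g j = 1 \<and> h = (\<lambda>l. g l - c j l)"

definition comb_trail :: "nat list \<Rightarrow> vec \<Rightarrow> vec \<Rightarrow> vec list \<Rightarrow> bool" where
  "comb_trail w g d p \<longleftrightarrow> length p = Suc (length w) \<and> p ! 0 = g \<and> p ! length w = d \<and>
     (\<forall>k<length w. step (w ! k) (p ! k) (p ! Suc k))"

lemma trail_sum_append: "trail_sum m k (u @ w) f g = trail_sum m k u (trail_sum m (k + length u) w f) g"
  by (induction u arbitrary: k g) auto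

lemma trail_sum_scale: "trail_sum m k w (\<lambda>g. a * f g) g = a * trail_sum m k w f g"
  by (induction w arbitrary: k g) (auto simp: algebra_simps)

lemma trail_sum_cong_pos:
  assumes "\<And>l. k \<le> l \<Longrightarrow> l < k + length w \<Longrightarrow> m l = m' l"
  shows "trail_sum m k w f g = trail_sum m' k w f g"
  using assms
proof (induction w arbitrary: k g)
  case (Cons j w)
  have "\<And>l. Suc k \<le> l \<Longrightarrow> l < Suc k + length w \<Longrightarrow> m l = m' l" using Cons.prems by simp
  then show ?case using Cons.IH[of "Suc k"] Cons.prems[of k] by simp
qed simp

lemma comb_trail_Nil: "comb_trail [] g d p \<longleftrightarrow> g = d \<and> p = [g]"
  by (cases p) (auto simp: comb_trail_def)

lemma comb_trail_Cons:
  "comb_trail (j # w) g d p \<longleftrightarrow> (\<exists>h q. p = g # q \<and> step j g h \<and> comb_trail w h d q)"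
proof (cases p)
  case (Cons a q)
  then show ?thesis
    by (cases q) (auto simp: comb_trail_def All_less_Suc2)
qed (auto simp: comb_trail_def)

text \<open>Membership in the ring is proved together with the value, because evaluation is
  multiplicative only for Laurent polynomials in the torus variables.\<close>

lemma trail_sum_eval:
  assumes "x \<in> torus N" "\<And>g. f g \<in> laurent_ring N" "1 \<le> k" "k + length w \<le> Suc N"
  shows "trail_sum (\<lambda>k a. single (single k a) 1) k w f g \<in> laurent_ring N \<and>
    laurent_eval (trail_sum (\<lambda>k a. single (single k a) 1) k w f g) x =
    trail_sum (powers x) k w (\<lambda>g. laurent_eval (f g) x) g"
  using assms(3,4)
proof (induction w arbitrary: k g)
  case (Cons j w)
  let ?m = "\<lambda>k a. single (single k a) 1 :: laurent"
  have IH: "trail_sum ?m (Suc k) w f h \<in> laurent_ring N" "laurent_eval (trail_sum ?m (Suc k) w f h) x =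
    trail_sum (powers x) (Suc k) w (\<lambda>g. laurent_eval (f g) x) h" for h
    using Cons.IH[of "Suc k"] Cons.prems by auto
  have m: "?m k a \<in> laurent_ring N" "laurent_eval (?m k a) x = x k powi a" for a
  proof -
    have "keys (single k a) \<subseteq> {1..N}" using Cons.prems by simp
    then show "?m k a \<in> laurent_ring N" by (rule laurent_ring_single)
    show "laurent_eval (?m k a) x = x k powi a" by (simp add: laurent_eval_single monomial_def)
  qed
  show ?case
    using m IH by (auto simp: laurent_eval_add laurent_eval_mult[OF assms(1)] intro!: laurent_ring_add laurent_ring_mult)
qed (use assms in simp)

definition end_indicator :: "vec \<Rightarrow> vec \<Rightarrow> laurent" where
  "end_indicator d = (\<lambda>g. if g = d then 1 else 0)"

abbreviation trail_poly :: "nat \<Rightarrow> nat list \<Rightarrow> vec \<Rightarrow> vec \<Rightarrow> laurent" where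
  "trail_poly k w d g \<equiv> trail_sum (\<lambda>k a. single (single k a) 1) k w (end_indicator d) g"

lemma nat_coeffs_trail_poly: "nat_coeffs (trail_poly k w d g)"
proof (induction w arbitrary: k g)
  case Nil
  then show ?case by (simp add: end_indicator_def nat_coeffs_def lookup_one when_def)
next
  case (Cons j w)
  moreover have "nat_coeffs 0" by (simp add: nat_coeffs_def)
  ultimately show ?case by (auto intro!: nat_coeffs_add nat_coeffs_monomial_times)
qed

text \<open>The value of the simple root at the midpoint of the step; for a descent from coordinate
  1 to -1 it is 0.\<close>

definition step_exponent :: "nat \<Rightarrow> vec \<Rightarrow> vec \<Rightarrow> int" where
  "step_exponent j g h = (if h = g then g j else 0)"

definition trail_value :: "(nat \<Rightarrow> real) \<Rightarrow> nat \<Rightarrow> nat list \<Rightarrow> vec list \<Rightarrow> real" where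
  "trail_value t k w p = (\<Sum>l<length w. t (k + l) * of_int (step_exponent (w ! l) (p ! l) (p ! Suc l)))"

lemma trail_value_Cons:
  "trail_value t k (j # w) (g # q) = t k * of_int (step_exponent j g (q ! 0)) + trail_value t (Suc k) w q"
  unfolding trail_value_def by (simp add: sum.lessThan_Suc_shift del: sum.lessThan_Suc)

text \<open>An equality of sets of values rather than of minima: several trails may share a
  monomial, but natural coefficients prevent any monomial from being lost.\<close>

lemma trop_trail_poly:
  assumes "set w \<subseteq> I"
  shows "trop_weight t ` keys (trail_poly k w d g) = trail_value t k w ` Collect (comb_trail w g d)"
  using assms
proof (induction w arbitrary: k g)
  case Nil
  have "Collect (comb_trail [] g d) = (if g = d then {[g]} else {})" by (auto simp: comb_trail_Nil)
  then show ?case by (simp add: end_indicator_def trail_value_def trop_weight_def)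
next
  case (Cons j w)
  let ?g' = "\<lambda>l. g l - c j l"
  let ?T = "\<lambda>h. trail_poly (Suc k) w d h"
  \<comment> \<open>\<open>step_exponent\<close> recognises a descent by the change of the vector,
    and the diagonal entry 2 guarantees such a change.\<close>
  have ne: "?g' \<noteq> g" using Cons.prems diag[of j] by (auto simp: fun_eq_iff intro!: exI[of _ j])
  have IH: "trop_weight t ` keys (?T h) = trail_value t (Suc k) w ` Collect (comb_trail w h d)" for h
    using Cons.IH Cons.prems by simp
  have hd0: "comb_trail w h d q \<Longrightarrow> q ! 0 = h" for h q by (simp add: comb_trail_def)
  have A: "trop_weight t ` keys (single (single k (g j)) 1 * ?T g) =
      (\<lambda>q. trail_value t k (j # w) (g # q)) ` Collect (comb_trail w g d)"
  proof -
    have "trop_weight t ` keys (single (single k (g j)) 1 * ?T g) =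
        (\<lambda>v. t k * of_int (g j) + v) ` trop_weight t ` keys (?T g)"
      by (simp add: keys_monomial_times image_image trop_weight_add trop_weight_single)
    also have "\<dots> = (\<lambda>q. trail_value t k (j # w) (g # q)) ` Collect (comb_trail w g d)"
      unfolding IH image_image
      by (intro image_cong refl) (auto simp: trail_value_Cons step_exponent_def dest: hd0)
    finally show ?thesis .
  qed
  have B: "trop_weight t ` keys (?T ?g') = (\<lambda>q. trail_value t k (j # w) (g # q)) ` Collect (comb_trail w ?g' d)"
    unfolding IH using ne by (intro image_cong refl) (auto simp: trail_value_Cons step_exponent_def dest: hd0)
  have "Collect (comb_trail (j # w) g d) = (#) g ` (Collect (comb_trail w g d) \<union> (if g j = 1 then Collect (comb_trail w ?g' d) else {}))"
    unfolding comb_trail_Cons step_def by auto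
  then have R: "trail_value t k (j # w) ` Collect (comb_trail (j # w) g d) =
      (\<lambda>q. trail_value t k (j # w) (g # q)) ` Collect (comb_trail w g d) \<union>
      (if g j = 1 then (\<lambda>q. trail_value t k (j # w) (g # q)) ` Collect (comb_trail w ?g' d) else {})"
    by (simp add: image_image image_Un)
  show ?case
  proof (cases "g j = 1")
    case True
    then have "keys (trail_poly k (j # w) d g) =
      keys (single (single k (g j)) 1 * ?T g) \<union> keys (?T ?g')"
      by (simp add: keys_add_nat_coeffs nat_coeffs_trail_poly nat_coeffs_monomial_times)
    then show ?thesis unfolding R using A B True by (simp only: image_Un refl if_True)
  next
    case False
    then show ?thesis unfolding R using A by simp
  qed
qed

text \<open>Read from its right end, each letter of \<open>w\<close> either fixes the current image
  of \<open>d\<close> or raises it by exactly one simple coroot, so the images ascend in the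
  dominance order.\<close>

fun extremal :: "nat list \<Rightarrow> vec \<Rightarrow> bool" where
  "extremal [] d = True"
| "extremal (j # w) d = (extremal w d \<and> dual_act w d j \<in> {- 1, 0})"

text \<open>The dominance order on coweights: the difference is a natural combination of simple
  coroots, whose coordinates are the rows of \<open>c\<close>.\<close>

definition dominated :: "vec \<Rightarrow> vec \<Rightarrow> bool" where
  "dominated g h \<longleftrightarrow> (\<exists>n. nonneg n \<and> h = (\<lambda>l. g l + (\<Sum>k\<in>I. n k * c k l)))"

lemma dominated_refl [simp]: "dominated g g"
  unfolding dominated_def by (intro exI[of _ "\<lambda>_. 0"]) (simp add: nonneg_def)

lemma combination_unit: "j \<in> I \<Longrightarrow> (\<Sum>k\<in>I. (n k + a * unit j k) * c k l) = (\<Sum>k\<in>I. n k * c k l) + a * c j l"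
proof -
  assume j: "j \<in> I"
  have "(\<Sum>k\<in>I. (n k + a * unit j k) * c k l) = (\<Sum>k\<in>I. n k * c k l) + a * (\<Sum>k\<in>I. unit j k * c k l)"
    by (simp add: distrib_right sum.distrib sum_distrib_left mult.assoc)
  then show ?thesis using j finite_I by (simp add: sum_unit)
qed

lemma dominated_raise: "j \<in> I \<Longrightarrow> dominated g h \<Longrightarrow> dominated g (\<lambda>l. h l + c j l)"
  unfolding dominated_def
proof (elim exE conjE)
  fix n assume j: "j \<in> I" and n: "nonneg n" "h = (\<lambda>l. g l + (\<Sum>k\<in>I. n k * c k l))"
  show "\<exists>n. nonneg n \<and> (\<lambda>l. h l + c j l) = (\<lambda>l. g l + (\<Sum>k\<in>I. n k * c k l))"
    using n combination_unit[OF j, of n 1]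
    by (intro exI[of _ "\<lambda>k. n k + 1 * unit j k"]) (auto simp: nonneg_def unit_def algebra_simps)
qed

lemma dominated_lower_both: "dominated (\<lambda>l. g l - c j l) h \<Longrightarrow> dominated g (\<lambda>l. h l + c j l)"
  unfolding dominated_def by (auto simp: algebra_simps)

text \<open>If \<open>h - g + \<alpha>\<close> pairs to \<open>1\<close> with the simple root, then it contains that root.\<close>

lemma dominated_absorb:
  assumes j: "j \<in> I" and d: "dominated (\<lambda>l. g l - c j l) h" and g: "g j = 1" and h: "h j = 0"
  shows "dominated g h"
proof -
  obtain n where n: "nonneg n" "h = (\<lambda>l. g l - c j l + (\<Sum>k\<in>I. n k * c k l))" using d unfolding dominated_def by blast
  have "0 = - 1 + (\<Sum>k\<in>I. n k * c k j)" using g h fun_cong[OF n(2), of j] diag[OF j] by simp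
  moreover have "(\<Sum>k\<in>I. n k * c k j) = n j * 2 + (\<Sum>k\<in>I-{j}. n k * c k j)"
    using j finite_I diag by (simp add: sum.remove)
  moreover have "(\<Sum>k\<in>I-{j}. n k * c k j) \<le> 0"
  proof (intro sum_nonpos mult_nonneg_nonpos)
    fix k assume k: "k \<in> I - {j}"
    show "0 \<le> n k" using n(1) by (simp add: nonneg_def)
    show "c k j \<le> 0" using off_diag[of k j] k j by auto
  qed
  ultimately have "1 \<le> n j" by linarith
  moreover have "h = (\<lambda>l. g l + (\<Sum>k\<in>I. (n k + (- 1) * unit j k) * c k l))"
    unfolding combination_unit[OF j] n(2) by auto
  moreover have "nonneg (\<lambda>k. n k + (- 1) * unit j k)"
    using n(1) \<open>1 \<le> n j\<close> by (auto simp: nonneg_def unit_def)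
  ultimately show ?thesis unfolding dominated_def by blast
qed

text \<open>If the coordinate of the current image is 0, staying has factor
  \<open>m k 0 = 1\<close>. If it is -1, the raised weight descends to the old one with factor 1,
  and the second conjunct for the rest of the word rules out staying at the raised weight. That
  conjunct persists because neither staying nor descending can bring a weight that is not below the
  new image under the old one.\<close>

lemma trail_sum_extremal:
  fixes m :: "nat \<Rightarrow> int \<Rightarrow> 'r::comm_ring_1"
  assumes strict: "\<And>j g. j \<in> I \<Longrightarrow> \<not> dominated (\<lambda>l. g l + c j l) g"
    and m0: "\<And>k. m k 0 = 1" and w: "set w \<subseteq> I" and ext: "extremal w d"
  shows "trail_sum m k w (\<lambda>g. if g = d then 1 else 0) (dual_act w d) = 1 \<and>
    (\<forall>g. \<not> dominated g (dual_act w d) \<longrightarrow> trail_sum m k w (\<lambda>g. if g = d then 1 else 0) g = 0)"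
  using w ext
proof (induction w arbitrary: k)
  case Nil
  then show ?case by auto
next
  case (Cons j w)
  let ?f = "\<lambda>g. if g = d then 1 else 0 :: 'r" and ?h = "dual_act w d"
  have j: "j \<in> I" using Cons.prems by simp
  have IH1: "trail_sum m (Suc k) w ?f ?h = 1"
    and IH2: "\<And>g. \<not> dominated g ?h \<Longrightarrow> trail_sum m (Suc k) w ?f g = 0"
    using Cons.IH[of "Suc k"] Cons.prems by auto
  consider "?h j = 0" | "?h j = - 1" using Cons.prems by auto
  then show ?case
  proof cases
    case 1
    have a: "dual_act (j # w) d = ?h" using 1 by (simp add: dual_refl_def)
    have "trail_sum m k (j # w) ?f g = 0" if g: "\<not> dominated g ?h" for g
      using IH2[OF g] dominated_absorb[of j g ?h] 1 j g IH2[of "\<lambda>l. g l - c j l"] by auto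
    then show ?thesis unfolding a using IH1 1 m0 by auto
  next
    case 2
    have a: "dual_act (j # w) d = (\<lambda>l. ?h l + c j l)" using 2 by (simp add: dual_refl_def)
    have "trail_sum m k (j # w) ?f g = 0" if g: "\<not> dominated g (\<lambda>l. ?h l + c j l)" for g
    proof -
      have "trail_sum m (Suc k) w ?f g = 0" using g dominated_raise[OF j, of g ?h] by (intro IH2) blast
      moreover have "trail_sum m (Suc k) w ?f (\<lambda>l. g l - c j l) = 0"
        using g dominated_lower_both[of g j ?h] by (intro IH2) blast
      ultimately show ?thesis by simp
    qed
    \<comment> \<open>The contribution of staying: the raised weight is not below
      \<open>?h\<close>.\<close>
    moreover have "trail_sum m (Suc k) w ?f (\<lambda>l. ?h l + c j l) = 0" using IH2 strict[OF j] by blast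
    then have "trail_sum m k (j # w) ?f (\<lambda>l. ?h l + c j l) = 1" using IH1 2 diag[OF j] by simp
    ultimately show ?thesis unfolding a by blast
  qed
qed

end

section \<open>Commutation and braid relations on minuscule weights\<close>

locale minuscule_weights = cartan_matrix +
  fixes M :: "vec set"
  assumes closed: "g \<in> M \<Longrightarrow> i \<in> I \<Longrightarrow> dual_refl i g \<in> M"
    and bound: "g \<in> M \<Longrightarrow> i \<in> I \<Longrightarrow> g i \<in> {- 1, 0, 1}"
begin

lemma lower_closed: "g \<in> M \<Longrightarrow> i \<in> I \<Longrightarrow> g i = 1 \<Longrightarrow> (\<lambda>l. g l - c i l) \<in> M"
  using closed[of g i] by (simp add: dual_refl_def)

lemma trail_sum_cong:
  assumes "set w \<subseteq> I" "g \<in> M" "\<And>g. g \<in> M \<Longrightarrow> f g = f' g"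
  shows "trail_sum m k w f g = trail_sum m k w f' g"
  using assms(1,2) by (induction w arbitrary: k g) (auto simp: assms(3) lower_closed)

lemma trail_sum_commute:
  fixes y x :: "nat \<Rightarrow> complex"
  assumes ab: "a \<in> I" "b \<in> I" "c a b = 0" and g: "g \<in> M"
    and y: "y k = x (Suc k)" "y (Suc k) = x k"
  shows "trail_sum (powers y) k [b, a] f g = trail_sum (powers x) k [a, b] f g"
proof -
  have e: "(\<lambda>l. g l - c a l - c b l) = (\<lambda>l. g l - c b l - c a l)" by (rule ext) simp
  show ?thesis using ab sym[of a b] y by (auto simp: e algebra_simps)
qed

text \<open>On minuscule weights the two letters see only one-dimensional or three-dimensional
  pieces, so the relation is a finite check of rational identities, one for each pair of
  coordinates.\<close>

lemma trail_sum_braid: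
  fixes x y :: "nat \<Rightarrow> complex"
  assumes ab: "a \<in> I" "b \<in> I" "c a b = - 1" and g: "g \<in> M"
    and nz: "x k \<noteq> 0" "x (Suc k) \<noteq> 0" "x (Suc (Suc k)) \<noteq> 0"
      "x (Suc k) + x k * x (Suc (Suc k)) \<noteq> 0"
    and y: "y k = x (Suc k) * x (Suc (Suc k)) / (x (Suc k) + x k * x (Suc (Suc k)))"
      "y (Suc k) = x k * x (Suc (Suc k))" "y (Suc (Suc k)) = x k + x (Suc k) / x (Suc (Suc k))"
  shows "trail_sum (powers y) k [b, a, b] f g = trail_sum (powers x) k [a, b, a] f g"
proof -
  have e: "(\<lambda>l. g l - c a l - c b l) = (\<lambda>l. g l - c b l - c a l)" by (rule ext) simp
  have cs: "c b a = - 1" "c a a = 2" "c b b = 2" "c a b = - 1" using ab sym[of a b] diag by auto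
  have "dual_refl a g b \<in> {- 1, 0, 1}" using bound[OF closed[OF g ab(1)] ab(2)] .
  \<comment> \<open>Reflection in \<open>a\<close> moves the coordinate at \<open>b\<close> to this
    sum. The bound for the reflected weight excludes the pairs (1,1) and (-1,-1), which leaves seven
    cases.\<close>
  then have s: "g b + g a \<in> {- 1, 0, 1}" using cs by (simp add: dual_refl_def)
  define p q r where "p = x k" and "q = x (Suc k)" and "r = x (Suc (Suc k))"
  have nzp: "p \<noteq> 0" "q \<noteq> 0" "r \<noteq> 0" "q + p * r \<noteq> 0" "p + q / r \<noteq> 0"
    using nz by (auto simp: p_def q_def r_def field_simps)
  note xy = y[folded p_def q_def r_def] p_def[symmetric] q_def[symmetric] r_def[symmetric]
  consider "g a = 0" "g b = 0" | "g a = 1" "g b = 0" | "g a = - 1" "g b = 0" | "g a = 0" "g b = 1"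
    | "g a = 0" "g b = - 1" | "g a = 1" "g b = - 1" | "g a = - 1" "g b = 1"
    using bound[OF g ab(1)] bound[OF g ab(2)] s by auto
  then show ?thesis
    by cases (use nzp in \<open>simp_all add: cs e xy power_int_minus divide_simps\<close>, simp_all add: algebra_simps)
qed

end


section \<open>Roots of simple Lie algebras\<close>

locale lie_setting =
  fixes G :: "'g::ab_group_add lie_data"
  assumes simple: "simple_lie_algebra G"
begin

abbreviation "I \<equiv> index_set G"

lemma lie: "lie_algebra G" and fd: "finite_dim (smult G)" and cartan: "cartan_subalgebra G"
  and base: "simple_roots_base G" and chev: "chevalley_generators G" and simp_lie: "simple_lie G"
  using simple by (auto simp: simple_lie_algebra_def simple_lie_def)

sublocale vector_space "smult G" using lie by (simp add: lie_algebra_def)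

lemma finite_I [simp]: "finite I" by (simp add: index_set_def)

lemma brk_add_left: "brk G (x + y) z = brk G x z + brk G y z"
  and brk_add_right: "brk G x (y + z) = brk G x y + brk G x z"
  and brk_scale_left: "brk G (smult G a x) y = smult G a (brk G x y)"
  and brk_scale_right: "brk G x (smult G a y) = smult G a (brk G x y)"
  and brk_self: "brk G x x = 0"
  and jacobi: "brk G x (brk G y z) + brk G y (brk G z x) + brk G z (brk G x y) = 0"
  using lie unfolding lie_algebra_def by blast+

lemma brk_0 [simp]: "brk G x 0 = 0" "brk G 0 x = 0"
  using brk_add_right[of x 0 0] brk_add_left[of 0 0 x] by simp_all

lemma brk_minus_right: "brk G x (- y) = - brk G x y"
  using brk_add_right[of x y "- y"] by (simp add: minus_unique)

lemma brk_minus_left: "brk G (- x) y = - brk G x y"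
  using brk_add_left[of x "- x" y] by (simp add: minus_unique)

lemma brk_anti: "brk G y x = - brk G x y"
proof -
  have "brk G (x + y) (x + y) = brk G x y + brk G y x"
    unfolding brk_add_left brk_add_right by (simp add: brk_self)
  then have "brk G x y + brk G y x = 0" by (simp add: brk_self)
  then show ?thesis using minus_unique by metis
qed

lemma brk_derivation: "brk G x (brk G y z) = brk G (brk G x y) z + brk G y (brk G x z)"
proof -
  have "brk G x (brk G y z) = - brk G y (brk G z x) - brk G z (brk G x y)"
  proof -
    have "brk G x (brk G y z) = - (brk G y (brk G z x) + brk G z (brk G x y))"
      using jacobi[of x y z] unfolding eq_neg_iff_add_eq_0 by (simp only: add.assoc)
    then show ?thesis by simp
  qed
  also have "brk G z x = - brk G x z" by (rule brk_anti)
  also have "brk G z (brk G x y) = - brk G (brk G x y) z" by (rule brk_anti)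
  finally show ?thesis by (simp add: brk_minus_right)
qed

lemma csa_eq: "{x. \<forall>h\<in>csa G. brk G h x = 0} = csa G" and csa_subspace: "subspace (csa G)"
  using cartan by (simp_all add: cartan_subalgebra_def)

lemma csa_closed: "x \<in> csa G \<Longrightarrow> y \<in> csa G \<Longrightarrow> x + y \<in> csa G"
  "x \<in> csa G \<Longrightarrow> smult G a x \<in> csa G" "0 \<in> csa G" "x \<in> csa G \<Longrightarrow> y \<in> csa G \<Longrightarrow> x - y \<in> csa G"
  using csa_subspace subspace_add subspace_scale subspace_0 subspace_diff by blast+

lemma root_dual: "\<beta> \<in> root_system G \<Longrightarrow> \<beta> \<in> dual_csa G"
  by (simp add: root_system_def)

lemma sroot_root: "i \<in> I \<Longrightarrow> sroot G i \<in> root_system G"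
  using base by (simp add: simple_roots_base_def)

lemma sroot_dual: "i \<in> I \<Longrightarrow> sroot G i \<in> dual_csa G"
  using sroot_root root_dual by blast

lemma dual_csaD:
  assumes "\<phi> \<in> dual_csa G"
  shows "x \<in> csa G \<Longrightarrow> y \<in> csa G \<Longrightarrow> \<phi> (x + y) = \<phi> x + \<phi> y"
    "x \<in> csa G \<Longrightarrow> \<phi> (smult G a x) = a * \<phi> x" "x \<notin> csa G \<Longrightarrow> \<phi> x = 0" "\<phi> 0 = 0"
    "x \<in> csa G \<Longrightarrow> y \<in> csa G \<Longrightarrow> \<phi> (x - y) = \<phi> x - \<phi> y"
proof -
  have 1: "\<And>x y. x \<in> csa G \<Longrightarrow> y \<in> csa G \<Longrightarrow> \<phi> (x + y) = \<phi> x + \<phi> y"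
    and 2: "\<And>x a. x \<in> csa G \<Longrightarrow> \<phi> (smult G a x) = a * \<phi> x"
    using assms by (auto simp: dual_csa_def)
  then show "x \<in> csa G \<Longrightarrow> y \<in> csa G \<Longrightarrow> \<phi> (x + y) = \<phi> x + \<phi> y"
    "x \<in> csa G \<Longrightarrow> \<phi> (smult G a x) = a * \<phi> x" by blast+
  show "x \<notin> csa G \<Longrightarrow> \<phi> x = 0" using assms by (simp add: dual_csa_def)
  show "\<phi> 0 = 0" using 2[OF csa_closed(3), of 0] by simp
  show "\<phi> (x - y) = \<phi> x - \<phi> y" if "x \<in> csa G" "y \<in> csa G"
    using 1[OF csa_closed(4)[OF that] that(2)] by simp
qed

lemma dual_csa_sum:
  assumes "\<phi> \<in> dual_csa G" "finite J" "\<And>j. j \<in> J \<Longrightarrow> x j \<in> csa G"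
  shows "(\<Sum>j\<in>J. x j) \<in> csa G \<and> \<phi> (\<Sum>j\<in>J. x j) = (\<Sum>j\<in>J. \<phi> (x j))"
  using assms(2,3) by (induction J rule: finite_induct) (auto simp: csa_closed dual_csaD[OF assms(1)])

lemma brk_e: "h \<in> csa G \<Longrightarrow> i \<in> I \<Longrightarrow> brk G h (raising G i) = smult G (sroot G i h) (raising G i)"
  and brk_f: "h \<in> csa G \<Longrightarrow> i \<in> I \<Longrightarrow> brk G h (lowering G i) = smult G (- sroot G i h) (lowering G i)"
  and sroot_scoroot: "i \<in> I \<Longrightarrow> sroot G i (scoroot G i) = 2"
  and brk_ef: "i \<in> I \<Longrightarrow> j \<in> I \<Longrightarrow> brk G (raising G i) (lowering G j) = (if i = j then scoroot G i else 0)"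
  and generated: "lie_subalgebra G S \<Longrightarrow> raising G ` I \<subseteq> S \<Longrightarrow> lowering G ` I \<subseteq> S \<Longrightarrow> S = UNIV"
  using chev unfolding chevalley_generators_def root_space_def by blast+

lemma scoroot_csa: "i \<in> I \<Longrightarrow> scoroot G i \<in> csa G"
proof -
  assume i: "i \<in> I"
  have "brk G h (scoroot G i) = 0" if h: "h \<in> csa G" for h
  proof -
    have "brk G h (scoroot G i) = brk G h (brk G (raising G i) (lowering G i))" using i by (simp add: brk_ef)
    also have "\<dots> = 0" unfolding brk_derivation[of h] using h i
      by (simp add: brk_e brk_f brk_scale_left brk_scale_right brk_minus_right)
    finally show ?thesis .
  qed
  then show ?thesis using csa_eq by blast
qed

text \<open>Such an element commutes with the Chevalley generators, hence with the whole algebra.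
  The centre is an ideal different from the whole algebra, so by simplicity it is zero.\<close>

lemma csa_separated:
  assumes x: "x \<in> csa G" and z: "\<And>i. i \<in> I \<Longrightarrow> sroot G i x = 0"
  shows "x = 0"
proof -
  have "lie_subalgebra G {y. brk G x y = 0}"
    unfolding lie_subalgebra_def subspace_def
    by (auto simp: brk_add_right brk_scale_right brk_derivation[of x])
  then have "{y. brk G x y = 0} = UNIV"
    by (rule generated) (use x z in \<open>auto simp: brk_e brk_f\<close>)
  then have xc: "brk G x y = 0" for y by blast
  let ?Z = "{z. \<forall>y. brk G z y = 0}"
  have "lie_ideal G ?Z" unfolding lie_ideal_def subspace_def
    by (auto simp: brk_add_left brk_scale_left) (metis add.inverse_neutral brk_0(2) brk_anti)
  moreover have "?Z \<noteq> UNIV" using simp_lie unfolding simple_lie_def by blast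
  ultimately have "?Z = {0}" using simp_lie unfolding simple_lie_def by blast
  then show ?thesis using xc by blast
qed

lemma csa_eqI:
  assumes "x \<in> csa G" "y \<in> csa G" "\<And>i. i \<in> I \<Longrightarrow> sroot G i x = sroot G i y"
  shows "x = y"
  using csa_separated[of "x - y"] assms by (simp add: csa_closed dual_csaD(5)[OF sroot_dual])

lemma sroots_independent: "(\<And>x. (\<Sum>i\<in>I. a i * sroot G i x) = 0) \<Longrightarrow> i \<in> I \<Longrightarrow> a i = 0"
  using base unfolding simple_roots_base_def by blast

lemma dual_csa_combination:
  assumes "\<phi> \<in> dual_csa G" "\<psi> \<in> dual_csa G"
  shows "(\<lambda>x. a * \<phi> x + b * \<psi> x) \<in> dual_csa G"
  using assms by (auto simp: dual_csa_def algebra_simps)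

text \<open>A functional that vanishes on the common kernel of finitely many functionals is a
  combination of them. Removing one functional \<open>k\<close>, the coefficient at \<open>k\<close>
  is read off at a point of the remaining kernel.\<close>

lemma vanishing_functional:
  assumes "J \<subseteq> I" "\<phi> \<in> dual_csa G" "\<And>x. x \<in> csa G \<Longrightarrow> \<forall>j\<in>J. sroot G j x = 0 \<Longrightarrow> \<phi> x = 0"
  shows "\<exists>a. \<forall>x. \<phi> x = (\<Sum>j\<in>J. a j * sroot G j x)"
  using finite_subset[OF assms(1) finite_I] assms
proof (induction J arbitrary: \<phi> rule: finite_induct)
  case empty
  then show ?case using dual_csaD(3) by auto
next
  case (insert k J)
  have k: "sroot G k \<in> dual_csa G" using insert.prems(1) sroot_dual by blast
  have J: "sroot G j \<in> dual_csa G" if "j \<in> J" for j using that insert.prems(1) sroot_dual by blast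
  obtain b where b: "x \<in> csa G \<Longrightarrow> \<forall>j\<in>J. sroot G j x = 0 \<Longrightarrow> \<phi> x = b * sroot G k x" for x
  proof (cases "\<exists>z\<in>csa G. (\<forall>j\<in>J. sroot G j z = 0) \<and> sroot G k z \<noteq> 0")
    case True
    then obtain z where z: "z \<in> csa G" "\<forall>j\<in>J. sroot G j z = 0" "sroot G k z \<noteq> 0" by blast
    have "\<phi> x = \<phi> z / sroot G k z * sroot G k x" if x: "x \<in> csa G" "\<forall>j\<in>J. sroot G j x = 0" for x
    proof -
      \<comment> \<open>The projection of \<open>x\<close> along \<open>z\<close> into the kernel of
        the root \<open>k\<close>; it stays in the kernel of the roots from
        \<open>J\<close>.\<close>
      let ?y = "x - smult G (sroot G k x / sroot G k z) z"
      have "\<psi> ?y = \<psi> x - sroot G k x / sroot G k z * \<psi> z" if "\<psi> \<in> dual_csa G" for \<psi>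
        using dual_csaD(2,5)[OF that] x z csa_closed by simp
      note y = this[OF insert.prems(2)] this[OF k] this[OF J]
      have "\<phi> ?y = 0" using y(2,3) x z csa_closed by (intro insert.prems(3)) auto
      then show ?thesis using y(1) by (simp add: field_simps)
    qed
    then show ?thesis using that by blast
  next
    case False
    then show ?thesis using that[of 0] insert.prems(3) by auto
  qed
  obtain a where a: "\<And>x. 1 * \<phi> x + (- b) * sroot G k x = (\<Sum>j\<in>J. a j * sroot G j x)"
    using insert.IH[OF _ dual_csa_combination[OF insert.prems(2) k, of 1 "- b"]] insert.prems(1) b by auto
  have "\<phi> x = (\<Sum>j\<in>insert k J. (a(k := b)) j * sroot G j x)" for x
  proof -
    have "(\<Sum>j\<in>J. (a(k := b)) j * sroot G j x) = (\<Sum>j\<in>J. a j * sroot G j x)"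
      using insert.hyps by (intro sum.cong) auto
    then show ?thesis using a[of x] insert.hyps by (simp add: algebra_simps)
  qed
  then show ?case by blast
qed

text \<open>If the simple root \<open>i\<close> vanished on the common kernel of the others, it
  would be a combination of them, against independence. A point of that kernel where it does not
  vanish only has to be rescaled.\<close>

lemma fund_coweight:
  assumes i: "i \<in> I"
  shows "fund_coweight G i \<in> csa G" and "j \<in> I \<Longrightarrow> sroot G j (fund_coweight G i) = (if i = j then 1 else 0)"
proof -
  let ?P = "\<lambda>x. x \<in> csa G \<and> (\<forall>j\<in>I. sroot G j x = (if i = j then 1 else 0))"
  have "\<exists>x\<in>csa G. (\<forall>j\<in>I-{i}. sroot G j x = 0) \<and> sroot G i x \<noteq> 0"
  proof (rule ccontr)
    assume "\<not> ?thesis"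
    then obtain a where a: "\<And>x. sroot G i x = (\<Sum>j\<in>I-{i}. a j * sroot G j x)"
      using vanishing_functional[of "I - {i}" "sroot G i"] sroot_dual[OF i] by blast
    have "(\<Sum>j\<in>I. (a(i := - 1)) j * sroot G j x) = 0" for x
    proof -
      have "(\<Sum>j\<in>I-{i}. (a(i := - 1)) j * sroot G j x) = sroot G i x"
        unfolding a[of x] by (intro sum.cong) auto
      then show ?thesis using i by (simp add: sum.remove[of I i])
    qed
    then have "(a(i := - 1)) i = 0" using sroots_independent[of "a(i := - 1)"] i by blast
    then show False by simp
  qed
  then obtain x where x: "x \<in> csa G" "\<And>j. j \<in> I - {i} \<Longrightarrow> sroot G j x = 0" "sroot G i x \<noteq> 0" by blast
  then have "?P (smult G (1 / sroot G i x) x)" by (auto simp: csa_closed dual_csaD(2)[OF sroot_dual])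
  then have "?P (fund_coweight G i)" unfolding fund_coweight_def
    by (rule theI[of ?P]) (use \<open>?P _\<close> csa_eqI in auto)
  then show "fund_coweight G i \<in> csa G" "j \<in> I \<Longrightarrow> sroot G j (fund_coweight G i) = (if i = j then 1 else 0)"
    by auto
qed

lemma sl2_adjoint:
  assumes i: "i \<in> I"
  shows "sl2_module (smult G) (brk G (raising G i)) (brk G (lowering G i)) (brk G (scoroot G i))"
proof
  note h = scoroot_csa[OF i]
  fix v
  show "brk G (scoroot G i) (brk G (raising G i) v) = brk G (raising G i) (brk G (scoroot G i) v) + smult G 2 (brk G (raising G i) v)"
    using i by (subst brk_derivation) (simp add: brk_e[OF h i] sroot_scoroot brk_scale_left)
  show "brk G (scoroot G i) (brk G (lowering G i) v) = brk G (lowering G i) (brk G (scoroot G i) v) - smult G 2 (brk G (lowering G i) v)"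
    using i by (subst brk_derivation) (simp add: brk_f[OF h i] sroot_scoroot brk_scale_left brk_minus_left)
  show "brk G (raising G i) (brk G (lowering G i) v) = brk G (lowering G i) (brk G (raising G i) v) + brk G (scoroot G i) v"
    using i by (subst brk_derivation) (simp add: brk_ef)
qed (simp_all add: fd brk_add_right brk_scale_right)

lemma root_space_pow:
  assumes y: "\<And>h. h \<in> csa G \<Longrightarrow> brk G h y = smult G (a h) y" and x: "x \<in> root_space G \<beta>"
  shows "(brk G y ^^ r) x \<in> root_space G (\<lambda>h. \<beta> h + of_nat r * a h)"
proof (induction r)
  case (Suc r)
  let ?z = "(brk G y ^^ r) x"
  have "brk G h (brk G y ?z) = smult G (\<beta> h + of_nat (Suc r) * a h) (brk G y ?z)" if h: "h \<in> csa G" for h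
  proof -
    have z: "brk G h ?z = smult G (\<beta> h + of_nat r * a h) ?z" using Suc h by (simp add: root_space_def)
    have "brk G h (brk G y ?z) = smult G (a h) (brk G y ?z) + smult G (\<beta> h + of_nat r * a h) (brk G y ?z)"
      unfolding brk_derivation[of h] y[OF h] z by (simp only: brk_scale_left brk_scale_right)
    then show ?thesis unfolding scale_left_distrib[symmetric] by (simp add: algebra_simps)
  qed
  then show ?case by (simp add: root_space_def)
qed (use x in simp)

text \<open>A nonzero root vector, moved up and down its string by the adjoint sl2-action of
  \<open>i\<close>, gives a nonzero vector of the reflected weight.\<close>

lemma root_reflection:
  assumes i: "i \<in> I" and b: "\<beta> \<in> root_system G" and m: "\<beta> (scoroot G i) = of_int m"
  shows "(\<lambda>x. \<beta> x - of_int m * sroot G i x) \<in> root_system G"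
proof -
  obtain x where x: "x \<in> root_space G \<beta>" "x \<noteq> 0" using b by (auto simp: root_system_def)
  have hx: "brk G (scoroot G i) x = smult G (of_int m) x" using x(1) scoroot_csa[OF i] m by (simp add: root_space_def)
  interpret s: sl2_module "smult G" "brk G (raising G i)" "brk G (lowering G i)" "brk G (scoroot G i)"
    by (rule sl2_adjoint[OF i])
  note e = root_space_pow[where a="sroot G i", OF brk_e[OF _ i]]
    and f = root_space_pow[where a="\<lambda>h. - sroot G i h", OF brk_f[OF _ i]]
  have "\<exists>y\<in>root_space G (\<lambda>x. \<beta> x - of_int m * sroot G i x). y \<noteq> 0"
    using hx x(2)
  proof (cases rule: s.reflected_vector)
    case (1 r a)
    have ca: "(of_nat a :: complex) = of_int m + of_nat r" using 1(1) by (metis of_int_add of_int_of_nat_eq)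
    have "(\<lambda>h. \<beta> h + of_nat r * sroot G i h + of_nat a * - sroot G i h) = (\<lambda>x. \<beta> x - of_int m * sroot G i x)"
      by (rule ext) (simp add: ca algebra_simps)
    then show ?thesis using f[OF _ e[OF _ x(1)], of a r] 1(2) by auto
  next
    case (2 r a)
    have ca: "(of_nat r :: complex) = of_int m + of_nat a" using 2(1) by (metis of_int_add of_int_of_nat_eq)
    have "(\<lambda>h. \<beta> h + of_nat r * - sroot G i h + of_nat a * sroot G i h) = (\<lambda>x. \<beta> x - of_int m * sroot G i x)"
      by (rule ext) (simp add: ca algebra_simps)
    then show ?thesis using e[OF _ f[OF _ x(1)], of a r] 2(2) by auto
  qed
  moreover have "(\<lambda>x. 1 * \<beta> x + (- of_int m) * sroot G i x) \<in> dual_csa G"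
    by (rule dual_csa_combination[OF root_dual[OF b] sroot_dual[OF i]])
  moreover have "(\<lambda>x. \<beta> x - of_int m * sroot G i x) \<noteq> (\<lambda>_. 0)"
  proof
    assume z: "(\<lambda>x. \<beta> x - of_int m * sroot G i x) = (\<lambda>_. 0)"
    have "m = 0" using fun_cong[OF z, of "scoroot G i"] m sroot_scoroot[OF i] by simp
    then have "\<beta> = (\<lambda>_. 0)" using z by simp
    then show False using b by (simp add: root_system_def)
  qed
  ultimately show ?thesis by (simp add: root_system_def)
qed

lemma finite_root_system: "finite (root_system G)"
proof -
  obtain v where v: "\<And>\<beta>. \<beta> \<in> root_system G \<Longrightarrow> v \<beta> \<in> root_space G \<beta> \<and> v \<beta> \<noteq> 0"
    using bchoice[of "root_system G" "\<lambda>\<beta> x. x \<in> root_space G \<beta> \<and> x \<noteq> 0"] by (auto simp: root_system_def)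
  show ?thesis
  proof (rule finite_joint_eigenvectors[OF fd, where K="csa G" and T="brk G" and v=v and \<chi>="\<lambda>\<beta> h. \<beta> h"])
    fix \<beta> \<gamma> assume "\<beta> \<in> root_system G" "\<gamma> \<in> root_system G" "\<beta> \<noteq> \<gamma>"
    then show "\<exists>h\<in>csa G. \<beta> h \<noteq> \<gamma> h" using dual_csaD(3)[OF root_dual] by (metis ext)
  qed (use v in \<open>auto simp: brk_add_right brk_scale_right root_space_def\<close>)
qed

definition root_of :: "vec \<Rightarrow> 'g \<Rightarrow> complex" where
  "root_of q x = (\<Sum>k\<in>I. of_int (q k) * sroot G k x)"

lemma root_of_inject:
  assumes "\<And>x. root_of p x = root_of q x" "k \<in> I" shows "p k = q k"
proof -
  have "(\<Sum>k\<in>I. (of_int (p k) - of_int (q k)) * sroot G k x) = 0" for x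
    using assms(1)[of x] by (simp add: root_of_def left_diff_distrib sum_subtractf)
  then have "(of_int (p k) - of_int (q k) :: complex) = 0" by (rule sroots_independent[of "\<lambda>k. of_int (p k) - of_int (q k)"]) (rule assms(2))
  then show ?thesis by simp
qed

lemma root_of_unit: "i \<in> I \<Longrightarrow> root_of (unit i) = sroot G i"
proof
  fix x assume i: "i \<in> I"
  have "root_of (unit i) x = (\<Sum>k\<in>I. if k = i then sroot G k x else 0)"
    unfolding root_of_def unit_def by (intro sum.cong refl) auto
  then show "root_of (unit i) x = sroot G i x" using i by simp
qed

text \<open>The base property provides some coefficients of constant sign; independence of the
  simple roots identifies them with \<open>q\<close>.\<close>

lemma root_signs:
  assumes r: "root_of q \<in> root_system G" and out: "\<And>k. k \<notin> I \<Longrightarrow> q k = 0"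
  shows "nonneg q \<or> nonpos q"
proof -
  obtain m :: "nat \<Rightarrow> nat" where "root_of q = (\<lambda>x. \<Sum>i\<in>I. of_nat (m i) * sroot G i x) \<or>
      root_of q = (\<lambda>x. - (\<Sum>i\<in>I. of_nat (m i) * sroot G i x))"
    using base r unfolding simple_roots_base_def by blast
  then have "(\<forall>x. root_of q x = root_of (\<lambda>k. int (m k)) x) \<or> (\<forall>x. root_of q x = root_of (\<lambda>k. - int (m k)) x)"
    unfolding fun_eq_iff by (simp add: root_of_def sum_negf)
  then have "(\<forall>k\<in>I. q k = int (m k)) \<or> (\<forall>k\<in>I. q k = - int (m k))" using root_of_inject by blast
  then show ?thesis unfolding nonneg_def nonpos_def using out by (metis of_nat_0_le_iff neg_le_0_iff_le order_refl)
qed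

end


section \<open>Weyl groups of simply laced Lie algebras\<close>

locale simply_laced_setting = lie_setting +
  assumes laced: "simply_laced G"
begin

text \<open>\<open>cartan_entry\<close> is complex valued, hence this integer copy with default 0
  outside \<open>I\<close>. \<open>simply_laced\<close> restricts each entry separately, so symmetry
  has to be proved.\<close>

definition cmat :: "nat \<Rightarrow> nat \<Rightarrow> int" where
  "cmat i j = (if i \<in> I \<and> j \<in> I then if i = j then 2 else if cartan_entry G i j = 0 then 0 else - 1 else 0)"

lemma sroot_scoroot_cmat: "i \<in> I \<Longrightarrow> j \<in> I \<Longrightarrow> sroot G j (scoroot G i) = of_int (cmat i j)"
  using laced sroot_scoroot by (auto simp: cmat_def cartan_entry_def simply_laced_def)

lemma root_of_scoroot: "i \<in> I \<Longrightarrow> root_of q (scoroot G i) = of_int (\<Sum>k\<in>I. cmat i k * q k)"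
  by (simp add: root_of_def sroot_scoroot_cmat mult.commute)

lemma root_of_reflection:
  assumes i: "i \<in> I" and q: "root_of q \<in> root_system G"
  shows "root_of (\<lambda>k. q k - (\<Sum>k\<in>I. cmat i k * q k) * unit i k) \<in> root_system G"
proof -
  let ?m = "\<Sum>k\<in>I. cmat i k * q k"
  have "root_of (\<lambda>k. q k - ?m * unit i k) x = root_of q x - of_int ?m * root_of (unit i) x" for x
    by (simp only: root_of_def of_int_diff of_int_mult left_diff_distrib sum_subtractf sum_distrib_left mult.assoc)
  then have "root_of (\<lambda>k. q k - ?m * unit i k) = (\<lambda>x. root_of q x - of_int ?m * sroot G i x)"
    using root_of_unit[OF i] by (intro ext) simp
  then show ?thesis using root_reflection[OF i q root_of_scoroot[OF i]] by simp
qed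

lemma sum_cmat_unit: "j \<in> I \<Longrightarrow> (\<Sum>k\<in>I. cmat i k * unit j k) = cmat i j"
  by (simp add: sum_unit)

text \<open>If \<open>c\<^sub>i\<^sub>j = 0\<close> but \<open>c\<^sub>j\<^sub>i \<noteq> 0\<close>, then \<open>s\<^sub>i s\<^sub>j \<alpha>\<^sub>i = \<alpha>\<^sub>j - \<alpha>\<^sub>i\<close> would be a root of mixed sign.\<close>

lemma cmat_zero_sym:
  assumes ij: "i \<in> I" "j \<in> I" "i \<noteq> j" and z: "cmat i j = 0" shows "cmat j i = 0"
proof (rule ccontr)
  assume "cmat j i \<noteq> 0"
  then have ji: "cmat j i = - 1" using ij by (auto simp: cmat_def split: if_splits)
  have "root_of (unit i) \<in> root_system G" using root_of_unit sroot_root ij by simp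
  then have "root_of (\<lambda>k. unit i k - (\<Sum>k\<in>I. cmat j k * unit i k) * unit j k) \<in> root_system G"
    by (rule root_of_reflection[OF ij(2)])
  then have "root_of (\<lambda>k. unit i k + unit j k) \<in> root_system G"
    using sum_cmat_unit[OF ij(1)] ji by simp
  then have "root_of (\<lambda>k. unit i k + unit j k -
      (\<Sum>k\<in>I. cmat i k * (unit i k + unit j k)) * unit i k) \<in> root_system G"
    by (rule root_of_reflection[OF ij(1)])
  moreover have "(\<Sum>k\<in>I. cmat i k * (unit i k + unit j k)) = 2"
    using sum_cmat_unit ij z by (simp add: distrib_left sum.distrib cmat_def[of i i])
  ultimately have "root_of (\<lambda>k. unit j k - unit i k) \<in> root_system G" by (simp add: algebra_simps)
  then have "nonneg (\<lambda>k. unit j k - unit i k) \<or> nonpos (\<lambda>k. unit j k - unit i k)"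
    by (rule root_signs) (use ij in \<open>auto simp: unit_def\<close>)
  then show False
  proof
    assume "nonneg (\<lambda>k. unit j k - unit i k)"
    then have "0 \<le> unit j i - unit i i" by (auto simp: nonneg_def)
    then show False using ij by (simp add: unit_def)
  next
    assume "nonpos (\<lambda>k. unit j k - unit i k)"
    then have "unit j j - unit i j \<le> 0" by (auto simp: nonpos_def)
    then show False using ij by (simp add: unit_def)
  qed
qed

sublocale cartan_matrix I cmat
proof
  fix i j
  show "cmat i j = cmat j i"
  proof (cases "i \<in> I \<and> j \<in> I \<and> i \<noteq> j")
    case True
    then show ?thesis using cmat_zero_sym[of i j] cmat_zero_sym[of j i] by (auto simp: cmat_def split: if_splits)
  qed (auto simp: cmat_def)
qed (auto simp: cmat_def)

lemma root_of_act:
  assumes "w \<in> lists I" "i \<in> I" shows "root_of (act w (unit i)) \<in> root_system G"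
  using assms(1)
proof (induction w)
  case Nil
  then show ?case using root_of_unit sroot_root assms by simp
next
  case (Cons j w)
  then show ?case using root_of_reflection[of j "act w (unit i)"] by (simp add: refl_def pair_def)
qed

text \<open>Signs come from the base property. The orbit is finite since \<open>root_of\<close> is
  injective on vectors supported in \<open>I\<close> and maps the orbit into the finite root
  system.\<close>

sublocale root_datum I cmat
proof
  have out: "act w (unit i) k = 0" if "w \<in> lists I" "i \<in> I" "k \<notin> I" for w i k
    using that(1)
  proof (induction w)
    case Nil
    then show ?case using that by (auto simp: unit_def)
  next
    case (Cons j w)
    then show ?case using that by (auto simp: refl_def unit_def)
  qed
  show "nonneg (act w (unit i)) \<or> nonpos (act w (unit i))" if "w \<in> lists I" "i \<in> I" for w i
    using root_signs[OF root_of_act[OF that]] out that by blast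
  let ?R = "{act w (unit i) |w i. w \<in> lists I \<and> i \<in> I}"
  have "inj_on root_of ?R"
  proof (rule inj_onI, rule ext)
    fix p q k assume pq: "p \<in> ?R" "q \<in> ?R" "root_of p = root_of q"
    show "p k = q k"
    proof (cases "k \<in> I")
      case True
      then show ?thesis using root_of_inject[of p q k] pq by simp
    next
      case False
      then have "p k = 0" "q k = 0" using pq out by blast+
      then show ?thesis by simp
    qed
  qed
  moreover have "root_of ` ?R \<subseteq> root_system G" using root_of_act by blast
  then have "finite (root_of ` ?R)" by (rule finite_subset[OF _ finite_root_system])
  ultimately show "finite ?R" by (rule finite_imageD[rotated])
qed

lemma root_of_simple_reflection:
  assumes i: "i \<in> I" shows "root_of q (simple_reflection G i x) = root_of (refl i q) x"
proof -
  have s: "sroot G k (simple_reflection G i x) = sroot G k x - sroot G i x * of_int (cmat i k)" if "k \<in> I" for k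
  proof (cases "x \<in> csa G")
    case True
    then show ?thesis using that i scoroot_csa[OF i]
      by (simp add: simple_reflection_def csa_closed dual_csaD[OF sroot_dual] sroot_scoroot_cmat)
  next
    case False
    then show ?thesis using dual_csaD(3)[OF sroot_dual[OF i]] dual_csaD(3)[OF sroot_dual[OF that]]
      by (simp add: simple_reflection_def)
  qed
  have "root_of q (simple_reflection G i x) = root_of q x - sroot G i x * of_int (pair i q)"
    unfolding root_of_def using s
    by (simp add: right_diff_distrib sum_subtractf pair_def sum_distrib_left mult.commute mult.left_commute)
  also have "\<dots> = root_of (refl i q) x"
  proof -
    have "root_of (refl i q) x = root_of q x - of_int (pair i q) * root_of (unit i) x"
      unfolding root_of_def refl_def by (simp add: left_diff_distrib sum_subtractf sum_distrib_left mult.assoc)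
    then show ?thesis using root_of_unit[OF i] by (simp add: mult.commute)
  qed
  finally show ?thesis .
qed

lemma word_product_simps [simp]: "word_product G [] = id"
  "word_product G (i # w) = simple_reflection G i \<circ> word_product G w"
  by (simp_all add: word_product_def)

lemma word_product_append: "word_product G (u @ w) x = word_product G u (word_product G w x)"
  by (induction u) simp_all

text \<open>Roots are functions on the space on which the word acts, hence the reversal.\<close>

lemma root_of_word_product: "w \<in> lists I \<Longrightarrow> root_of q (word_product G w x) = root_of (act (rev w) q) x"
  by (induction w arbitrary: q) (auto simp: root_of_simple_reflection act_append)

lemma simple_reflection_csa: "i \<in> I \<Longrightarrow> x \<in> csa G \<Longrightarrow> simple_reflection G i x \<in> csa G"
  by (simp add: simple_reflection_def csa_closed scoroot_csa)

lemma word_product_csa: "w \<in> lists I \<Longrightarrow> x \<in> csa G \<Longrightarrow> word_product G w x \<in> csa G"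
  by (induction w) (auto simp: simple_reflection_csa)

lemma word_product_outside: "w \<in> lists I \<Longrightarrow> x \<notin> csa G \<Longrightarrow> word_product G w x = x"
  by (induction w) (auto simp: simple_reflection_def dual_csaD(3)[OF sroot_dual])

text \<open>The map of a word is the identity outside the Cartan subalgebra and is determined there
  by the values of the simple roots. Comparing words as permutations of the algebra thus amounts to
  comparing their actions on root coordinates, which transfers lengths and reducedness.\<close>

lemma word_product_eq_iff:
  assumes u: "u \<in> lists I" and w: "w \<in> lists I"
  shows "word_product G u = word_product G w \<longleftrightarrow> act u = act w"
proof
  have rl: "rev u \<in> lists I" "rev w \<in> lists I" using u w by (auto simp: in_lists_conv_set)
  assume eq: "word_product G u = word_product G w"
  have "act (rev u) = act (rev w)"
  proof (rule act_eqI[OF rl], rule ext)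
    fix i k assume i: "i \<in> I"
    have "root_of (act (rev u) (unit i)) x = root_of (act (rev w) (unit i)) x" for x
      using eq root_of_word_product u w by metis
    then show "act (rev u) (unit i) k = act (rev w) (unit i) k"
      using root_of_inject[of _ _ k] act_outside[OF rl(1), of k] act_outside[OF rl(2), of k]
      by (cases "k \<in> I") auto
  qed
  then show "act u = act w" using act_rev_eq_iff u w by blast
next
  assume eq: "act u = act w"
  then have eq': "act (rev u) = act (rev w)" using act_rev_eq_iff u w by blast
  show "word_product G u = word_product G w"
  proof
    fix x
    show "word_product G u x = word_product G w x"
    proof (cases "x \<in> csa G")
      case True
      show ?thesis
      proof (rule csa_eqI)
        fix i assume "i \<in> I"
        then show "sroot G i (word_product G u x) = sroot G i (word_product G w x)"
          using root_of_word_product[OF u] root_of_word_product[OF w] eq' root_of_unit by metis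
      qed (use True u w word_product_csa in auto)
    next
      case False
      then show ?thesis using word_product_outside u w by simp
    qed
  qed
qed

lemma weyl_length_reduced: "reduced w \<Longrightarrow> weyl_length G (word_product G w) = length w"
  unfolding weyl_length_def
  by (rule Least_equality) (auto simp: reduced_def word_product_eq_iff)

lemma weyl_group_reduced: "v \<in> weyl_group G \<Longrightarrow> \<exists>w. reduced w \<and> v = word_product G w"
proof -
  assume "v \<in> weyl_group G"
  then obtain u where u: "u \<in> lists I" "v = word_product G u" by (auto simp: weyl_group_def)
  then show ?thesis using ex_reduced[OF u(1)] word_product_eq_iff reduced_lists by metis
qed

lemma longest_element_eq:
  assumes l: "longest w" shows "longest_element G = word_product G w"
  unfolding longest_element_def
proof (rule the_equality)
  have r: "reduced w" using l by (simp add: longest_def)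
  show "word_product G w \<in> weyl_group G \<and> (\<forall>v\<in>weyl_group G. weyl_length G v \<le> weyl_length G (word_product G w))"
  proof (intro conjI ballI)
    show "word_product G w \<in> weyl_group G" using reduced_lists[OF r] by (simp add: weyl_group_def)
    fix v assume "v \<in> weyl_group G"
    then obtain u where "reduced u" "v = word_product G u" using weyl_group_reduced by blast
    then show "weyl_length G v \<le> weyl_length G (word_product G w)"
      using l r by (simp add: weyl_length_reduced longest_iff)
  qed
  fix v assume v: "v \<in> weyl_group G \<and> (\<forall>v'\<in>weyl_group G. weyl_length G v' \<le> weyl_length G v)"
  then obtain u where u: "reduced u" "v = word_product G u" using weyl_group_reduced by blast
  have "length z \<le> length u" if "reduced z" for z
  proof -
    have "word_product G z \<in> weyl_group G" using reduced_lists[OF that] by (simp add: weyl_group_def)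
    then show ?thesis using v u that weyl_length_reduced by metis
  qed
  then have "longest u" using u longest_iff by blast
  then show "v = word_product G w"
    using longest_unique[OF _ l] u word_product_eq_iff reduced_lists r by metis
qed

lemma longest_length_eq: "longest w \<Longrightarrow> longest_length G = length w"
  by (simp add: longest_length_def longest_element_eq weyl_length_reduced longest_def)

text \<open>Replaces the definite description of the longest element by the condition on the signs
  of the simple roots.\<close>

lemma reduced_words_w0_iff: "w \<in> reduced_words_w0 G \<longleftrightarrow> longest w"
proof
  assume w: "w \<in> reduced_words_w0 G"
  obtain u where u: "longest u" using ex_longest by blast
  have "w \<in> lists I" "length w = length u" "word_product G w = word_product G u"
    using w longest_length_eq[OF u] longest_element_eq[OF u] by (auto simp: reduced_words_w0_def)
  moreover have ru: "reduced u" using u by (simp add: longest_def)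
  ultimately have "act w = act u" using word_product_eq_iff reduced_lists by blast
  then show "longest w" using u ru \<open>w \<in> lists I\<close> \<open>length w = length u\<close>
    by (simp add: longest_def reduced_def)
next
  assume l: "longest w"
  then have "w \<in> lists I" by (simp add: longest_def reduced_def)
  then show "w \<in> reduced_words_w0 G"
    using longest_length_eq[OF l] longest_element_eq[OF l] by (simp add: reduced_words_w0_def)
qed

section \<open>Integral coweights in coordinates\<close>

definition coweight :: "vec \<Rightarrow> 'a" where
  "coweight p = (\<Sum>j\<in>I. smult G (of_int (p j)) (fund_coweight G j))"

lemma coweight_csa: "coweight p \<in> csa G"
  and sroot_coweight: "i \<in> I \<Longrightarrow> sroot G i (coweight p) = of_int (p i)"
proof -
  have m: "\<And>j. j \<in> I \<Longrightarrow> smult G (of_int (p j)) (fund_coweight G j) \<in> csa G"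
    by (simp add: csa_closed fund_coweight)
  show "coweight p \<in> csa G" unfolding coweight_def
    by (rule subspace_sum[OF csa_subspace]) (rule m)
  assume i: "i \<in> I"
  have "sroot G i (coweight p) = (\<Sum>j\<in>I. sroot G i (smult G (of_int (p j)) (fund_coweight G j)))"
    unfolding coweight_def using dual_csa_sum[OF sroot_dual[OF i] finite_I m] by simp
  also have "\<dots> = (\<Sum>j\<in>I. if j = i then of_int (p j) else 0)"
    using i by (intro sum.cong refl) (simp add: dual_csaD(2)[OF sroot_dual] fund_coweight)
  finally show "sroot G i (coweight p) = of_int (p i)" using i by simp
qed

lemma coweight_inject: "coweight p = coweight q \<Longrightarrow> i \<in> I \<Longrightarrow> p i = q i"
  by (metis sroot_coweight of_int_eq_iff)

lemma coweight_unit: "i \<in> I \<Longrightarrow> coweight (unit i) = fund_coweight G i"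
  by (rule csa_eqI) (auto simp: coweight_csa sroot_coweight fund_coweight unit_def)

lemma scoroot_coweight: "i \<in> I \<Longrightarrow> scoroot G i = coweight (cmat i)"
  by (rule csa_eqI) (auto simp: coweight_csa sroot_coweight scoroot_csa sroot_scoroot_cmat)

lemma coweight_add: "coweight (\<lambda>l. p l + a * q l) = coweight p + smult G (of_int a) (coweight q)"
  by (rule csa_eqI) (auto simp: coweight_csa sroot_coweight csa_closed dual_csaD[OF sroot_dual])

lemma simple_reflection_coweight: "i \<in> I \<Longrightarrow> simple_reflection G i (coweight p) = coweight (dual_refl i p)"
  by (rule csa_eqI)
    (auto simp: simple_reflection_def coweight_csa sroot_coweight csa_closed dual_csaD[OF sroot_dual]
      scoroot_csa sroot_scoroot_cmat dual_refl_def)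

lemma word_product_coweight: "w \<in> lists I \<Longrightarrow> word_product G w (coweight p) = coweight (dual_act w p)"
  by (induction w) (auto simp: simple_reflection_coweight)

lemma word_product_linear:
  assumes "w \<in> lists I" "x \<in> csa G" "y \<in> csa G"
  shows "word_product G w (smult G a x + y) = smult G a (word_product G w x) + word_product G w y"
proof (rule csa_eqI)
  fix i assume i: "i \<in> I"
  have r: "sroot G i (word_product G w z) = root_of (act (rev w) (unit i)) z" for z
    using root_of_word_product[OF assms(1), of "unit i"] root_of_unit[OF i] by simp
  have lin: "root_of q (smult G a x + y) = a * root_of q x + root_of q y" for q
    using assms by (simp add: root_of_def csa_closed dual_csaD[OF sroot_dual] distrib_left sum.distrib
        sum_distrib_left mult.left_commute)
  show "sroot G i (word_product G w (smult G a x + y)) = sroot G i (smult G a (word_product G w x) + word_product G w y)"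
    using i assms by (simp add: csa_closed dual_csaD[OF sroot_dual] word_product_csa lin flip: r)
      (simp add: r lin)
qed (use assms in \<open>auto simp: csa_closed word_product_csa\<close>)

end


section \<open>Minuscule modules\<close>

locale dual_setting = simply_laced_setting +
  fixes L :: "'l::ab_group_add lie_data" and \<iota> :: "('a \<Rightarrow> complex) \<Rightarrow> 'l"
  assumes dual: "langlands_dual G L \<iota>"
begin

sublocale L: lie_setting L
  using dual by unfold_locales (simp add: langlands_dual_def)

lemma index_L: "index_set L = I"
  using dual by (simp add: langlands_dual_def index_set_def)

lemma iota_bij: "bij_betw \<iota> (dual_csa G) (csa L)"
  and scoroot_L: "i \<in> I \<Longrightarrow> scoroot L i = \<iota> (sroot G i)"
  and sroot_L: "i \<in> I \<Longrightarrow> \<phi> \<in> dual_csa G \<Longrightarrow> sroot L i (\<iota> \<phi>) = \<phi> (scoroot G i)"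
  using dual unfolding langlands_dual_def by blast+

lemma iota_csa: "\<phi> \<in> dual_csa G \<Longrightarrow> \<iota> \<phi> \<in> csa L"
  using iota_bij bij_betwE by blast

text \<open>Under \<open>\<iota>\<close> the simple coroots of \<open>G\<close> become the simple
  roots of \<open>L\<close>, which separate the points of its Cartan subalgebra.\<close>

lemma dual_csa_eqI:
  assumes "\<phi> \<in> dual_csa G" "\<psi> \<in> dual_csa G" "\<And>i. i \<in> I \<Longrightarrow> \<phi> (scoroot G i) = \<psi> (scoroot G i)"
  shows "\<phi> = \<psi>"
proof -
  have "\<iota> \<phi> = \<iota> \<psi>"
    by (rule L.csa_eqI) (use assms iota_csa sroot_L index_L in auto)
  then show ?thesis using iota_bij assms by (meson bij_betw_def inj_onD)
qed

lemma fund_weight: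
  assumes i: "i \<in> I"
  shows "fund_weight G i \<in> dual_csa G" "j \<in> I \<Longrightarrow> fund_weight G i (scoroot G j) = (if i = j then 1 else 0)"
proof -
  let ?P = "\<lambda>\<omega>. \<omega> \<in> dual_csa G \<and> (\<forall>j\<in>I. \<omega> (scoroot G j) = (if i = j then 1 else 0))"
  have c: "fund_coweight L i \<in> csa L" "\<And>j. j \<in> I \<Longrightarrow> sroot L j (fund_coweight L i) = (if i = j then 1 else 0)"
    using L.fund_coweight i index_L by auto
  then obtain \<omega> where w: "\<omega> \<in> dual_csa G" "\<iota> \<omega> = fund_coweight L i" using iota_bij by (metis bij_betw_imp_surj_on imageE)
  then have "?P \<omega>" using c sroot_L by metis
  then have "?P (fund_weight G i)" unfolding fund_weight_def
    by (rule theI[of ?P]) (use \<open>?P \<omega>\<close> dual_csa_eqI in auto)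
  then show "fund_weight G i \<in> dual_csa G" "j \<in> I \<Longrightarrow> fund_weight G i (scoroot G j) = (if i = j then 1 else 0)"
    by auto
qed

lemma zero_dual_csa: "(\<lambda>_. 0) \<in> dual_csa G"
  by (simp add: dual_csa_def)

lemma root_of_dual: "root_of q \<in> dual_csa G"
proof -
  have "root_of q (x + y) = root_of q x + root_of q y" if "x \<in> csa G" "y \<in> csa G" for x y
    using that by (simp add: root_of_def dual_csaD(1)[OF sroot_dual] distrib_left sum.distrib)
  moreover have "root_of q (smult G a x) = a * root_of q x" if "x \<in> csa G" for a x
    using that by (simp add: root_of_def dual_csaD(2)[OF sroot_dual] sum_distrib_left mult.left_commute)
  moreover have "root_of q x = 0" if "x \<notin> csa G" for x
    using that by (simp add: root_of_def dual_csaD(3)[OF sroot_dual])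
  ultimately show ?thesis by (simp add: dual_csa_def)
qed

text \<open>By symmetry of the Cartan matrix, the coefficients of a relation among coroots define a
  combination of simple roots that vanishes at every simple coroot. That functional is zero, and the
  simple roots are independent.\<close>

lemma coroots_independent:
  assumes "\<And>l. l \<in> I \<Longrightarrow> (\<Sum>k\<in>I. m k * cmat k l) = 0" "k \<in> I" shows "m k = 0"
proof -
  have "root_of m = (\<lambda>_. 0)"
  proof (rule dual_csa_eqI[OF root_of_dual zero_dual_csa])
    fix i assume i: "i \<in> I"
    have "(\<Sum>k\<in>I. cmat i k * m k) = (\<Sum>k\<in>I. m k * cmat k i)"
      by (intro sum.cong refl) (simp add: mult.commute local.sym[of i])
    then show "root_of m (scoroot G i) = 0" using root_of_scoroot[OF i, of m] assms(1)[OF i] by simp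
  qed
  then have "root_of m x = root_of (\<lambda>_. 0) x" for x by (simp add: root_of_def)
  then show ?thesis using root_of_inject assms(2) by blast
qed

text \<open>Otherwise a natural combination of simple coroots with a positive coefficient at
  \<open>j\<close> would be zero. This supplies the premise \<open>strict\<close> of
  \<open>trail_sum_extremal\<close>.\<close>

lemma not_dominated_raise: "j \<in> I \<Longrightarrow> \<not> dominated (\<lambda>l. g l + cmat j l) g"
proof
  assume j: "j \<in> I" and "dominated (\<lambda>l. g l + cmat j l) g"
  then obtain n where n: "nonneg n" "g = (\<lambda>l. g l + cmat j l + (\<Sum>k\<in>I. n k * cmat k l))"
    unfolding dominated_def by blast
  have "(\<Sum>k\<in>I. (n k + 1 * unit j k) * cmat k l) = 0" for l
    unfolding combination_unit[OF j] using fun_cong[OF n(2), of l] by simp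
  then have "n j + 1 * unit j j = 0" using coroots_independent[of "\<lambda>k. n k + 1 * unit j k" j] j by blast
  then show False using n(1) by (simp add: nonneg_def unit_def) (metis add_nonneg_eq_0_iff zero_le_one zero_neq_one)
qed

text \<open>\<open>star_index\<close> is defined by fundamental weights, whereas the proof works
  with the permutation of simple roots. The two agree because the longest element permutes the
  simple coroots up to sign in the same way, and functionals are determined by their values at the
  coroots.\<close>

lemma star_index_longest:
  assumes l: "longest w" and i: "i \<in> I"
  shows "star_index G i \<in> I" "act w (unit i) = (\<lambda>k. - unit (star_index G i) k)"
proof -
  have w: "w \<in> lists I" and wr: "rev w \<in> lists I" using l by (auto simp: longest_def reduced_def in_lists_conv_set)
  obtain j where j: "j \<in> I" "act w (unit i) = (\<lambda>k. - unit j k)" using longest_simple[OF l i] .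
  let ?w0 = "word_product G w"
  have inv: "?w0 (?w0 x) = x" for x
  proof -
    have "act (w @ w) = act []" using longest_twice[OF l] by (intro ext) (simp add: act_append)
    then have "word_product G (w @ w) = word_product G []" using word_product_eq_iff[of "w @ w" "[]"] w by simp
    then show ?thesis by (metis word_product_append word_product_simps(1) id_apply)
  qed
  then have invw: "inv ?w0 = ?w0" by (intro inv_unique_comp) (auto simp: fun_eq_iff)
  have act_dual: "weyl_act_dual (longest_element G) \<phi> = (\<lambda>x. \<phi> (?w0 x))" for \<phi>
    unfolding longest_element_eq[OF l] weyl_act_dual_def invw by (simp add: comp_def)
  have cor: "?w0 (scoroot G k) = - scoroot G m" if "k \<in> I" "m \<in> I" "act w (unit k) = (\<lambda>l. - unit m l)" for k m
  proof -
    have "?w0 (scoroot G k) = coweight (dual_act w (cmat k))" by (simp add: scoroot_coweight that word_product_coweight w)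
    also have "cmat k = (\<lambda>l. pair l (unit k))" using that local.sym by (intro ext) simp
    also have "dual_act w \<dots> = (\<lambda>l. pair l (act w (unit k)))" by (rule dual_act_pair[OF w])
    also have "\<dots> = (\<lambda>l. - cmat m l)"
      unfolding that(3) using pair_scale[of _ "- 1" "unit m"] that local.sym by (intro ext) simp
    also have "coweight \<dots> = - scoroot G m"
      unfolding scoroot_coweight[OF that(2)] by (simp add: coweight_def sum_negf)
    finally show ?thesis .
  qed
  have w0c: "?w0 x \<in> csa G \<longleftrightarrow> x \<in> csa G" for x using word_product_csa[OF w] inv by metis
  have neg: "(\<lambda>x. - fund_weight G j x) \<in> dual_csa G" if "j \<in> I" for j
    using dual_csa_combination[OF fund_weight(1)[OF that] zero_dual_csa, of "- 1" 0] by simp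
  note fwd = dual_csaD[OF fund_weight(1)[OF i]]
  have lin: "(\<lambda>x. fund_weight G i (?w0 x)) \<in> dual_csa G"
  proof -
    have "fund_weight G i (?w0 (x + y)) = fund_weight G i (?w0 x) + fund_weight G i (?w0 y)" if "x \<in> csa G" "y \<in> csa G" for x y
      using word_product_linear[OF w that, of 1] fwd(1) w0c that by simp
    moreover have "fund_weight G i (?w0 (smult G a x)) = a * fund_weight G i (?w0 x)" if "x \<in> csa G" for a x
    proof -
      have "?w0 0 = 0" using word_product_linear[OF w csa_closed(3) csa_closed(3), of 1] by simp
      then show ?thesis using word_product_linear[OF w that csa_closed(3), of a] fwd(2) w0c that by simp
    qed
    moreover have "fund_weight G i (?w0 x) = 0" if "x \<notin> csa G" for x using that fwd(3) w0c by blast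
    ultimately show ?thesis by (simp add: dual_csa_def)
  qed
  have fneg: "fund_weight G k (- scoroot G m) = - fund_weight G k (scoroot G m)" if "k \<in> I" "m \<in> I" for k m
    using dual_csaD(2)[OF fund_weight(1)[OF that(1)] scoroot_csa[OF that(2)], of "- 1"] by simp
  have main: "weyl_act_dual (longest_element G) (fund_weight G i) = (\<lambda>x. - fund_weight G j x)"
    unfolding act_dual
  proof (rule dual_csa_eqI[OF lin neg[OF j(1)]])
    fix k assume k: "k \<in> I"
    obtain m where m: "m \<in> I" "act w (unit k) = (\<lambda>l. - unit m l)" using longest_simple[OF l k] .
    \<comment> \<open>The permutation attached to the longest element is an involution that takes
      \<open>i\<close> to \<open>j\<close> and \<open>k\<close> to \<open>m\<close>.\<close>
    have "i = m \<longleftrightarrow> j = k"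
      using longest_swap[OF l m(2)] longest_swap[OF l j(2)] j m
      by (metis (no_types, lifting) ext minus_equation_iff unit_inject)
    then show "fund_weight G i (?w0 (scoroot G k)) = - fund_weight G j (scoroot G k)"
      using cor[OF k m] fneg[OF i m(1)] fund_weight(2)[OF i m(1)] fund_weight(2)[OF j(1) k] by simp
  qed
  have "star_index G i = j" unfolding star_index_def
  proof (rule the_equality)
    show "j \<in> I \<and> weyl_act_dual (longest_element G) (fund_weight G i) = (\<lambda>x. - fund_weight G j x)" using j main by blast
    fix j' assume j': "j' \<in> I \<and> weyl_act_dual (longest_element G) (fund_weight G i) = (\<lambda>x. - fund_weight G j' x)"
    then have "fund_weight G j' (scoroot G j) = fund_weight G j (scoroot G j)"
      using main by (metis minus_equation_iff)
    then show "j' = j" using fund_weight(2) j j' by (metis zero_neq_one)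
  qed
  then show "star_index G i \<in> I" "act w (unit i) = (\<lambda>k. - unit (star_index G i) k)" using j by auto
qed

end

text \<open>\<open>act w (unit j) s\<close> is the coefficient of a root at the simple root
  \<open>s\<close>, that is, the value of the root at the fundamental coweight \<open>s\<close>.
  Thus \<open>root_bound\<close> expresses minusculeness of \<open>s\<close> on the Weyl orbit of
  the simple roots.\<close>

locale minuscule_module = dual_setting G L \<iota>
  for G :: "'a::ab_group_add lie_data" and L :: "'l::ab_group_add lie_data" and \<iota> +
  fixes sc :: "complex \<Rightarrow> 'v::ab_group_add \<Rightarrow> 'v" and \<rho> :: "'l \<Rightarrow> 'v \<Rightarrow> 'v" and s :: nat
  assumes s: "s \<in> I"
    and module: "highest_weight_module G L \<iota> sc \<rho> (fund_coweight G s)"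
    and root_bound: "w \<in> lists I \<Longrightarrow> j \<in> I \<Longrightarrow> act w (unit j) s \<in> {- 1, 0, 1}"
begin

lemma mod_fd: "finite_dim sc" and irreducible: "irreducible_module L sc \<rho>" and lmod: "lie_module L sc \<rho>"
  using module by (auto simp: highest_weight_module_def irreducible_module_def)

sublocale V: vector_space sc using mod_fd by (simp add: finite_dim_def)

lemma rho_add_left: "\<rho> (x + y) v = \<rho> x v + \<rho> y v"
  and rho_scale_left: "\<rho> (smult L a x) v = sc a (\<rho> x v)"
  and rho_add: "\<rho> x (u + v) = \<rho> x u + \<rho> x v"
  and rho_scale: "\<rho> x (sc a v) = sc a (\<rho> x v)"
  and rho_brk: "\<rho> (brk L x y) v = \<rho> x (\<rho> y v) - \<rho> y (\<rho> x v)"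
  using lmod unfolding lie_module_def by blast+

lemma rho_0 [simp]: "\<rho> x 0 = 0" "\<rho> 0 v = 0"
  using rho_add[of x 0 0] rho_add_left[of 0 0 v] by simp_all

lemma rho_swap: "\<rho> x (\<rho> y v) = \<rho> (brk L x y) v + \<rho> y (\<rho> x v)"
  by (simp add: rho_brk)

abbreviation weight_vectors :: "'a \<Rightarrow> 'v set" where
  "weight_vectors \<mu> \<equiv> weight_space G \<iota> sc \<rho> \<mu>"

abbreviation "wspace p \<equiv> weight_vectors (coweight p)"
abbreviation "up i \<equiv> \<rho> (raising L i)"
abbreviation "down i \<equiv> \<rho> (lowering L i)"

lemma weight_vectorsD: "v \<in> weight_vectors \<mu> \<Longrightarrow> \<phi> \<in> dual_csa G \<Longrightarrow> \<rho> (\<iota> \<phi>) v = sc (\<phi> \<mu>) v"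
  by (simp add: weight_space_def)

lemma weight_vectors_subspace: "0 \<in> weight_vectors \<mu>"
  "u \<in> weight_vectors \<mu> \<Longrightarrow> v \<in> weight_vectors \<mu> \<Longrightarrow> u + v \<in> weight_vectors \<mu>"
  "u \<in> weight_vectors \<mu> \<Longrightarrow> sc a u \<in> weight_vectors \<mu>"
  by (auto simp: weight_space_def rho_add rho_scale V.scale_right_distrib mult.commute)

lemma shifted_weight:
  assumes i: "i \<in> I" and v: "v \<in> wspace p"
    and x: "\<And>\<phi>. \<phi> \<in> dual_csa G \<Longrightarrow> brk L (\<iota> \<phi>) x = smult L (of_int a * \<phi> (scoroot G i)) x"
  shows "(\<rho> x ^^ r) v \<in> wspace (\<lambda>l. p l + int r * (a * cmat i l))"
proof (induction r)
  case (Suc r)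
  let ?p = "\<lambda>r l. p l + int r * (a * cmat i l)" and ?u = "(\<rho> x ^^ r) v"
  have "\<rho> (\<iota> \<phi>) (\<rho> x ?u) = sc (\<phi> (coweight (?p (Suc r)))) (\<rho> x ?u)" if p: "\<phi> \<in> dual_csa G" for \<phi>
  proof -
    have "?p (Suc r) = (\<lambda>l. ?p r l + a * cmat i l)" by (auto simp: algebra_simps)
    then have "\<phi> (coweight (?p (Suc r))) = of_int a * \<phi> (scoroot G i) + \<phi> (coweight (?p r))"
      using scoroot_csa[OF i]
      by (simp add: coweight_add scoroot_coweight[OF i, symmetric] dual_csaD[OF p] coweight_csa csa_closed)
    then show ?thesis
      by (simp only: rho_swap[of "\<iota> \<phi>"] x[OF p] rho_scale_left weight_vectorsD[OF Suc p] rho_scale V.scale_left_distrib)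
  qed
  then show ?case by (simp add: weight_space_def)
qed (use v in simp)

lemma up_pow_weight:
  assumes i: "i \<in> I" and v: "v \<in> wspace p"
  shows "(up i ^^ r) v \<in> wspace (\<lambda>l. p l + int r * cmat i l)"
  using shifted_weight[OF i v, of "raising L i" 1] L.brk_e[OF iota_csa] i sroot_L[OF i] by (simp add: index_L)

lemma down_pow_weight:
  assumes i: "i \<in> I" and v: "v \<in> wspace p"
  shows "(down i ^^ r) v \<in> wspace (\<lambda>l. p l - int r * cmat i l)"
  using shifted_weight[OF i v, of "lowering L i" "- 1"] L.brk_f[OF iota_csa] i sroot_L[OF i] by (simp add: index_L)

lemma up_weight: "i \<in> I \<Longrightarrow> v \<in> wspace p \<Longrightarrow>
    up i v \<in> wspace (\<lambda>l. p l + cmat i l)"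
  using up_pow_weight[of i v p 1] by simp

lemma down_weight: "i \<in> I \<Longrightarrow> v \<in> wspace p \<Longrightarrow>
    down i v \<in> wspace (\<lambda>l. p l - cmat i l)"
  using down_pow_weight[of i v p 1] by simp

lemma h_weight:
  assumes "i \<in> I" "v \<in> wspace p"
  shows "\<rho> (scoroot L i) v = sc (of_int (p i)) v"
  using weight_vectorsD[OF assms(2) sroot_dual[OF assms(1)]] assms by (simp add: scoroot_L sroot_coweight)

lemma sl2_rho:
  assumes i: "i \<in> I"
  shows "sl2_module sc (up i) (down i) (\<rho> (scoroot L i))"
proof
  note iL = i[folded index_L] and h = L.scoroot_csa[OF i[folded index_L]]
  fix v
  show "\<rho> (scoroot L i) (up i v) = up i (\<rho> (scoroot L i) v) + sc 2 (up i v)"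
    unfolding rho_swap[of "scoroot L i"] L.brk_e[OF h iL] by (simp add: rho_scale_left L.sroot_scoroot[OF iL])
  show "\<rho> (scoroot L i) (down i v) = down i (\<rho> (scoroot L i) v) - sc 2 (down i v)"
    unfolding rho_swap[of "scoroot L i"] L.brk_f[OF h iL] rho_scale_left L.sroot_scoroot[OF iL] by simp
  show "up i (down i v) = down i (up i v) + \<rho> (scoroot L i) v"
    unfolding rho_swap[of "raising L i"] L.brk_ef[OF iL iL] by simp
qed (simp_all add: mod_fd rho_add rho_scale)

lemma up_nonzero:
  assumes "i \<in> I" "v \<in> wspace p" "p i < 0" "v \<noteq> 0" shows "up i v \<noteq> 0"
proof -
  interpret sl2_module sc "up i" "down i" "\<rho> (scoroot L i)" by (rule sl2_rho[OF assms(1)])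
  show ?thesis using E_nonzero[OF h_weight[OF assms(1,2)]] assms by blast
qed

section \<open>The weights of the module form one Weyl orbit\<close>

definition is_weight :: "vec \<Rightarrow> bool" where
  "is_weight p \<longleftrightarrow> (\<exists>v\<in>wspace p. v \<noteq> 0)"

lemma is_weight_refl:
  assumes i: "i \<in> I" and p: "is_weight p" shows "is_weight (dual_refl i p)"
proof -
  obtain v where v: "v \<in> wspace p" "v \<noteq> 0" using p by (auto simp: is_weight_def)
  interpret S: sl2_module sc "up i" "down i" "\<rho> (scoroot L i)" by (rule sl2_rho[OF i])
  show ?thesis
    using h_weight[OF i v(1)] v(2)
  proof (cases rule: S.reflected_vector)
    case (1 r a)
    have "(\<lambda>l. p l + int r * cmat i l - int a * cmat i l) = dual_refl i p"
      by (auto simp: dual_refl_def 1(1) algebra_simps)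
    then show ?thesis using down_pow_weight[OF i up_pow_weight[OF i v(1)], of a r] 1(2) by (auto simp: is_weight_def)
  next
    case (2 r a)
    have "(\<lambda>l. p l - int r * cmat i l + int a * cmat i l) = dual_refl i p"
      by (auto simp: dual_refl_def 2(1) algebra_simps)
    then show ?thesis using up_pow_weight[OF i down_pow_weight[OF i v(1)], of a r] 2(2) by (auto simp: is_weight_def)
  qed
qed

definition lowered :: "vec \<Rightarrow> vec \<Rightarrow> nat \<Rightarrow> int" where
  "lowered p n = (\<lambda>l. p l - (\<Sum>k\<in>I. n k * cmat k l))"

lemma lowered_unit: "j \<in> I \<Longrightarrow> lowered p (\<lambda>k. n k + a * unit j k) = (\<lambda>l. lowered p n l - a * cmat j l)"
  unfolding lowered_def using combination_unit[of j n a] by (auto simp: algebra_simps)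

text \<open>\<open>n\<close> counts how often each lowering operator has been applied to
  \<open>y\<close>, which is what determines the weight.\<close>

inductive lowering_word :: "'v \<Rightarrow> vec \<Rightarrow> 'v \<Rightarrow> bool" for y where
  "lowering_word y (\<lambda>_. 0) y"
| "lowering_word y n u \<Longrightarrow> j \<in> I \<Longrightarrow> lowering_word y (\<lambda>k. n k + 1 * unit j k) (down j u)"

lemma lowering_word_weight:
  assumes y: "y \<in> wspace p" and "lowering_word y n u"
  shows "nonneg n \<and> u \<in> wspace (lowered p n)"
  using assms(2)
proof induction
  case 1
  then show ?case using y by (simp add: lowered_def nonneg_def)
next
  case (2 n u j)
  then show ?case using down_weight[of j u "lowered p n"] lowered_unit[of j p n 1]
    by (auto simp: nonneg_def unit_def)
qed

text \<open>The span is stable under the lowering operators by construction and under the raising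
  operators by commuting them to the right. The elements of \<open>L\<close> that preserve it form a
  subalgebra, so it is a nonzero submodule of an irreducible module.\<close>

lemma highest_vector_generates:
  assumes y: "y \<in> wspace p" "y \<noteq> 0" and hw: "\<And>j. j \<in> I \<Longrightarrow> up j y = 0"
  shows "V.span {u. \<exists>n. lowering_word y n u} = UNIV"
proof -
  let ?X = "{u. \<exists>n. lowering_word y n u}"
  let ?U = "V.span ?X"
  have closed: "\<rho> x u \<in> ?U" if "\<And>u. u \<in> ?X \<Longrightarrow> \<rho> x u \<in> ?U" "u \<in> ?U" for x u
    using that(2)
    by (induction rule: V.span_induct_alt) (auto simp: rho_add rho_scale intro: V.span_add V.span_scale that(1) V.span_zero)
  have fU: "down j u \<in> ?U" if "j \<in> I" "u \<in> ?U" for j u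
  proof (rule closed[OF _ that(2)])
    fix u assume "u \<in> ?X"
    then have "down j u \<in> ?X" using lowering_word.intros(2)[OF _ that(1)] by blast
    then show "down j u \<in> ?U" by (rule V.span_base)
  qed
  have eX: "up j u \<in> ?U" if "lowering_word y n u" "j \<in> I" for j n u
    using that(1)
  proof induction
    case 1
    then show ?case using hw that(2) by (simp add: V.span_zero)
  next
    case (2 n u i)
    have iL: "i \<in> index_set L" "j \<in> index_set L" using 2 that(2) by (auto simp: index_L)
    have u: "u \<in> wspace (lowered p n)" using lowering_word_weight[OF y(1) 2(1)] by blast
    have "u \<in> ?U" using 2(1) by (intro V.span_base) blast
    then have "\<rho> (if j = i then scoroot L j else 0) u \<in> ?U"
      using h_weight[OF that(2) u] by (auto intro: V.span_scale V.span_zero)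
    \<comment> \<open>The commutator of a raising and a lowering operator is zero or a coroot, which
      acts on the weight vector \<open>u\<close> by a scalar.\<close>
    then show ?case unfolding rho_swap[of "raising L j"] L.brk_ef[OF iL(2,1)]
      using fU[OF 2(2) 2(3)] V.span_add by blast
  qed
  have eU: "up j u \<in> ?U" if "j \<in> I" "u \<in> ?U" for j u
    using closed[of "raising L j"] eX that by blast
  have "lie_subalgebra L {x. \<forall>u\<in>?U. \<rho> x u \<in> ?U}"
    unfolding lie_subalgebra_def L.subspace_def
    by (auto simp: rho_add_left rho_scale_left rho_brk intro: V.span_add V.span_scale V.span_zero V.span_diff)
  then have "{x. \<forall>u\<in>?U. \<rho> x u \<in> ?U} = UNIV"
    by (rule L.generated) (use eU fU in \<open>auto simp: index_L\<close>)
  then have "?U = {0} \<or> ?U = UNIV" using irreducible V.subspace_span unfolding irreducible_module_def by blast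
  moreover have "y \<in> ?U" by (rule V.span_base) (use lowering_word.intros(1) in blast)
  ultimately show ?thesis using y(2) by blast
qed

text \<open>Every vector is a sum of weight vectors of lowered weights. If \<open>\<nu>\<close> were
  none of these, \<open>z\<close> and the summands would be dependent eigenvectors of distinct
  weights. As \<open>y\<close> may be any weight vector killed by the raising operators, two highest
  weights are always below each other.\<close>

lemma weights_below_highest:
  assumes y: "y \<in> wspace p" "y \<noteq> 0" and hw: "\<And>j. j \<in> I \<Longrightarrow> up j y = 0"
    and z: "z \<in> weight_vectors \<nu>" "z \<noteq> 0" "\<nu> \<in> csa G"
  shows "\<exists>n. nonneg n \<and> \<nu> = coweight (lowered p n)"
proof -
  let ?\<Lambda> = "{coweight (lowered p n) |n. nonneg n}"
  let ?P = "\<lambda>u. \<exists>T g. finite T \<and> T \<subseteq> ?\<Lambda> \<and> (\<forall>\<mu>. g \<mu> \<in> weight_vectors \<mu>) \<and> (\<forall>\<mu>. \<mu> \<notin> T \<longrightarrow> g \<mu> = 0) \<and> u = sum g T"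
  have P: "?P u" if "u \<in> V.span {u. \<exists>n. lowering_word y n u}" for u
    using that
  proof (induction rule: V.span_induct_alt)
    case base
    show ?case by (intro exI[of _ "{}"] exI[of _ "\<lambda>_. 0"]) (simp add: weight_vectors_subspace)
  next
    case (step a u u')
    obtain n where n: "lowering_word y n u" using step by blast
    define \<mu> where "\<mu> = coweight (lowered p n)"
    have u: "nonneg n" "u \<in> weight_vectors \<mu>" using lowering_word_weight[OF y(1) n] by (auto simp: \<mu>_def)
    obtain T g where Tg: "finite T" "T \<subseteq> ?\<Lambda>" "\<And>\<mu>. g \<mu> \<in> weight_vectors \<mu>" "\<And>\<mu>. \<mu> \<notin> T \<Longrightarrow> g \<mu> = 0" "u' = sum g T"
      using step by blast
    define g' where "g' = (\<lambda>x. if x = \<mu> then sc a u + g x else g x)"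
    have "sum g' (insert \<mu> T) = sc a u + g \<mu> + sum g (T - {\<mu>})"
      using Tg(1) unfolding g'_def by (subst sum.insert_remove) (auto intro!: sum.cong)
    also have "g \<mu> + sum g (T - {\<mu>}) = sum g T"
      using Tg(1,4) by (metis sum.remove Diff_empty Diff_insert0 add.left_neutral)
    then have "sc a u + g \<mu> + sum g (T - {\<mu>}) = sc a u + u'" using Tg(5) by (simp add: add.assoc)
    finally have "sc a u + u' = sum g' (insert \<mu> T)" ..
    moreover have "g' x \<in> weight_vectors x" for x
      using Tg(3) u(2) by (auto simp: g'_def weight_vectors_subspace)
    moreover have "x \<notin> insert \<mu> T \<longrightarrow> g' x = 0" for x using Tg(4) by (simp add: g'_def)
    moreover have "insert \<mu> T \<subseteq> ?\<Lambda>" using Tg(2) u(1) by (auto simp: \<mu>_def)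
    ultimately show ?case using Tg(1) by blast
  qed
  have "?P z" by (rule P) (simp only: highest_vector_generates[OF y hw] UNIV_I)
  then obtain T g where Tg: "finite T" "T \<subseteq> ?\<Lambda>" "\<And>\<mu>. g \<mu> \<in> weight_vectors \<mu>" "z = sum g T"
    by (elim exE conjE) blast
  show ?thesis
  proof (rule ccontr)
    assume "\<not> ?thesis"
    then have \<nu>: "\<nu> \<notin> T" using Tg(2) by blast
    let ?Y = "{\<mu>\<in>T. g \<mu> \<noteq> 0}"
    \<comment> \<open>The family of summands enlarged by \<open>z\<close> at the new index
      \<open>\<nu>\<close>; with coefficient -1 there, the sum is zero.\<close>
    let ?v = "\<lambda>\<mu>. if \<mu> = \<nu> then z else g \<mu>"
    have csaT: "\<mu> \<in> csa G" if "\<mu> \<in> insert \<nu> ?Y" for \<mu> using that z(3) Tg(2) coweight_csa by blast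
    have "sum g ?Y = z" unfolding Tg(4) using Tg(1) by (intro sum.mono_neutral_left) auto
    moreover have "(\<Sum>\<mu>\<in>?Y. sc (if \<mu> = \<nu> then - 1 else 1) (?v \<mu>)) = sum g ?Y"
      using \<nu> by (intro sum.cong refl) auto
    ultimately have s0: "(\<Sum>\<mu>\<in>insert \<nu> ?Y. sc (if \<mu> = \<nu> then - 1 else 1) (?v \<mu>)) = 0"
      using \<nu> Tg(1) by (subst sum.insert) auto
    have "(if \<nu> = \<nu> then - 1 else 1 :: complex) = 0"
    proof (rule joint_eigenvectors_independent[where T="\<lambda>\<phi>. \<rho> (\<iota> \<phi>)" and K="dual_csa G" and \<chi>="\<lambda>\<mu> \<phi>. \<phi> \<mu>"
          and v="?v" and X="insert \<nu> ?Y", OF V.vector_space_axioms _ rho_add rho_scale _ _ _ s0])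
      show "finite (insert \<nu> ?Y)" using Tg(1) by simp
      show "\<rho> (\<iota> \<phi>) (?v \<mu>) = sc (\<phi> \<mu>) (?v \<mu>)" if "\<phi> \<in> dual_csa G" for \<mu> \<phi>
        using weight_vectorsD[OF z(1) that] weight_vectorsD[OF Tg(3) that] by auto
      show "?v \<mu> \<noteq> 0" if "\<mu> \<in> insert \<nu> ?Y" for \<mu> using that z(2) by auto
      show "\<exists>\<phi>\<in>dual_csa G. \<phi> \<mu> \<noteq> \<phi> \<mu>'" if "\<mu> \<in> insert \<nu> ?Y" "\<mu>' \<in> insert \<nu> ?Y" "\<mu> \<noteq> \<mu>'" for \<mu> \<mu>'
        using csa_eqI[OF csaT[OF that(1)] csaT[OF that(2)]] that(3) sroot_dual by blast
    qed simp
    then show False by simp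
  qed
qed

definition orbit :: "vec set" where
  "orbit = {dual_act w (unit s) |w. w \<in> lists I}"

sublocale minuscule_weights I cmat orbit
proof
  fix g i assume g: "g \<in> orbit" and i: "i \<in> I"
  then obtain w where w: "w \<in> lists I" "g = dual_act w (unit s)" by (auto simp: orbit_def)
  then have "dual_refl i g = dual_act (i # w) (unit s)" "i # w \<in> lists I" using i by auto
  then show "dual_refl i g \<in> orbit" unfolding orbit_def by blast
  have "g i = pairing (unit s) (act (rev w) (unit i))" using w dual_act_nth i by simp
  also have "\<dots> = act (rev w) (unit i) s" by (rule pairing_unit(2)[OF s])
  also have "\<dots> \<in> {- 1, 0, 1}" by (rule root_bound) (use w i in \<open>auto simp: in_lists_conv_set\<close>)
  finally show "g i \<in> {- 1, 0, 1}" .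
qed

lemma unit_in_orbit: "unit s \<in> orbit"
  unfolding orbit_def by (intro CollectI exI[of _ "[]"]) simp

lemma orbit_outside: "g \<in> orbit \<Longrightarrow> k \<notin> I \<Longrightarrow> g k = 0"
proof -
  assume "g \<in> orbit" "k \<notin> I"
  then have "g k = unit s k" unfolding orbit_def using dual_act_outside by blast
  then show ?thesis using s \<open>k \<notin> I\<close> by (auto simp: unit_def)
qed

lemma coweight_inj_orbit: "g \<in> orbit \<Longrightarrow> h \<in> orbit \<Longrightarrow> coweight g = coweight h \<Longrightarrow> g = h"
  by (rule ext) (metis coweight_inject orbit_outside)

lemma highest_vector: "\<exists>v\<in>wspace (unit s). v \<noteq> 0 \<and> (\<forall>j\<in>I. up j v = 0)"
  using module by (simp add: highest_weight_module_def coweight_unit[OF s] index_L)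

lemma orbit_is_weight: "g \<in> orbit \<Longrightarrow> is_weight g"
proof -
  have "is_weight (dual_act w (unit s))" if "w \<in> lists I" for w
    using that highest_vector by (induction w) (auto simp: is_weight_refl is_weight_def[of "unit s"])
  then show "g \<in> orbit \<Longrightarrow> is_weight g" by (auto simp: orbit_def)
qed

lemma weight_lowered:
  assumes "z \<in> weight_vectors \<nu>" "z \<noteq> 0" "\<nu> \<in> csa G"
  shows "\<exists>n. nonneg n \<and> \<nu> = coweight (lowered (unit s) n)"
  using highest_vector weights_below_highest assms by blast

lemma lowered_coefficients:
  assumes "coweight (lowered p n) = coweight (lowered p n')" "k \<in> I" shows "n k = n' k"
proof -
  have "(\<Sum>k\<in>I. (n k - n' k) * cmat k l) = 0" if "l \<in> I" for l
    using coweight_inject[OF assms(1) that] by (simp add: lowered_def left_diff_distrib sum_subtractf)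
  then have "n k - n' k = 0" using coroots_independent[of "\<lambda>k. n k - n' k"] assms(2) by blast
  then show ?thesis by simp
qed

lemma highest_weight_unique:
  assumes y: "y \<in> wspace (lowered (unit s) n)" "y \<noteq> 0" "nonneg n"
    and hw: "\<And>j. j \<in> I \<Longrightarrow> up j y = 0"
  shows "lowered (unit s) n = unit s"
proof -
  obtain v where v: "v \<in> wspace (unit s)" "v \<noteq> 0" using highest_vector by blast
  obtain n' where n': "nonneg n'" "coweight (unit s) = coweight (lowered (lowered (unit s) n) n')"
    using weights_below_highest[OF y(1,2) hw v coweight_csa] by blast
  have "lowered (lowered (unit s) n) n' = lowered (unit s) (\<lambda>k. n k + n' k)"
    by (auto simp: lowered_def distrib_right sum.distrib)
  moreover have "lowered (unit s) (\<lambda>_. 0) = unit s" by (simp add: lowered_def)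
  ultimately have "0 = n k + n' k" if "k \<in> I" for k
    using lowered_coefficients[of "unit s" "\<lambda>_. 0" "\<lambda>k. n k + n' k" k] n'(2) that by simp
  then have "n k = 0" if "k \<in> I" for k
    using that y(3) n'(1) unfolding nonneg_def by (metis add_nonneg_eq_0_iff)
  then show ?thesis by (simp add: lowered_def)
qed

text \<open>Induction on the height of the difference from the highest weight. A negative coordinate
  allows a reflection upwards. Otherwise the weight vector is either highest, hence of weight
  \<open>unit s\<close>, or it can be raised into the orbit, where the bound on the coordinates
  yields a contradiction.\<close>

lemma weight_in_orbit:
  "nonneg n \<Longrightarrow> is_weight (lowered (unit s) n) \<Longrightarrow> lowered (unit s) n \<in> orbit"
proof (induction "nat (\<Sum>k\<in>I. n k)" arbitrary: n rule: less_induct)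
  case less
  let ?p = "lowered (unit s) n"
  obtain z where z: "z \<in> wspace ?p" "z \<noteq> 0" using less.prems by (auto simp: is_weight_def)
  have smaller: "(\<lambda>l. ?p l - a * cmat j l) \<in> orbit"
    if j: "j \<in> I" and a: "a < 0" and w: "is_weight (\<lambda>l. ?p l - a * cmat j l)" for j a
  proof -
    \<comment> \<open>The sign of these coefficients is not known in advance. It follows from
      comparison with the nonnegative coefficients \<open>n'\<close> that the weight has anyway,
      which agree with \<open>?n\<close> on \<open>I\<close>.\<close>
    let ?n = "\<lambda>k. n k + a * unit j k"
    have eq: "lowered (unit s) ?n = (\<lambda>l. ?p l - a * cmat j l)" by (rule lowered_unit[OF j])
    obtain z where "z \<in> wspace (\<lambda>l. ?p l - a * cmat j l)" "z \<noteq> 0" using w by (auto simp: is_weight_def)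
    then obtain n' where n': "nonneg n'" "coweight (\<lambda>l. ?p l - a * cmat j l) = coweight (lowered (unit s) n')"
      using weight_lowered coweight_csa by blast
    have k: "?n k = n' k" if "k \<in> I" for k
      using lowered_coefficients[of "unit s" ?n n' k] n'(2) eq that by simp
    have "lowered (unit s) n' = lowered (unit s) ?n"
      unfolding lowered_def using k by (intro ext arg_cong2[of _ _ _ _ "(-)"] refl sum.cong) simp
    then have eq': "lowered (unit s) n' = (\<lambda>l. ?p l - a * cmat j l)" using eq by simp
    have "(\<Sum>k\<in>I. n' k) = (\<Sum>k\<in>I. ?n k)" using k by simp
    also have "\<dots> = (\<Sum>k\<in>I. n k) + a" using j by (simp add: sum.distrib sum_unit)
    finally have "(\<Sum>k\<in>I. n' k) = (\<Sum>k\<in>I. n k) + a" .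
    moreover have "0 \<le> (\<Sum>k\<in>I. n' k)" using n'(1) by (simp add: nonneg_def sum_nonneg)
    ultimately have "nat (\<Sum>k\<in>I. n' k) < nat (\<Sum>k\<in>I. n k)" using a by linarith
    then have "lowered (unit s) n' \<in> orbit" by (rule less.hyps[OF _ n'(1)]) (use w eq' in simp)
    then show ?thesis using eq' by simp
  qed
  show ?case
  proof (cases "\<exists>j\<in>I. ?p j < 0")
    case True
    then obtain j where j: "j \<in> I" "?p j < 0" by blast
    have "is_weight (dual_refl j ?p)" using is_weight_refl[OF j(1) less.prems(2)] .
    then have "dual_refl j ?p \<in> orbit" using smaller[OF j] by (simp add: dual_refl_def)
    then have "dual_refl j (dual_refl j ?p) \<in> orbit" using closed j by blast
    then show ?thesis using j by simp
  next
    case False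
    show ?thesis
    proof (cases "\<forall>j\<in>I. up j z = 0")
      case True
      then show ?thesis using highest_weight_unique[OF z less.prems(1)] unit_in_orbit by simp
    next
      case False
      then obtain j where j: "j \<in> I" "up j z \<noteq> 0" by blast
      have "is_weight (\<lambda>l. ?p l + cmat j l)" using up_weight[OF j(1) z(1)] j(2) by (auto simp: is_weight_def)
      then have "(\<lambda>l. ?p l + cmat j l) \<in> orbit" using smaller[OF j(1), of "- 1"] by simp
      \<comment> \<open>The raised weight has coordinate at least 2 when \<open>?p j\<close> is
        nonnegative, which no weight in the orbit has.\<close>
      then have "?p j + cmat j j \<in> {- 1, 0, 1}" using bound j by blast
      then have "?p j < 0" using diag[OF j(1)] by auto
      then show ?thesis using \<open>\<not> (\<exists>j\<in>I. ?p j < 0)\<close> j by blast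
    qed
  qed
qed

lemma module_weights_eq: "module_weights G \<iota> sc \<rho> = coweight ` orbit"
proof
  show "module_weights G \<iota> sc \<rho> \<subseteq> coweight ` orbit"
  proof
    fix \<mu> assume "\<mu> \<in> module_weights G \<iota> sc \<rho>"
    then obtain v where v: "\<mu> \<in> csa G" "v \<in> weight_vectors \<mu>" "v \<noteq> 0" by (auto simp: module_weights_def)
    then obtain n where "nonneg n" "\<mu> = coweight (lowered (unit s) n)" using weight_lowered by blast
    then show "\<mu> \<in> coweight ` orbit" using weight_in_orbit v by (auto simp: is_weight_def)
  qed
  show "coweight ` orbit \<subseteq> module_weights G \<iota> sc \<rho>"
    using orbit_is_weight coweight_csa by (auto simp: module_weights_def is_weight_def)
qed

end


section \<open>Moves and trails\<close>

lemma take_drop_letters: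
  assumes "1 \<le> k" "k + n \<le> Suc (length w)"
  shows "w = take (k - 1) w @ map (letter w) [k..<k + n] @ drop (k - 1 + n) w"
proof -
  have "map (letter w) [k..<k + n] = take n (drop (k - 1) w)"
    using assms by (intro nth_equalityI) (auto simp: letter_def)
  then show ?thesis by (metis append_take_drop_id drop_drop add.commute)
qed

lemma local_move:
  assumes len: "length jw = length iw" and k: "1 \<le> k" "k + n \<le> Suc (length iw)"
    and eq: "\<And>l. l \<in> {1..length iw} - {k..<k + n} \<Longrightarrow> letter jw l = letter iw l"
  obtains u v where "length u = k - 1" "iw = u @ map (letter iw) [k..<k + n] @ v" "jw = u @ map (letter jw) [k..<k + n] @ v"
proof -
  have "jw ! l = iw ! l" if "l < length iw" "l < k - 1 \<or> k - 1 + n \<le> l" for l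
  proof -
    have "Suc l \<in> {1..length iw} - {k..<k + n}" using that k by auto
    then show ?thesis using eq by (fastforce simp: letter_def)
  qed
  then have "take (k - 1) jw = take (k - 1) iw" "drop (k - 1 + n) jw = drop (k - 1 + n) iw"
    using len by (auto intro: nth_equalityI)
  then show ?thesis
    using that[of "take (k - 1) iw" "drop (k - 1 + n) iw"] take_drop_letters[of k n iw] take_drop_letters[of k n jw] k len
    by simp
qed

lemma two_term_moveE:
  assumes m: "two_term_move G k iw jw"
  obtains u a b v where "iw = u @ [a, b] @ v" "jw = u @ [b, a] @ v" "k = Suc (length u)" "cartan_entry G a b = 0"
proof -
  have "{k..<k + 2} = {k, k + 1}" by auto
  then obtain u v where "length u = k - 1" "iw = u @ map (letter iw) [k..<k + 2] @ v" "jw = u @ map (letter jw) [k..<k + 2] @ v"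
    using m local_move[of jw iw k 2] by (auto simp: two_term_move_def)
  moreover have "[k..<k + 2] = [k, k + 1]" by (simp add: upt_conv_Cons)
  ultimately show ?thesis using m by (intro that[of u "letter iw k" "letter iw (k + 1)" v]) (auto simp: two_term_move_def)
qed

text \<open>The position \<open>k\<close> is that of the middle letter, so the common prefix has
  \<open>k - 2\<close> letters.\<close>

lemma three_term_moveE:
  assumes m: "three_term_move G k iw jw"
  obtains u a b v where "iw = u @ [a, b, a] @ v" "jw = u @ [b, a, b] @ v" "k = Suc (Suc (length u))" "cartan_entry G b a = - 1"
proof -
  have k: "2 \<le> k" "1 \<le> k - 1" "k - 1 + 3 \<le> Suc (length iw)" "length jw = length iw"
    using m by (auto simp: three_term_move_def)
  have "letter jw l = letter iw l" if "l \<in> {1..length iw} - {k - 1..<k - 1 + 3}" for l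
    using m that by (auto simp: three_term_move_def)
  then obtain u v where "length u = k - 1 - 1" "iw = u @ map (letter iw) [k - 1..<k - 1 + 3] @ v"
      "jw = u @ map (letter jw) [k - 1..<k - 1 + 3] @ v"
    by (rule local_move[OF k(4,2,3)])
  moreover have "[k - 1..<k - 1 + 3] = [k - 1, k, k + 1]" using k by (simp add: upt_conv_Cons)
  moreover have "letter iw (k - 1) = letter iw (k + 1)" "letter jw k = letter iw (k + 1)" "letter jw (k - 1) = letter iw k"
    "letter jw (k + 1) = letter iw k" "cartan_entry G (letter iw k) (letter iw (k + 1)) = - 1"
    using m unfolding three_term_move_def by metis+
  ultimately show ?thesis using k by (intro that[of u "letter iw (k + 1)" "letter iw k" v]) auto
qed

lemma two_term_moveI:
  "cartan_entry G a b = 0 \<Longrightarrow> two_term_move G (Suc (length u)) (u @ [a, b] @ v) (u @ [b, a] @ v)"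
  by (auto simp: two_term_move_def letter_def nth_append nth_Cons split: nat.splits)

lemma three_term_moveI:
  "cartan_entry G b a = - 1 \<Longrightarrow> three_term_move G (Suc (Suc (length u))) (u @ [a, b, a] @ v) (u @ [b, a, b] @ v)"
  by (auto simp: three_term_move_def letter_def nth_append nth_Cons split: nat.splits)

lemma transition_start_torus: "transition G iw x jw y \<Longrightarrow> x \<in> torus (length iw)"
  by (induction rule: transition.induct)

lemma two_term_map_involution: "two_term_map k (two_term_map k x) = x"
  by (auto simp: two_term_map_def)

text \<open>With \<open>p\<close>, \<open>q\<close>, \<open>r\<close> the three coordinates,
  \<open>p + q / r\<close> is \<open>(q + p * r) / r\<close>, so the new denominator of the inverse
  map simplifies. The bound on \<open>k\<close> keeps \<open>k - 1\<close> distinct from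
  \<open>k\<close> under truncated subtraction.\<close>

lemma three_term_map_involution:
  assumes "positive x" "2 \<le> k" shows "three_term_map k (three_term_map k x) = x"
proof -
  have k: "k - 1 \<noteq> k" "k + 1 \<noteq> k - 1" using assms by auto
  define p q r where "p = x (k - 1)" and "q = x k" and "r = x (k + 1)"
  obtain p' q' r' where R: "p' > 0" "p = complex_of_real p'" "q' > 0" "q = complex_of_real q'" "r' > 0" "r = complex_of_real r'"
    using assms(1) unfolding positive_def p_def q_def r_def by metis
  have "q' + p' * r' > 0" using R by (simp add: add_pos_pos)
  then have "q + p * r \<noteq> 0" using R by (metis of_real_add of_real_mult of_real_eq_0_iff less_irrefl)
  then have nz: "p \<noteq> 0" "q \<noteq> 0" "r \<noteq> 0" "q + p * r \<noteq> 0" using R by auto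
  let ?y = "three_term_map k x"
  have y: "?y (k - 1) = q * r / (q + p * r)" "?y k = p * r" "?y (k + 1) = p + q / r"
    using k by (auto simp: three_term_map_def p_def q_def r_def)
  have "p + q / r = (q + p * r) / r" using nz by (simp add: field_simps)
  then have s: "q * r / (q + p * r) * (p + q / r) = q" using nz by simp
  have c: "p * r * (p + q / r) / (p * r + q) = p" "q * r / (q + p * r) + p * r / (p + q / r) = r"
  proof -
    have "p + q / r = (q + p * r) / r" using nz by (simp add: field_simps)
    then show "p * r * (p + q / r) / (p * r + q) = p" using nz by (simp add: add.commute)
    have "p * r / (p + q / r) = p * r * r / (q + p * r)" using \<open>p + q / r = (q + p * r) / r\<close> nz by simp
    then have "q * r / (q + p * r) + p * r / (p + q / r) = (q + p * r) * r / (q + p * r)"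
      by (simp add: add_divide_distrib[symmetric] distrib_right)
    then show "q * r / (q + p * r) + p * r / (p + q / r) = r" using nz by simp
  qed
  have e: "three_term_map k ?y = ?y(k - 1 := ?y k * ?y (k + 1) / (?y k + ?y (k - 1) * ?y (k + 1)),
      k := ?y (k - 1) * ?y (k + 1), k + 1 := ?y (k - 1) + ?y k / ?y (k + 1))"
    by (rule three_term_map_def)
  have "three_term_map k ?y = ?y(k - 1 := p, k := q, k + 1 := r)"
    unfolding e unfolding y s c ..
  also have "\<dots> = x" using k unfolding p_def q_def r_def by (auto simp: three_term_map_def fun_eq_iff)
  finally show ?thesis .
qed

lemma positive_two_term_map: "positive x \<Longrightarrow> positive (two_term_map k x)"
  by (auto simp: positive_def two_term_map_def)

lemma positive_three_term_map:
  assumes "positive x" shows "positive (three_term_map k x)" "x k + x (k - 1) * x (k + 1) \<noteq> 0"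
proof -
  obtain r where r: "\<And>l. r l > 0" "\<And>l. x l = complex_of_real (r l)" using assms unfolding positive_def by metis
  define r' where "r' = r(k - 1 := r k * r (k + 1) / (r k + r (k - 1) * r (k + 1)),
     k := r (k - 1) * r (k + 1), k + 1 := r (k - 1) + r k / r (k + 1))"
  have "r' l > 0" for l using r(1) by (auto simp: r'_def intro!: divide_pos_pos add_pos_pos mult_pos_pos)
  moreover have "three_term_map k x l = complex_of_real (r' l)" for l
    by (auto simp: three_term_map_def r'_def r(2))
  ultimately show "positive (three_term_map k x)" unfolding positive_def by blast
  have "r k + r (k - 1) * r (k + 1) > 0" using r(1) by (simp add: add_pos_pos)
  then show "x k + x (k - 1) * x (k + 1) \<noteq> 0" unfolding r(2) by (metis of_real_add of_real_mult of_real_eq_0_iff less_irrefl)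
qed

context minuscule_weights
begin

text \<open>The sum over a concatenated word is a composite of operators on functions of weights. An
  identity for the middle block that holds for every end function survives any prefix and suffix
  with unchanged parameters.\<close>

lemma trail_sum_replace:
  assumes g: "g \<in> M" and sub: "set u \<subseteq> I" and len: "length w' = length w"
    and out: "\<And>l. l < Suc (length u) \<or> Suc (length u + length w) \<le> l \<Longrightarrow> m' l = m l"
    and eq: "\<And>f g. g \<in> M \<Longrightarrow> trail_sum m' (Suc (length u)) w' f g = trail_sum m (Suc (length u)) w f g"
  shows "trail_sum m' 1 (u @ w' @ v) f g = trail_sum m 1 (u @ w @ v) f g"
proof -
  let ?k = "Suc (length u)"
  have v: "trail_sum m' (?k + length w) v f = trail_sum m (?k + length w) v f"
    by (rule ext, rule trail_sum_cong_pos) (use out in simp)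
  have wv: "trail_sum m' ?k (w' @ v) f = trail_sum m' ?k w' (trail_sum m (?k + length w) v f)"
    unfolding v[symmetric] by (rule ext) (simp only: trail_sum_append len)
  have "trail_sum m' 1 (u @ w' @ v) f g = trail_sum m' 1 u (\<lambda>h. trail_sum m' ?k w' (trail_sum m (?k + length w) v f) h) g"
    using trail_sum_append[of m' 1 u "w' @ v" f g] by (simp add: wv)
  also have "\<dots> = trail_sum m' 1 u (\<lambda>h. trail_sum m ?k w (trail_sum m (?k + length w) v f) h) g"
    by (rule trail_sum_cong[OF sub g]) (rule eq)
  also have "\<dots> = trail_sum m 1 u (\<lambda>h. trail_sum m ?k w (trail_sum m (?k + length w) v f) h) g"
    by (rule trail_sum_cong_pos) (use out in simp)
  also have "\<dots> = trail_sum m 1 (u @ w @ v) f g"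
  proof -
    have "trail_sum m ?k (w @ v) f = trail_sum m ?k w (trail_sum m (?k + length w) v f)"
      by (rule ext) (simp only: trail_sum_append)
    then show ?thesis using trail_sum_append[of m 1 u "w @ v" f g] by simp
  qed
  finally show ?thesis .
qed

end

context minuscule_module
begin

lemma cartan_entry_cmat: "a \<in> I \<Longrightarrow> b \<in> I \<Longrightarrow> cartan_entry G a b = of_int (cmat a b)"
  by (simp add: cartan_entry_def sroot_scoroot_cmat)

lemma transition_trail_sum:
  assumes "transition G iw x jw y" "iw \<in> lists I" "g \<in> orbit"
  shows "jw \<in> lists I \<and> length jw = length iw \<and> y \<in> torus (length iw) \<and>
    trail_sum (powers y) 1 jw f g = trail_sum (powers x) 1 iw f g"
  using assms(1)
proof induction
  case start
  then show ?case using assms by simp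
next
  case (two_term jw y k kw)
  then obtain u a b v where uv: "jw = u @ [a, b] @ v" "kw = u @ [b, a] @ v" "k = Suc (length u)" "cartan_entry G a b = 0"
    using two_term_moveE by blast
  have ab: "a \<in> I" "b \<in> I" "set u \<subseteq> I" "set v \<subseteq> I" using two_term.IH uv by auto
  let ?y = "two_term_map k y"
  have "trail_sum (powers ?y) 1 (u @ [b, a] @ v) f g = trail_sum (powers y) 1 (u @ [a, b] @ v) f g"
  proof (rule trail_sum_replace[OF assms(3) ab(3)])
    show "trail_sum (powers ?y) (Suc (length u)) [b, a] f g = trail_sum (powers y) (Suc (length u)) [a, b] f g"
      if "g \<in> orbit" for f g
      using ab uv cartan_entry_cmat[of a b] that
      by (intro trail_sum_commute) (auto simp: two_term_map_def)
  qed (auto simp: two_term_map_def uv)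
  moreover have "?y \<in> torus (length iw)"
    using two_term.IH uv by (auto simp: torus_def two_term_map_def)
  ultimately show ?case using two_term.IH uv by auto
next
  case (three_term jw y k kw)
  then obtain u a b v where uv: "jw = u @ [a, b, a] @ v" "kw = u @ [b, a, b] @ v" "k = Suc (Suc (length u))" "cartan_entry G b a = - 1"
    using three_term_moveE by blast
  have ab: "a \<in> I" "b \<in> I" "set u \<subseteq> I" "set v \<subseteq> I" using three_term.IH uv by auto
  let ?y = "three_term_map k y" and ?l = "Suc (length u)"
  have len: "length iw = length u + length v + 3" using three_term.IH uv by auto
  have nz: "y ?l \<noteq> 0" "y (Suc ?l) \<noteq> 0" "y (Suc (Suc ?l)) \<noteq> 0"
    using three_term.IH len by (auto simp: torus_def)
  have nz': "y (Suc ?l) + y ?l * y (Suc (Suc ?l)) \<noteq> 0" using three_term.hyps(3) uv(3) by simp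
  have y: "?y ?l = y (Suc ?l) * y (Suc (Suc ?l)) / (y (Suc ?l) + y ?l * y (Suc (Suc ?l)))"
    "?y (Suc ?l) = y ?l * y (Suc (Suc ?l))" "?y (Suc (Suc ?l)) = y ?l + y (Suc ?l) / y (Suc (Suc ?l))"
    by (auto simp: three_term_map_def uv(3))
  have c: "cmat a b = - 1" using cartan_entry_cmat[OF ab(2,1)] uv(4) local.sym[of a b]
    by (metis of_int_eq_iff of_int_minus of_int_1)
  have "trail_sum (powers ?y) 1 (u @ [b, a, b] @ v) f g = trail_sum (powers y) 1 (u @ [a, b, a] @ v) f g"
  proof (rule trail_sum_replace[OF assms(3) ab(3)])
    show "trail_sum (powers ?y) ?l [b, a, b] f g = trail_sum (powers y) ?l [a, b, a] f g"
      if "g \<in> orbit" for f g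
      by (rule trail_sum_braid[where x=y and y="?y" and k="?l", OF ab(1,2) c that nz nz' y])
  qed (auto simp: three_term_map_def uv(3))
  moreover have "?y \<in> torus (length iw)"
  proof -
    have "y ?l + y (Suc ?l) / y (Suc (Suc ?l)) \<noteq> 0" using nz nz' by (auto simp: field_simps)
    then show ?thesis using three_term.IH nz nz'
      by (auto simp: torus_def three_term_map_def uv(3))
  qed
  ultimately show ?case using three_term.IH uv by auto
qed

text \<open>Transitions are built from the starting word, whereas here the target point is
  prescribed. Applying the last move to \<open>y\<close> gives the target for the preceding word,
  and the move leads back to \<open>y\<close> because it is an involution.\<close>

lemma positive_transition:
  assumes "braid_equiv iw jw" "iw \<in> lists I" "positive y"
  shows "jw \<in> lists I \<and> (\<exists>x. positive x \<and> transition G iw x jw y)"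
  using assms(1,3)
proof (induction arbitrary: y rule: rtranclp_induct)
  case base
  then show ?case using assms(2) transition.start positive_torus by blast
next
  case (step jw kw)
  show ?case using step.hyps(2)
  proof cases
    case (commute a b u v)
    let ?k = "Suc (length u)"
    have p: "positive (two_term_map ?k y)" using step.prems by (rule positive_two_term_map)
    have jw: "jw \<in> lists I" using step.IH[OF p] by blast
    then have ab: "a \<in> I" "b \<in> I" using commute by auto
    obtain x where x: "positive x" "transition G iw x jw (two_term_map ?k y)" using step.IH[OF p] by blast
    have "two_term_move G ?k jw kw" unfolding commute by (rule two_term_moveI) (use commute ab cartan_entry_cmat in simp)
    then have "transition G iw x kw (two_term_map ?k (two_term_map ?k y))" using x(2) transition.two_term by blast
    then show ?thesis using x(1) jw commute by (auto simp: two_term_map_involution)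
  next
    case (braid a b u v)
    let ?k = "Suc (Suc (length u))"
    have p: "positive (three_term_map ?k y)" using step.prems by (rule positive_three_term_map)
    have jw: "jw \<in> lists I" using step.IH[OF p] by blast
    then have ab: "a \<in> I" "b \<in> I" using braid by auto
    obtain x where x: "positive x" "transition G iw x jw (three_term_map ?k y)" using step.IH[OF p] by blast
    have "three_term_move G ?k jw kw" unfolding braid
      by (rule three_term_moveI) (use braid(3) ab cartan_entry_cmat[of b a] local.sym[of a b] in simp)
    then have "transition G iw x kw (three_term_map ?k (three_term_map ?k y))"
      using transition.three_term[OF x(2)] positive_three_term_map(2)[OF p] by blast
    moreover have "three_term_map ?k (three_term_map ?k y) = y"
      by (rule three_term_map_involution[OF step.prems]) simp
    ultimately show ?thesis using x(1) jw braid by auto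
  qed
qed

lemma step_orbit: "g \<in> orbit \<Longrightarrow> i \<in> I \<Longrightarrow> step i g h \<Longrightarrow> h \<in> orbit"
  using lower_closed by (auto simp: step_def)

lemma comb_trail_orbit:
  assumes "comb_trail w g d p" "g \<in> orbit" "w \<in> lists I" "k \<le> length w"
  shows "p ! k \<in> orbit"
  using assms(4)
proof (induction k)
  case 0
  then show ?case using assms by (simp add: comb_trail_def)
next
  case (Suc k)
  then have "step (w ! k) (p ! k) (p ! Suc k)" "w ! k \<in> I"
    using assms by (auto simp: comb_trail_def in_lists_conv_set)
  then show ?case using step_orbit Suc by simp
qed

text \<open>Going back from the end of the path, a descent is undone by a raising operator on a
  nonzero vector with coordinate -1, where it cannot vanish. A stationary step applies no
  operator.\<close>

lemma trail_vector:
  assumes p: "comb_trail w g d p" "g \<in> orbit" "w \<in> lists I"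
    and c: "\<And>k. c (Suc k) = (if p ! Suc k = p ! k then 0 else 1 :: nat)"
    and v: "v \<in> wspace d" "v \<noteq> 0" and m: "m \<le> length w"
  shows "foldr (\<lambda>k T. (up (letter w k) ^^ c k) \<circ> T) [Suc m..<length w + 1] id v \<in> wspace (p ! m) \<and>
    foldr (\<lambda>k T. (up (letter w k) ^^ c k) \<circ> T) [Suc m..<length w + 1] id v \<noteq> 0"
  using m
proof (induction rule: inc_induct)
  case base
  then show ?case using p(1) v by (simp add: comb_trail_def)
next
  case (step m)
  let ?u = "foldr (\<lambda>k T. (up (letter w k) ^^ c k) \<circ> T) [Suc (Suc m)..<length w + 1] id v"
  have f: "foldr (\<lambda>k T. (up (letter w k) ^^ c k) \<circ> T) [Suc m..<length w + 1] id v = (up (w ! m) ^^ c (Suc m)) ?u"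
    using step.hyps by (subst upt_conv_Cons) (simp_all add: letter_def)
  have s: "step (w ! m) (p ! m) (p ! Suc m)" and i: "w ! m \<in> I"
    using p step.hyps by (auto simp: comb_trail_def in_lists_conv_set)
  show ?case
  proof (cases "p ! Suc m = p ! m")
    case True
    then have "c (Suc m) = 0" using c by simp
    moreover have "?u \<in> wspace (p ! m) \<and> ?u \<noteq> 0" using step.IH True by metis
    ultimately show ?thesis unfolding f by (simp only: funpow_0 simp_thms)
  next
    case False
    then have h: "(p ! m) (w ! m) = 1" "p ! Suc m = (\<lambda>l. (p ! m) l - cmat (w ! m) l)" using s by (auto simp: step_def)
    have "up (w ! m) ?u \<in> wspace (\<lambda>l. (p ! Suc m) l + cmat (w ! m) l)"
      using up_weight[OF i] step.IH by blast
    moreover have "(\<lambda>l. (p ! Suc m) l + cmat (w ! m) l) = p ! m" unfolding h(2) by simp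
    moreover have "(p ! Suc m) (w ! m) < 0" unfolding h(2) using h(1) diag[OF i] by simp
    then have "up (w ! m) ?u \<noteq> 0" using up_nonzero[OF i] step.IH by blast
    moreover have "c (Suc m) = Suc 0" using c False by simp
    ultimately show ?thesis unfolding f by (simp only: funpow.simps comp_apply id_apply simp_thms)
  qed
qed

text \<open>At a letter, consecutive coordinates lie in {-1, 0, 1} and differ by twice the exponent.
  So the exponent is 0 or 1, and 1 only for a step from 1 to -1. Conversely
  \<open>trail_vector\<close> provides the nonzero operator product.\<close>

lemma trails_eq:
  assumes w: "w \<in> lists I" and g: "g \<in> orbit" and d: "d \<in> orbit"
  shows "trails G L \<iota> sc \<rho> w (coweight g) (coweight d) = map coweight ` Collect (comb_trail w g d)"
proof (intro equalityI subsetI)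
  fix \<pi> assume "\<pi> \<in> trails G L \<iota> sc \<rho> w (coweight g) (coweight d)"
  then obtain c where \<pi>: "length \<pi> = length w + 1" "\<pi> ! 0 = coweight g" "\<pi> ! length w = coweight d"
    "set \<pi> \<subseteq> coweight ` orbit"
    and c: "\<And>k. k \<in> {1..length w} \<Longrightarrow> \<pi> ! (k - 1) - \<pi> ! k = smult G (of_nat (c k)) (scoroot G (letter w k))"
    unfolding trails_def module_weights_eq by blast
  define p where "p = map (inv_into orbit coweight) \<pi>"
  have p: "p ! k \<in> orbit" "coweight (p ! k) = \<pi> ! k" if "k \<le> length w" for k
  proof -
    have "\<pi> ! k \<in> coweight ` orbit" using that \<pi> nth_mem[of k \<pi>] by auto
    then show "p ! k \<in> orbit" "coweight (p ! k) = \<pi> ! k"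
      using that \<pi> by (simp_all add: p_def inv_into_into f_inv_into_f)
  qed
  have "step (w ! k) (p ! k) (p ! Suc k)" if k: "k < length w" for k
  proof -
    let ?i = "w ! k" and ?n = "int (c (Suc k))"
    have i: "?i \<in> I" using w k by (simp add: in_lists_conv_set)
    have o: "p ! k \<in> orbit" "p ! Suc k \<in> orbit" using p k by auto
    have "coweight (p ! k) = coweight (p ! Suc k) + smult G (of_int ?n) (coweight (cmat ?i))"
      using c[of "Suc k"] k p(2)[of k] p(2)[of "Suc k"]
      by (simp add: letter_def scoroot_coweight[OF i] diff_eq_eq add.commute)
    then have "coweight (p ! k) = coweight (\<lambda>l. (p ! Suc k) l + ?n * cmat ?i l)" by (simp add: coweight_add)
    then have "(p ! k) l = (p ! Suc k) l + ?n * cmat ?i l" for l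
      using coweight_inject[of _ _ l] orbit_outside[OF o(1), of l] orbit_outside[OF o(2), of l] outside[of l ?i]
      by (cases "l \<in> I") auto
    then have eq: "p ! k = (\<lambda>l. (p ! Suc k) l + ?n * cmat ?i l)" by (rule ext)
    have "(p ! k) ?i = (p ! Suc k) ?i + ?n * 2" using eq diag[OF i] by metis
    moreover have "(p ! k) ?i \<in> {- 1, 0, 1}" "(p ! Suc k) ?i \<in> {- 1, 0, 1}" using bound o i by blast+
    ultimately have "?n = 0 \<or> ?n = 1 \<and> (p ! k) ?i = 1" by auto
    then show ?thesis
    proof
      assume "?n = 0"
      then have "p ! k = p ! Suc k" using eq by simp
      then show ?thesis by (simp add: step_def)
    next
      assume n: "?n = 1 \<and> (p ! k) ?i = 1"
      have "(p ! Suc k) = (\<lambda>l. (p ! k) l - cmat ?i l)" by (rule ext) (subst eq, use n in simp)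
      then show ?thesis using n by (simp add: step_def)
    qed
  qed
  moreover have "p ! 0 = g" "p ! length w = d" using p[of 0] p[of "length w"] \<pi> g d coweight_inj_orbit by auto
  moreover have "length p = Suc (length w)" using \<pi> by (simp add: p_def)
  ultimately have "comb_trail w g d p" by (simp add: comb_trail_def)
  moreover have "\<pi> = map coweight p" using \<pi>(1) p(2) by (intro nth_equalityI) (auto simp: p_def less_Suc_eq_le)
  ultimately show "\<pi> \<in> map coweight ` Collect (comb_trail w g d)" by blast
next
  fix \<pi> assume "\<pi> \<in> map coweight ` Collect (comb_trail w g d)"
  then obtain p where p: "comb_trail w g d p" and \<pi>: "\<pi> = map coweight p" by blast
  have len: "length p = Suc (length w)" using p by (simp add: comb_trail_def)
  have po: "p ! k \<in> orbit" if "k \<le> length w" for k using comb_trail_orbit[OF p g w that] .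
  define c where "c k = (if p ! k = p ! (k - 1) then 0 else 1 :: nat)" for k
  have "\<pi> ! (k - 1) - \<pi> ! k = smult G (of_nat (c k)) (scoroot G (letter w k))" if k: "k \<in> {1..length w}" for k
  proof -
    obtain m where m: "k = Suc m" "m < length w" using k by (cases k) auto
    have i: "w ! m \<in> I" using w m by (simp add: in_lists_conv_set)
    have s: "step (w ! m) (p ! m) (p ! Suc m)" using p m by (simp add: comb_trail_def)
    show ?thesis
    proof (cases "p ! Suc m = p ! m")
      case True
      then show ?thesis using m len by (simp add: \<pi> c_def)
    next
      case False
      then have 2: "p ! Suc m = (\<lambda>l. (p ! m) l + (- 1) * cmat (w ! m) l)" using s by (simp add: step_def)
      have "coweight (p ! Suc m) = coweight (p ! m) + smult G (of_int (- 1)) (coweight (cmat (w ! m)))"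
        by (subst 2) (rule coweight_add)
      then show ?thesis using m len False by (simp add: \<pi> c_def letter_def scoroot_coweight[OF i])
    qed
  qed
  moreover obtain v where v: "v \<in> wspace d" "v \<noteq> 0"
    using orbit_is_weight[OF d] by (auto simp: is_weight_def)
  have "foldr (\<lambda>k T. (up (letter w k) ^^ c k) \<circ> T) [1..<length w + 1] id v \<noteq> 0"
    using trail_vector[OF p g w _ v, of c 0] by (simp add: c_def)
  moreover have "set \<pi> \<subseteq> coweight ` orbit"
    using po len by (auto simp: \<pi> in_set_conv_nth less_Suc_eq_le)
  moreover have "length \<pi> = length w + 1" "\<pi> ! 0 = coweight g" "\<pi> ! length w = coweight d"
    using p len by (auto simp: \<pi> comb_trail_def)
  ultimately show "\<pi> \<in> trails G L \<iota> sc \<rho> w (coweight g) (coweight d)"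
    unfolding trails_def module_weights_eq using v(1) by blast
qed

lemma trail_coeff_sum:
  assumes p: "comb_trail w g d p" and w: "w \<in> lists I"
  shows "(\<Sum>k = 1..length w. trail_coeff G w (map coweight p) k * t k) = trail_value t 1 w p"
proof -
  have len: "length p = Suc (length w)" using p by (simp add: comb_trail_def)
  have tc: "trail_coeff G w (map coweight p) (Suc l) = of_int (step_exponent (w ! l) (p ! l) (p ! Suc l))"
    if l: "l < length w" for l
  proof -
    let ?i = "w ! l"
    have i: "?i \<in> I" using w l by (simp add: in_lists_conv_set)
    have s: "step ?i (p ! l) (p ! Suc l)" using p l by (simp add: comb_trail_def)
    have "sroot G ?i (smult G (1 / 2) (coweight (p ! l) + coweight (p ! Suc l))) =
        1 / 2 * (of_int ((p ! l) ?i) + of_int ((p ! Suc l) ?i))"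
      by (simp add: dual_csaD[OF sroot_dual[OF i]] csa_closed coweight_csa sroot_coweight[OF i])
    also have "\<dots> = complex_of_real ((of_int ((p ! l) ?i) + of_int ((p ! Suc l) ?i)) / 2)" by simp
    finally have "Re (sroot G ?i (smult G (1 / 2) (coweight (p ! l) + coweight (p ! Suc l)))) =
        (of_int ((p ! l) ?i) + of_int ((p ! Suc l) ?i)) / 2" by (simp only: Re_complex_of_real)
    then have a: "trail_coeff G w (map coweight p) (Suc l) = (of_int ((p ! l) ?i) + of_int ((p ! Suc l) ?i)) / 2"
      using l len by (simp only: trail_coeff_def letter_def diff_Suc_1 nth_map less_SucI Suc_mono)
    show ?thesis
    proof (cases "p ! Suc l = p ! l")
      case True
      then show ?thesis unfolding a by (simp add: step_exponent_def)
    next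
      case False
      then have h: "(p ! l) ?i = 1" "p ! Suc l = (\<lambda>k. (p ! l) k - cmat ?i k)" using s by (auto simp: step_def)
      then have "(p ! Suc l) ?i = - 1" using diag[OF i] by simp
      then show ?thesis unfolding a using False h(1) by (simp add: step_exponent_def)
    qed
  qed
  have "(\<Sum>k = 1..length w. trail_coeff G w (map coweight p) k * t k) =
      (\<Sum>l<length w. trail_coeff G w (map coweight p) (Suc l) * t (Suc l))"
    by (rule sum.reindex_bij_witness[of _ Suc "\<lambda>k. k - 1"]) auto
  also have "\<dots> = trail_value t 1 w p"
    unfolding trail_value_def using tc by (intro sum.cong refl) (simp add: mult.commute)
  finally show ?thesis .
qed

end


section \<open>Rational functions attached to reduced words\<close>

context cartan_matrix
begin

lemma extremalI:
  assumes "\<And>u k v. w = u @ k # v \<Longrightarrow> dual_act v d k \<in> {- 1, 0}" shows "extremal w d"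
  using assms
proof (induction w)
  case (Cons j w)
  have "extremal w d" by (rule Cons.IH) (use Cons.prems[of "j # _"] in simp)
  moreover have "dual_act w d j \<in> {- 1, 0}" using Cons.prems[of "[]"] by simp
  ultimately show ?case by simp
qed simp

end

context simply_laced_setting
begin

lemma root_of_coweight: "root_of q (coweight p) = of_int (pairing p q)"
  by (simp add: root_of_def pairing_def sroot_coweight mult.commute)

end

text \<open>\<open>s\<close> is the star of \<open>i\<close>, characterised by the action of the
  longest element on simple roots; \<open>w0\<close> is some reduced word of that element.\<close>

locale trail_setting = minuscule_module +
  fixes i :: nat and w0 :: "nat list"
  assumes i: "i \<in> I" and w0: "longest w0" and i_s: "act w0 (unit i) = (\<lambda>k. - unit s k)"
begin

text \<open>The final weight of the trails. The longest element takes the fundamental coweight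
  \<open>s\<close> to minus the fundamental coweight \<open>i\<close> and carries the reflection
  \<open>s\<close> to the reflection \<open>i\<close>; reflecting that negative coweight adds the
  simple coroot \<open>i\<close>.\<close>

definition \<delta> :: "nat \<Rightarrow> int" where "\<delta> = (\<lambda>l. - unit i l + cmat i l)"

abbreviation "N \<equiv> longest_length G"

lemma act_longest: "longest w \<Longrightarrow> act w = act w0"
  using longest_unique w0 by blast

lemma longest_lists: "longest w \<Longrightarrow> w \<in> lists I"
  by (simp add: longest_def reduced_def)

lemma dual_longest: "longest w \<Longrightarrow> dual_act w (unit s) = (\<lambda>k. - unit i k)"
  "longest w \<Longrightarrow> dual_act w (\<lambda>k. - unit i k) = unit s"
proof -
  assume w: "longest w"
  have a: "act w (unit i) = (\<lambda>k. - unit s k)" using i_s act_longest[OF w] by simp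
  show "dual_act w (unit s) = (\<lambda>k. - unit i k)" by (rule dual_longest_unit[OF w i s a])
  have "dual_act w (unit i) = (\<lambda>k. - unit s k)"
    by (rule dual_longest_unit[OF w s i longest_swap[OF w a]])
  then show "dual_act w (\<lambda>k. - unit i k) = unit s" by (simp add: dual_act_uminus)
qed

lemma \<delta>_eq: "dual_act w0 (dual_refl s (unit s)) = \<delta>"
proof -
  have "unit s s = 1" by (simp add: unit_def)
  then
  have "dual_refl s (unit s) = (\<lambda>l. unit s l - pair l (unit s))"
    using s local.sym[of s] \<open>unit s s = 1\<close> by (auto simp: dual_refl_def)
  then have "dual_act w0 (dual_refl s (unit s)) =
      (\<lambda>l. dual_act w0 (unit s) l - pair l (act w0 (unit s)))"
    by (simp only: dual_act_diff dual_act_pair[OF longest_lists[OF w0]])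
  also have "\<dots> = \<delta>"
    unfolding dual_longest(1)[OF w0] longest_swap[OF w0 i_s] \<delta>_def
    using pair_scale[of _ "- 1" "unit i"] i local.sym[of i] by (intro ext) simp
  finally show ?thesis .
qed

lemma \<delta>_orbit: "\<delta> \<in> orbit"
  using \<delta>_eq closed[OF unit_in_orbit s] longest_lists[OF w0] dual_act_append[of w0 "[s]" "unit s"] s
  unfolding orbit_def by (intro CollectI exI[of _ "w0 @ [s]"]) simp

lemma \<delta>_refl: "dual_refl i (\<lambda>k. - unit i k) = \<delta>"
  by (auto simp: dual_refl_def \<delta>_def unit_def)

text \<open>The last step has to stay at \<open>\<delta>\<close>, whose coordinate 1 at
  \<open>i\<close> gives the factor. The prefix \<open>u\<close> takes \<open>\<delta>\<close> to
  \<open>unit s\<close> through extremal weights, so its sum is 1.\<close>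

lemma trail_sum_last:
  fixes m :: "nat \<Rightarrow> int \<Rightarrow> 'r::comm_ring_1"
  assumes m0: "\<And>k. m k 0 = 1" and l: "longest (u @ [i])"
  shows "trail_sum m 1 (u @ [i]) (\<lambda>g. if g = \<delta> then 1 else 0) (unit s) = m (Suc (length u)) 1"
proof -
  let ?k = "Suc (length u)"
  have red: "reduced (u @ [i])" using l by (simp add: longest_def)
  have ul: "u \<in> lists I" using longest_lists[OF l] by simp
  have \<delta>i: "\<delta> i = 1" using diag[OF i] by (simp add: \<delta>_def unit_def)
  have last: "trail_sum m ?k [i] (\<lambda>g. if g = \<delta> then 1 else 0) = (\<lambda>g. m ?k 1 * (if g = \<delta> then 1 else 0))"
  proof
    fix g
    \<comment> \<open>A descent along \<open>i\<close> ends at coordinate -1, but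
      \<open>\<delta>\<close> has coordinate 1 there.\<close>
    have "(\<lambda>l. g l - cmat i l) \<noteq> \<delta>" if "g i = 1"
      using \<delta>i diag[OF i] that by (metis diff_eq_eq one_add_one add_left_cancel zero_neq_numeral add.right_neutral)
    then show "trail_sum m ?k [i] (\<lambda>g. if g = \<delta> then 1 else 0) g = m ?k 1 * (if g = \<delta> then 1 else 0)"
      using \<delta>i by auto
  qed
  have "extremal u \<delta>"
  proof (rule extremalI)
    fix a k v assume u: "u = a @ k # v"
    have k: "k \<in> I" "v \<in> lists I" using ul u by auto
    \<comment> \<open>In the reversed word the letter \<open>k\<close> follows the inverse of
      \<open>v @ [i]\<close>, so reducedness makes the corresponding root positive. Its coefficient
      at \<open>i\<close> is minus the coordinate in question.\<close>
    have "reduced (rev (u @ [i]))" using red by (rule reduced_rev)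
    then have "reduced ((rev (v @ [i]) @ [k]) @ rev a)" using u by simp
    then have "nonneg (act (rev (v @ [i])) (unit k))" using reduced_prefix reduced_snoc_nonneg by blast
    moreover have "dual_act v \<delta> k = dual_act (v @ [i]) (\<lambda>k. - unit i k) k"
      by (simp add: dual_act_append \<delta>_refl)
    then have "dual_act v \<delta> k = - act (rev (v @ [i])) (unit k) i"
      using dual_act_nth[of "v @ [i]" k] k i by (simp add: pairing_uminus pairing_unit)
    ultimately have "dual_act v \<delta> k \<le> 0" by (simp add: nonneg_def)
    moreover have "dual_act v \<delta> \<in> orbit"
      using \<delta>_orbit k(2) unfolding orbit_def by (auto simp flip: dual_act_append) (metis append_in_lists_conv in_listsI)
    then have "dual_act v \<delta> k \<in> {- 1, 0, 1}" using bound k by blast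
    ultimately show "dual_act v \<delta> k \<in> {- 1, 0}" by auto
  qed
  moreover have "dual_act u \<delta> = unit s" using dual_longest(2)[OF l] by (simp add: dual_act_append \<delta>_refl)
  ultimately have "trail_sum m 1 u (\<lambda>g. if g = \<delta> then 1 else 0) (unit s) = 1"
    using trail_sum_extremal[of m u \<delta> 1] not_dominated_raise m0 ul by auto
  moreover have "trail_sum m 1 (u @ [i]) (\<lambda>g. if g = \<delta> then 1 else 0) (unit s) =
      m ?k 1 * trail_sum m 1 u (\<lambda>g. if g = \<delta> then 1 else 0) (unit s)"
    unfolding trail_sum_append[of m 1 u] using last by (simp add: trail_sum_scale)
  ultimately show ?thesis by simp
qed

definition trail_ratfun :: "nat list \<Rightarrow> ratfun" where
  "trail_ratfun w = Fract (trail_poly 1 w \<delta> (unit s)) 1"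

lemma trail_poly_ring:
  assumes "length w = N"
  shows "trail_poly 1 w d g \<in> laurent_ring N"
    and "x \<in> torus N \<Longrightarrow> laurent_eval (trail_poly 1 w d g) x =
      trail_sum (powers x) 1 w (\<lambda>g. laurent_eval (end_indicator d g) x) g"
proof -
  have f: "end_indicator d g \<in> laurent_ring N" for g by (simp add: end_indicator_def)
  \<comment> \<open>\<open>trail_sum_eval\<close> asks for a point of the torus even for membership
    in the ring; any point will do.\<close>
  have "(\<lambda>_. 1) \<in> torus N" by (simp add: torus_def)
  then show "trail_poly 1 w d g \<in> laurent_ring N" using trail_sum_eval[OF _ f, of _ 1 w] assms by simp
  show "x \<in> torus N \<Longrightarrow> laurent_eval (trail_poly 1 w d g) x =
      trail_sum (powers x) 1 w (\<lambda>g. laurent_eval (end_indicator d g) x) g"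
    using trail_sum_eval[OF _ f, of x 1 w] assms by simp
qed

lemma indicator_eval: "laurent_eval (end_indicator d g) x = (if g = d then 1 else 0)"
  by (simp add: end_indicator_def)

lemma longest_nonempty: "longest w \<Longrightarrow> w \<noteq> []"
  using i unit_nonneg(2)[of i] by (auto simp: longest_def)

lemma trail_ratfun_last: "longest w \<Longrightarrow> letter w N = i \<Longrightarrow> trail_ratfun w = Fract (laurent_var N) 1"
proof -
  assume l: "longest w" and li: "letter w N = i"
  have N: "length w = N" using longest_length_eq[OF l] by simp
  have "last w = i" using li N longest_nonempty[OF l] by (simp add: letter_def last_conv_nth)
  then obtain u where u: "w = u @ [i]" using longest_nonempty[OF l] by (metis append_butlast_last_id)
  then have "Suc (length u) = N" using N by simp
  then show ?thesis
    using trail_sum_last[of "\<lambda>k a. single (single k a) 1 :: laurent" u] l u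
    by (simp add: trail_ratfun_def end_indicator_def laurent_var_def)
qed

lemma trail_ratfun_sigma_family: "sigma_family G i trail_ratfun"
  unfolding sigma_family_def reduced_words_w0_iff Ball_def
proof (intro conjI allI impI)
  fix w assume w: "longest w"
  show "trail_ratfun w \<in> ratfun_field N" unfolding trail_ratfun_def
    by (rule Fract_in_ratfun_field, rule trail_poly_ring) (simp add: longest_length_eq[OF w])
  show "trail_ratfun w = Fract (laurent_var N) 1" if "letter w N = i" using trail_ratfun_last[OF w that] .
next
  fix w u x y a b
  assume w: "longest w" and u: "longest u"
    and t: "transition G u x w y \<and> ratfun_value N (trail_ratfun w) y a \<and> ratfun_value N (trail_ratfun u) x b"
  have len: "length w = N" "length u = N" using longest_length_eq[OF w] longest_length_eq[OF u] by simp_all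
  have x: "x \<in> torus N" using transition_start_torus t len(2) by metis
  have T: "y \<in> torus N" "trail_sum (powers y) 1 w f (unit s) = trail_sum (powers x) 1 u f (unit s)" for f
    using transition_trail_sum[of u x w y "unit s" f] t len longest_lists[OF u] unit_in_orbit by auto
  have "a = laurent_eval (trail_poly 1 w \<delta> (unit s)) y"
    using t ratfun_value_Fract[OF trail_poly_ring(1)[OF len(1)] T(1)] by (auto simp: trail_ratfun_def)
  moreover have "b = laurent_eval (trail_poly 1 u \<delta> (unit s)) x"
    using t ratfun_value_Fract[OF trail_poly_ring(1)[OF len(2)] x] by (auto simp: trail_ratfun_def)
  ultimately show "a = b"
    unfolding trail_poly_ring(2)[OF len(1) T(1)] trail_poly_ring(2)[OF len(2) x] indicator_eval using T(2) by simp
qed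

lemma ex_longest_last: "\<exists>u. longest (u @ [i])"
proof -
  have "reduced w0" "nonpos (act w0 (unit i))" using w0 i by (auto simp: longest_def)
  then obtain u where u: "reduced (u @ [i])" "act (u @ [i]) = act w0" using nonpos_ex_reduced_snoc i by blast
  then have "longest (u @ [i])" using w0 unfolding longest_def by metis
  then show ?thesis ..
qed

text \<open>At a word ending in \<open>i\<close> both families are the last variable. Every positive
  point for \<open>w\<close> is reached from such a word, so both functions take the same value
  there whenever they are regular.\<close>

lemma sigma_family_unique:
  assumes f: "sigma_family G i f" and h: "sigma_family G i h" and w: "longest w"
  shows "f w = h w"
proof -
  obtain u where u: "longest (u @ [i])" using ex_longest_last by blast
  let ?u = "u @ [i]"
  have N: "Suc (length u) = N" using longest_length_eq[OF u] by simp
  then have li: "letter ?u N = i" by (auto simp: letter_def nth_append)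
  have mv: "braid_equiv ?u w" using matsumoto u w longest_unique by (simp add: longest_def)
  have var: "laurent_var N \<in> laurent_ring N" unfolding laurent_var_def
    by (rule laurent_ring_single) (use N in auto)
  have val: "a = laurent_eval (laurent_var N) x"
    if "sigma_family G i k" "transition G ?u x w y" "ratfun_value N (k w) y a" for k x y a
  proof -
    have "k ?u = Fract (laurent_var N) 1" using that(1) u li by (auto simp: sigma_family_def reduced_words_w0_iff)
    then have "ratfun_value N (k ?u) x (laurent_eval (laurent_var N) x)" using ratfun_value_FractI[OF var] by simp
    moreover have "w \<in> reduced_words_w0 G" "?u \<in> reduced_words_w0 G" using u w reduced_words_w0_iff by auto
    ultimately show ?thesis using that unfolding sigma_family_def by blast
  qed
  show ?thesis
  proof (rule ratfun_eqI[of _ N])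
    show "f w \<in> ratfun_field N" "h w \<in> ratfun_field N"
      using f h w by (auto simp: sigma_family_def reduced_words_w0_iff)
    fix y a b assume y: "positive y" and ab: "ratfun_value N (f w) y a" "ratfun_value N (h w) y b"
    obtain x where "transition G ?u x w y" using positive_transition[OF mv longest_lists[OF u] y] by blast
    then show "a = b" using val[OF f _ ab(1)] val[OF h _ ab(2)] by metis
  qed
qed

lemma sigma_eq: "longest w \<Longrightarrow> sigma G w i = trail_ratfun w"
  unfolding sigma_def by (rule the_equality) (use trail_ratfun_sigma_family sigma_family_unique in blast)+

lemma tropicalization_sigma:
  assumes w: "longest w"
  shows "tropicalization (laurent_of_ratfun (sigma G w i)) t =
    Min ((\<lambda>\<pi>. \<Sum>k = 1..N. trail_coeff G w \<pi> k * t k) ` trails G L \<iota> sc \<rho> w (coweight (unit s)) (coweight \<delta>))"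
proof -
  have wl: "w \<in> lists I" using longest_lists[OF w] .
  have "(\<lambda>\<pi>. \<Sum>k = 1..N. trail_coeff G w \<pi> k * t k) ` trails G L \<iota> sc \<rho> w (coweight (unit s)) (coweight \<delta>) =
      trail_value t 1 w ` Collect (comb_trail w (unit s) \<delta>)"
    unfolding trails_eq[OF wl unit_in_orbit \<delta>_orbit] longest_length_eq[OF w] image_image
    using trail_coeff_sum[OF _ wl] by (intro image_cong refl) simp
  also have "\<dots> = trop_weight t ` keys (trail_poly 1 w \<delta> (unit s))"
    by (rule trop_trail_poly[symmetric]) (use wl in auto)
  finally show ?thesis
    unfolding sigma_eq[OF w] trail_ratfun_def laurent_of_ratfun_Fract tropicalization_def trop_weight_def by simp
qed

end

theorem proposition8:
  fixes G :: "'g::ab_group_add lie_data"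
    and L :: "'l::ab_group_add lie_data"
    and \<iota> :: "('g \<Rightarrow> complex) \<Rightarrow> 'l"
    and sc :: "complex \<Rightarrow> 'v::ab_group_add \<Rightarrow> 'v"
    and \<rho> :: "'l \<Rightarrow> 'v \<Rightarrow> 'v"
    and i :: nat and iw :: "nat list" and t :: "nat \<Rightarrow> real"
  assumes "simple_lie_algebra G" and "simply_laced G"
    and "langlands_dual G L \<iota>"
    and "i \<in> index_set G" and "minuscule G i"
    and "iw \<in> reduced_words_w0 G"
    and "highest_weight_module G L \<iota> sc \<rho> (fund_coweight G (star_index G i))"
  shows "tropicalization (laurent_of_ratfun (sigma G iw i)) t =
    Min ((\<lambda>\<pi>. \<Sum>k = 1..longest_length G. trail_coeff G iw \<pi> k * t k) `
      trails G L \<iota> sc \<rho> iw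
        (fund_coweight G (star_index G i))
        (longest_element G (simple_reflection G (star_index G i)
          (fund_coweight G (star_index G i)))))"
proof -
  interpret dual_setting G L \<iota> by unfold_locales (fact assms)+
  let ?s = "star_index G i"
  have l: "longest iw" using assms(6) reduced_words_w0_iff by blast
  have iwl: "iw \<in> lists (index_set G)" using l by (simp add: longest_def reduced_def)
  note s = star_index_longest[OF l assms(4)]
  \<comment> \<open>Minusculeness of \<open>i\<close> bounds the coefficients of roots at
    \<open>i\<close>. Up to sign, the coefficient of a root at \<open>?s\<close> is the coefficient
    at \<open>i\<close> of its image under the longest element, which is again a root.\<close>
  have bound: "act w (unit j) ?s \<in> {- 1, 0, 1}" if w: "w \<in> lists (index_set G)" and j: "j \<in> index_set G" for w j
  proof -
    let ?q = "act w (unit j)"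
    have "act (iw @ w) (unit j) i = pairing (unit i) (act iw ?q)"
      using assms(4) by (simp add: pairing_unit act_append)
    also have "act iw ?q = act (rev (rev iw)) ?q" by simp
    also have "pairing (unit i) \<dots> = pairing (dual_act (rev iw) (unit i)) ?q"
      using pairing_dual_act[of "rev iw"] iwl by (simp add: in_lists_conv_set)
    also have "dual_act (rev iw) (unit i) = (\<lambda>k. - unit ?s k)"
      using dual_longest_unit[OF longest_rev[OF l] s(1) assms(4)] longest_swap[OF l s(2)]
        longest_involution[OF l] by simp
    also have "pairing \<dots> ?q = - ?q ?s" using s(1) by (simp add: pairing_uminus pairing_unit)
    finally have e: "act (iw @ w) (unit j) i = - ?q ?s" .
    have "root_of (act (iw @ w) (unit j)) \<in> root_system G" by (rule root_of_act) (use iwl w j in auto)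
    then have "root_of (act (iw @ w) (unit j)) (coweight (unit i)) \<in> {- 1, 0, 1}"
      using assms(5) coweight_unit[OF assms(4)] by (simp add: minuscule_def)
    then have "(of_int (- ?q ?s) :: complex) \<in> {of_int (- 1), of_int 0, of_int 1}"
      using e assms(4) by (simp add: root_of_coweight pairing_unit)
    then have "- ?q ?s \<in> {- 1, 0, 1}" unfolding insert_iff of_int_eq_iff by blast
    then show ?thesis by auto
  qed
  interpret trail_setting G L \<iota> sc \<rho> ?s i iw
    by unfold_locales (use assms s l bound in auto)
  have "longest_element G (simple_reflection G ?s (fund_coweight G ?s)) = coweight \<delta>"
    unfolding longest_element_eq[OF l] coweight_unit[OF s(1), symmetric] simple_reflection_coweight[OF s(1)]
      word_product_coweight[OF iwl] \<delta>_eq ..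
  then show ?thesis using tropicalization_sigma[OF l] by (simp add: coweight_unit[OF s(1)])
qed

end
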